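(* Let $k\ge 4$ be an integer and let $p^*=p^*(n)=(e/n)^{1/k}$. For $n\ge 2k+1$ let $H$ denote the $k$-th power of a Hamilton cycle on $n$ vertices, i.e. the graph on vertex set $[n]=\{1,\dots,n\}$ with edge set $\{\{v,v+i\}: v\in[n],\ i\in[k]\}$ (addition modulo $n$). Then for every $\varepsilon>0$: (i) if $p=p(n)\le (1-\varepsilon)p^*$, then with high probability the binomial random graph $G(n,p)$ contains no copy of $H$; (ii) if $p=p(n)\ge (1+\varepsilon)p^*$, then with high probability $G(n,p)$ contains a copy of $H$.
   Context: $G(n,p)$ is the binomial random graph on vertex set $[n]$ in which each of the $\binom n2$ potential edges is present independently with probability $p$. An event holds with high probability if its probability tends to $1$ as $n\to\infty$. *)

theory Defs
  imports "HOL-Probability.Probability" "HOL-Number_Theory.Cong"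
begin

type_synonym 'a graph = "'a set \<times> 'a set set"

abbreviation verts :: "'a graph \<Rightarrow> 'a set" where
  "verts \<equiv> fst"

abbreviation edges :: "'a graph \<Rightarrow> 'a set set" where
  "edges \<equiv> snd"

definition simple_graph :: "'a graph \<Rightarrow> bool" where
  "simple_graph G \<longleftrightarrow> finite (verts G) \<and> (\<forall>e\<in>edges G. e \<subseteq> verts G \<and> card e = 2)"

definition subgraph :: "'a graph \<Rightarrow> 'a graph \<Rightarrow> bool" where
  "subgraph G' G \<longleftrightarrow> simple_graph G' \<and> verts G' \<subseteq> verts G \<and> edges G' \<subseteq> edges G"

definition graph_iso :: "'a graph \<Rightarrow> 'b graph \<Rightarrow> bool" where
  "graph_iso G H \<longleftrightarrow>
    (\<exists>\<phi>. bij_betw \<phi> (verts G) (verts H) \<and> (\<lambda>e. \<phi> ` e) ` edges G = edges H)"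

definition contains_copy :: "'a graph \<Rightarrow> 'b graph \<Rightarrow> bool" where
  "contains_copy G H \<longleftrightarrow> (\<exists>G'. subgraph G' G \<and> graph_iso H G')"

definition potential_edges :: "nat \<Rightarrow> nat set set" where
  "potential_edges n = {e. e \<subseteq> {1..n} \<and> card e = 2}"

definition binomial_random_graph :: "nat \<Rightarrow> real \<Rightarrow> nat graph pmf" where
  "binomial_random_graph n p =
    map_pmf (\<lambda>present. ({1..n}, {e \<in> potential_edges n. present e}))
      (Pi_pmf (potential_edges n) False (\<lambda>_. bernoulli_pmf p))"

(* The congruence expresses w = v + i modulo n with the representative w taken in {1..n}.
   This is a simple graph, 2k-regular, when n >= 2k + 1; for n <= k it would have
   singleton "edges", so the definition is meaningful only for larger n. *)
definition hamilton_cycle_power :: "nat \<Rightarrow> nat \<Rightarrow> nat graph" where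
  "hamilton_cycle_power k n =
    ({1..n}, {{v, w} |v w i. v \<in> {1..n} \<and> w \<in> {1..n} \<and> i \<in> {1..k} \<and> [w = v + i] (mod n)})"

definition p_star :: "nat \<Rightarrow> nat \<Rightarrow> real" where
  "p_star k n = (exp 1 / real n) powr (1 / real k)"

definition with_high_probability :: "(nat \<Rightarrow> 'a pmf) \<Rightarrow> (nat \<Rightarrow> 'a \<Rightarrow> bool) \<Rightarrow> bool" where
  "with_high_probability M A \<longleftrightarrow> (\<lambda>n. measure_pmf.prob (M n) {x. A n x}) \<longlonglongrightarrow> 1"

end

theory Submission
  imports Defs "HOL-Real_Asymp.Real_Asymp"
begin

text \<open>
  The lower bound is the first moment: $n!\,p^{kn}$ is about $(p/p^*)^{kn}$ by Stirling.

  The upper bound is a second moment for the number of copies, where each copy is weighted by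
  $\beta^{e(G)}$ with $\beta = 1 - 2k/(np)$. The plain second moment fails, because single common
  edges of two copies contribute $\exp(2k^2/p)$; the tilt by $\beta$ cancels precisely this factor,
  as passing to a fixed number of edges would, but keeps the edges independent.

  What remains is the average of $(1+y)^{|E \cap \sigma E|}$ over permutations $\sigma$, with
  $y$ about $1/p$. It is expanded over the edge sets $S$ common to both copies, and $S$ is split
  into connected components, which turns the sum into the exponential of a sum over connected edge
  sets (polymers). A polymer is scanned along the cycle: a vertex joined to all $k$ predecessors
  contributes at most $e y^k/n < 1$ and has no freedom in its image, since a
  $(k+1)$-clique of the cycle power is an interval and can be continued in one way only.
  Every other vertex contributes a power of $n^{-1/k}$ that beats any constant. Polymers on two
  vertices give the factor $\exp(2k^2y)$ above, and those on at least three vertices contribute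
  $O(n^{3/k-1})$, which is where $k \ge 4$ enters.
\<close>

section \<open>Cliques in the cycle power\<close>

text \<open>Replacing \<open>(n - v)! / n!\<close> by \<open>1 / n ^ v\<close> costs a factor up to
  \<open>e ^ v\<close> for an edge set on \<open>v\<close> vertices. Charged to single common edges,
  this would raise their contribution to \<open>exp (2 e^2 k^2 y)\<close>, which the tilt can no
  longer cancel. The expansion is therefore bounded by two sums: sets on at most \<open>V\<close>
  vertices lose only \<open>1 - V^2 / n\<close>, while larger sets pay \<open>e\<close> per vertex
  and a further \<open>\<rho> > 1\<close> per vertex, repaid by \<open>1 / \<rho> ^ V\<close> in
  front. With \<open>V\<close> about \<open>n powr (2/5)\<close>, \<open>V^2 / n\<close> is small
  and \<open>\<rho> ^ V\<close> still beats the exponential of a multiple of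
  \<open>n powr (1/4)\<close>.

  The tilt restores the number of edges. Planting a copy adds about \<open>k n (1 - p)\<close> edges
  to the expectation; tilting with \<open>1 - \<beta> = 2k / (n p)\<close> removes about
  \<open>(n^2 / 2) p (1 - p) (1 - \<beta>)\<close>, which is the same number.\<close>

definition near :: "nat \<Rightarrow> nat \<Rightarrow> int \<Rightarrow> int \<Rightarrow> bool" where
  "near n k a b \<longleftrightarrow> (\<exists>d. d \<noteq> 0 \<and> \<bar>d\<bar> \<le> int k \<and> [a = b + d] (mod int n))"

lemma near_sym: "near n k a b \<Longrightarrow> near n k b a"
proof -
  assume "near n k a b"
  then obtain d where d: "d \<noteq> 0" "\<bar>d\<bar> \<le> int k" "[a = b + d] (mod int n)"
    unfolding near_def by blast
  have "[b = a + (-d)] (mod int n)"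
    using d(3) by (simp add: cong_iff_dvd_diff dvd_diff_commute algebra_simps)
  then show ?thesis unfolding near_def using d by (intro exI[of _ "-d"]) auto
qed

lemma near_translate: "near n k (a + c) (b + c) \<longleftrightarrow> near n k a b"
  unfolding near_def by (simp add: cong_iff_dvd_diff algebra_simps)

lemma near_cong:
  assumes "[a = a'] (mod int n)" "[b = b'] (mod int n)" "near n k a b"
  shows "near n k a' b'"
proof -
  obtain d where d: "d \<noteq> 0" "\<bar>d\<bar> \<le> int k" "[a = b + d] (mod int n)"
    using assms(3) unfolding near_def by blast
  have "[a' = b' + d] (mod int n)"
    using assms(1,2) d(3) by (meson cong_add_rcancel cong_sym cong_trans)
  then show ?thesis unfolding near_def using d by blast
qed

lemma near_not_cong:
  assumes "near n k a b" "n > k"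
  shows "\<not> [a = b] (mod int n)"
proof
  assume "[a = b] (mod int n)"
  obtain d where d: "d \<noteq> 0" "\<bar>d\<bar> \<le> int k" "[a = b + d] (mod int n)"
    using assms(1) unfolding near_def by blast
  have "[b + 0 = b + d] (mod int n)"
    using \<open>[a = b] (mod int n)\<close> d(3) by (metis add.right_neutral cong_sym cong_trans)
  then have "int n dvd d" by (simp add: cong_iff_dvd_diff)
  then have "int n \<le> \<bar>d\<bar>" using d(1) using dvd_imp_le_int[of d "int n"] by simp
  then show False using d(2) assms(2) by linarith
qed

text \<open>\<open>z\<close> and the true offset differ by a multiple of \<open>n\<close> that is
  smaller than \<open>n\<close>. This is the passage from residues to integers, where order and
  intervals make sense.\<close>

lemma near_exact:
  assumes "near n k a b" "[a - b = z] (mod int n)" "\<bar>z\<bar> + int k < int n"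
  shows "z \<noteq> 0" "\<bar>z\<bar> \<le> int k"
proof -
  obtain d where d: "d \<noteq> 0" "\<bar>d\<bar> \<le> int k" "[a = b + d] (mod int n)"
    using assms(1) unfolding near_def by blast
  have "int n dvd z - d"
    using assms(2) d(3) unfolding cong_iff_dvd_diff
    using dvd_diff[of "int n" "a - (b + d)" "a - b - z"] by (simp add: algebra_simps)
  then have "z = d"
    using assms(3) d(2) dvd_imp_le_int[of "z - d" "int n"] by linarith
  then show "z \<noteq> 0" "\<bar>z\<bar> \<le> int k" using d by auto
qed

text \<open>A clique of size \<open>k + 1\<close> is an interval, so it can only be moved by dropping an end point.\<close>

lemma interval_extension:
  fixes D :: "int set" and k :: nat
  assumes "finite D" "card D = k" "k \<ge> 1" "0 \<notin> D"
    and "\<And>a b. a \<in> insert 0 D \<Longrightarrow> b \<in> insert 0 D \<Longrightarrow> \<bar>a - b\<bar> \<le> int k"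
    and y: "y \<notin> insert 0 D" "\<And>a. a \<in> D \<Longrightarrow> \<bar>y - a\<bar> \<le> int k"
  shows "y = (if Min (insert 0 D) = 0 then int k + 1 else - int k - 1)"
proof -
  let ?I = "insert 0 D"
  define m where "m = Min ?I"
  have fin: "finite ?I" using assms by simp
  have m: "m \<in> ?I" "\<And>a. a \<in> ?I \<Longrightarrow> m \<le> a"
    unfolding m_def using fin Min_in[OF fin] Min_le[OF fin] by blast+
  have sub: "?I \<subseteq> {m..m + int k}"
  proof
    fix a assume "a \<in> ?I"
    then have "\<bar>a - m\<bar> \<le> int k" "m \<le> a" using assms(5) m by blast+
    then show "a \<in> {m..m + int k}" by auto
  qed
  \<comment> \<open>Since \<open>0 \<notin> D\<close>, the set \<open>?I\<close> has
    \<open>k + 1\<close> elements, as many as the interval around it.\<close>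
  have I: "?I = {m..m + int k}"
    by (rule card_subset_eq) (use sub assms in auto)
  have le0: "m \<le> 0" using m by blast
  show ?thesis
  proof (cases "m = 0")
    case True
    \<comment> \<open>\<open>y\<close> need not be near \<open>0\<close>, the point that is dropped.
      Nearness to \<open>1\<close> and to \<open>k\<close> leaves the range from \<open>0\<close> to
      \<open>k + 1\<close>, in which only \<open>k + 1\<close> is new.\<close>
    then have "1 \<in> insert 0 D" "int k \<in> insert 0 D" unfolding I using assms(3) by auto
    then have "1 \<in> D" "int k \<in> D" using assms(3) by auto
    then have "\<bar>y - 1\<bar> \<le> int k" "\<bar>y - int k\<bar> \<le> int k" using y by blast+
    moreover have "y \<notin> {0..int k}" using y(1) I True by auto
    ultimately show ?thesis using True unfolding m_def[symmetric] by auto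
  next
    case False
    then have mD: "m \<in> D" using m by auto
    have "m + int k \<in> ?I" unfolding I by simp
    show ?thesis
    proof (cases "m + int k = 0")
      case True
      have "-1 \<in> {m..m + int k}" using True assms(3) by auto
      then have "-1 \<in> D" unfolding I[symmetric] by simp
      then have "\<bar>y - (-1)\<bar> \<le> int k" "\<bar>y - m\<bar> \<le> int k" using y mD by blast+
      moreover have "y \<notin> {m..0}" using y(1) I True by auto
      ultimately show ?thesis using True False unfolding m_def[symmetric] by auto
    next
      case f2: False
      \<comment> \<open>Dropping an inner point leaves both ends in \<open>D\<close>, and a point
        near both ends already lies in the interval.\<close>
      then have "m + int k \<in> D" using \<open>m + int k \<in> ?I\<close> by auto
      then have "\<bar>y - m\<bar> \<le> int k" "\<bar>y - (m + int k)\<bar> \<le> int k" using y mD by blast+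
      then have "y \<in> {m..m + int k}" by auto
      then show ?thesis using I y(1) by auto
    qed
  qed
qed

text \<open>Measured from \<open>u (k + 1)\<close>, the window becomes a set of integers, and
  \<open>interval_extension\<close> computes the offset of a new point from that set alone, so two
  new points agree. The offsets compared are at most \<open>3 k\<close> in absolute value and
  \<open>near_exact\<close> asks for another \<open>k\<close>, whence
  \<open>n > 4 * k\<close>.\<close>

lemma extension_unique:
  fixes n k :: nat and u :: "nat \<Rightarrow> int"
  assumes n: "n > 4 * k" and k: "k \<ge> 1"
    and win: "\<And>i j. 1 \<le> i \<Longrightarrow> i < j \<Longrightarrow> j \<le> k + 1 \<Longrightarrow> near n k (u i) (u j)"
    and x: "\<And>i. 1 \<le> i \<Longrightarrow> i \<le> k \<Longrightarrow> near n k x (u i)" "\<not> [x = u (k + 1)] (mod int n)"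
    and x': "\<And>i. 1 \<le> i \<Longrightarrow> i \<le> k \<Longrightarrow> near n k x' (u i)" "\<not> [x' = u (k + 1)] (mod int n)"
  shows "[x = x'] (mod int n)"
proof -
  have "\<forall>i\<in>{1..k}. \<exists>d. d \<noteq> 0 \<and> \<bar>d\<bar> \<le> int k \<and> [u i = u (k+1) + d] (mod int n)"
    using win[of _ "k+1"] unfolding near_def by auto
  then obtain d where d: "\<And>i. i \<in> {1..k} \<Longrightarrow> d i \<noteq> 0 \<and> \<bar>d i\<bar> \<le> int k \<and> [u i = u (k+1) + d i] (mod int n)"
    by metis
  have dij: "\<bar>d i - d j\<bar> \<le> int k \<and> d i \<noteq> d j" if "i \<in> {1..k}" "j \<in> {1..k}" "i < j" for i j
  proof -
    have nr: "near n k (u i) (u j)" using win that by auto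
    have c: "[u i - u j = d i - d j] (mod int n)"
      using cong_diff[of "u i" "u (k+1) + d i" "int n" "u j" "u (k+1) + d j"] d that by auto
    have "\<bar>d i - d j\<bar> + int k < int n" using d[OF that(1)] d[OF that(2)] n by linarith
    from near_exact[OF nr c this] show ?thesis by auto
  qed
  have inj: "inj_on d {1..k}"
    by (intro linorder_inj_onI) (use dij in fastforce)+
  define D where "D = d ` {1..k}"
  have key: "\<exists>y. [x = u (k+1) + y] (mod int n) \<and> y = (if Min (insert 0 D) = 0 then int k + 1 else - int k - 1)"
    if x: "\<And>i. 1 \<le> i \<Longrightarrow> i \<le> k \<Longrightarrow> near n k x (u i)" "\<not> [x = u (k + 1)] (mod int n)" for x
  proof -
    obtain e where e: "\<bar>e\<bar> \<le> int k" "[x = u 1 + e] (mod int n)"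
      using x(1)[of 1] k unfolding near_def by auto
    define y where "y = d 1 + e"
    have d1: "\<bar>d 1\<bar> \<le> int k" "[u 1 = u (k+1) + d 1] (mod int n)" using d k by auto
    have yc: "[x = u (k+1) + y] (mod int n)"
      using cong_trans[OF e(2) cong_add[OF d1(2) cong_refl[of e]]] by (simp add: y_def algebra_simps)
    have yb: "\<bar>y\<bar> \<le> 2 * int k" using e d1 unfolding y_def by linarith
    have y0: "y \<noteq> 0" using yc x(2) by auto
    have yi: "\<bar>y - d i\<bar> \<le> int k \<and> y - d i \<noteq> 0" if "i \<in> {1..k}" for i
    proof -
      have nr: "near n k x (u i)" using x that by auto
      have c: "[x - u i = y - d i] (mod int n)"
        using cong_diff[OF yc, of "u i" "u (k+1) + d i"] d that by auto
      have "\<bar>y - d i\<bar> + int k < int n" using d[OF that(1)] yb n by linarith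
      from near_exact[OF nr c this] show ?thesis by auto
    qed
    have "y = (if Min (insert 0 D) = 0 then int k + 1 else - int k - 1)"
    proof (rule interval_extension)
      show "finite D" "card D = k" "1 \<le> k" using k card_image[OF inj] by (auto simp: D_def)
      show "0 \<notin> D" using d unfolding D_def by force
      show "\<bar>a - b\<bar> \<le> int k" if ab: "a \<in> insert 0 D" "b \<in> insert 0 D" for a b
      proof -
        have *: "\<bar>d i - d j\<bar> \<le> int k" if "i \<in> {1..k}" "j \<in> {1..k}" for i j
          using dij[of i j] dij[of j i] that by (cases i j rule: linorder_cases) auto
        show ?thesis using ab d * unfolding D_def by fastforce
      qed
      show "y \<notin> insert 0 D" using y0 yi unfolding D_def by fastforce
      show "\<bar>y - a\<bar> \<le> int k" if "a \<in> D" for a using that yi unfolding D_def by auto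
    qed
    then show ?thesis using yc by blast
  qed
  from key[OF x] key[OF x'] show ?thesis
    by (metis cong_sym cong_trans)
qed

lemma cong_int_eq_range:
  assumes "u \<in> {1..n}" "w \<in> {1..n}" "[int u = int w] (mod int n)"
  shows "u = w"
proof (rule ccontr)
  assume "u \<noteq> w"
  have "int n dvd int u - int w" using assms(3) by (simp add: cong_iff_dvd_diff)
  then have "int n \<le> \<bar>int u - int w\<bar>" using \<open>u \<noteq> w\<close> dvd_imp_le_int[of "int u - int w" "int n"] by auto
  then show False using assms(1,2) by auto
qed

section \<open>The edges of the cycle power\<close>

text \<open>The vertices are indexed by all integers modulo \<open>n\<close>, so that no wrap-around has to be treated in the statements below.\<close>

definition vert :: "nat \<Rightarrow> int \<Rightarrow> nat" where
  "vert n m = nat ((m - 1) mod int n) + 1"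

lemma vert_mem: "n \<ge> 1 \<Longrightarrow> vert n m \<in> {1..n}"
proof -
  assume "n \<ge> 1"
  then have "0 \<le> (m - 1) mod int n" "(m - 1) mod int n < int n" by auto
  then have "nat ((m - 1) mod int n) < n" by linarith
  then show ?thesis unfolding vert_def by simp
qed

lemma vert_cong: "n \<ge> 1 \<Longrightarrow> [int (vert n m) = m] (mod int n)"
proof -
  assume "n \<ge> 1"
  then have "int (vert n m) = (m - 1) mod int n + 1" unfolding vert_def by simp
  moreover have "[(m - 1) mod int n + 1 = (m - 1) + 1] (mod int n)"
    by (intro cong_add cong_refl) simp
  ultimately show ?thesis by simp
qed

lemma vert_eq_iff: "n \<ge> 1 \<Longrightarrow> vert n m = vert n m' \<longleftrightarrow> [m = m'] (mod int n)"
  by (metis vert_cong vert_mem cong_int_eq_range cong_sym cong_trans)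

lemma vert_of_nat: "n \<ge> 1 \<Longrightarrow> u \<in> {1..n} \<Longrightarrow> vert n (int u) = u"
  by (metis vert_cong vert_mem cong_int_eq_range)

locale cycle_power =
  fixes n k :: nat
  assumes k1: "k \<ge> 1" and n4k: "n > 4 * k"
begin

definition E :: "nat set set" where
  "E = edges (hamilton_cycle_power k n)"

definition edge :: "int \<Rightarrow> nat \<Rightarrow> nat set" where
  "edge m j = {vert n m, vert n (m - int j)}"

lemma n1: "n \<ge> 1" using n4k by simp

lemmas vmem [simp] = vert_mem[OF n1]
lemmas vcong = vert_cong[OF n1]
lemmas veq = vert_eq_iff[OF n1]

lemma small_cong:
  assumes "[int a = int b] (mod int n)" "a < n" "b < n"
  shows "a = b"
  using assms by (simp add: cong_int_iff cong_less_modulus_unique_nat)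

lemma E_eq: "E = {edge m j |m j. j \<in> {1..k}}"
proof (intro equalityI subsetI)
  fix e assume "e \<in> E"
  then obtain v w i where e: "e = {v, w}" "v \<in> {1..n}" "w \<in> {1..n}" "i \<in> {1..k}" "[w = v + i] (mod n)"
    unfolding E_def hamilton_cycle_power_def by auto
  have "[int w = int v + int i] (mod int n)" using e(5) by (metis cong_int_iff of_nat_add)
  then have "[int v = int w - int i] (mod int n)"
    by (simp add: cong_iff_dvd_diff dvd_diff_commute algebra_simps)
  then have "vert n (int w - int i) = vert n (int v)" by (simp add: veq cong_sym)
  then have "e = edge (int w) i"
    unfolding edge_def using e vert_of_nat[OF n1] by auto
  then show "e \<in> {edge m j |m j. j \<in> {1..k}}" using e(4) by blast
next
  fix e assume "e \<in> {edge m j |m j. j \<in> {1..k}}"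
  then obtain m j where e: "e = edge m j" "j \<in> {1..k}" by blast
  have "[int (vert n m) = int (vert n (m - int j)) + int j] (mod int n)"
    using vcong[of m] cong_add[OF vcong[of "m - int j"] cong_refl[of "int j"]]
    by (metis cong_sym cong_trans diff_add_cancel)
  then have "[vert n m = vert n (m - int j) + j] (mod n)"
    by (metis cong_int_iff of_nat_add)
  moreover have "e = {vert n (m - int j), vert n m}"
    using e(1) unfolding edge_def by auto
  ultimately show "e \<in> E"
    unfolding E_def hamilton_cycle_power_def snd_conv using e(2) vmem by blast
qed

lemma edge_in_E: "j \<in> {1..k} \<Longrightarrow> edge m j \<in> E"
  unfolding E_eq by blast

lemma edge_cong: "[m = m'] (mod int n) \<Longrightarrow> edge m j = edge m' j"
  unfolding edge_def by (metis cong_diff cong_refl veq)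

lemma near_of_edge: "{u, w} \<in> E \<Longrightarrow> near n k (int u) (int w)"
proof -
  assume "{u, w} \<in> E"
  then obtain m j where e: "{u, w} = edge m j" "j \<in> {1..k}" unfolding E_eq by blast
  have *: "near n k (int (vert n m)) (int (vert n (m - int j)))"
    by (rule near_cong[OF cong_sym[OF vcong] cong_sym[OF vcong]])
       (use e(2) in \<open>auto simp: near_def intro!: exI[of _ "int j"]\<close>)
  show ?thesis using e(1) * near_sym[OF *] unfolding edge_def doubleton_eq_iff by auto
qed

text \<open>The origin \<open>r\<close> is left free, so that the cycle can be cut open at a vertex
  that suits the edge set at hand.\<close>

lemma edge_exists:
  assumes "e \<in> E"
  shows "\<exists>i<n. \<exists>j\<in>{1..k}. e = edge (r + int i) j"
proof -
  obtain m j where e: "e = edge m j" "j \<in> {1..k}" using assms unfolding E_eq by blast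
  define i where "i = nat ((m - r) mod int n)"
  have "int i = (m - r) mod int n" unfolding i_def using n1 by simp
  then have "i < n" using n1 by (metis of_nat_less_iff pos_mod_bound of_nat_0_less_iff less_le_trans zero_less_one)
  have "[r + int i = r + (m - r)] (mod int n)"
    unfolding \<open>int i = (m - r) mod int n\<close> by (intro cong_add cong_refl) simp
  then have "edge m j = edge (r + int i) j" by (intro edge_cong) (simp add: cong_sym)
  then show ?thesis using e \<open>i < n\<close> by blast
qed

lemma edge_inj:
  assumes "edge (r + int i) j = edge (r + int i') j'" "i < n" "i' < n" "j \<in> {1..k}" "j' \<in> {1..k}"
  shows "i = i' \<and> j = j'"
proof -
  consider "vert n (r + int i) = vert n (r + int i')" "vert n (r + int i - int j) = vert n (r + int i' - int j')"
    | "vert n (r + int i) = vert n (r + int i' - int j')" "vert n (r + int i - int j) = vert n (r + int i')"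
    using assms(1) unfolding edge_def doubleton_eq_iff by auto
  then show ?thesis
  proof cases
    case 1
    have i: "i = i'" using 1(1) assms small_cong unfolding veq by (auto simp: cong_add_lcancel)
    have "[int j = int j'] (mod int n)"
      using 1(2) unfolding veq i by (simp add: cong_iff_dvd_diff dvd_diff_commute algebra_simps)
    then have "j = j'" using assms(4,5) n4k by (intro small_cong) auto
    then show ?thesis using i by simp
  next
    case 2
    \<comment> \<open>Exchanged end points would make \<open>j + j'\<close> a positive multiple of
      \<open>n\<close>, but it is at most \<open>2 k\<close>.\<close>
    have "int n dvd (r + int i - (r + int i' - int j')) - (r + int i - int j - (r + int i'))"
      using 2 unfolding veq cong_iff_dvd_diff by (rule dvd_diff)
    then have "int n dvd int (j + j')" by (simp add: algebra_simps)
    then have "n dvd j + j'" by presburger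
    then have "n \<le> j + j'" using assms(4) by (intro dvd_imp_le) auto
    then show ?thesis using assms(4,5) n4k by auto
  qed
qed

lemma E_bij: "bij_betw (\<lambda>(i, j). edge (r + int i) j) ({..<n} \<times> {1..k}) E"
  unfolding bij_betw_def
proof
  show "inj_on (\<lambda>(i, j). edge (r + int i) j) ({..<n} \<times> {1..k})"
    by (intro inj_onI) (use edge_inj in fastforce)
  show "(\<lambda>(i, j). edge (r + int i) j) ` ({..<n} \<times> {1..k}) = E"
    using edge_exists[of _ r] edge_in_E by (fastforce simp: image_iff)
qed

lemma finite_E [simp]: "finite E"
  using bij_betw_finite[OF E_bij] by simp

lemma card_E: "card E = k * n"
  using bij_betw_same_card[OF E_bij] by (simp add: mult.commute)

lemma E_edge: "e \<in> E \<Longrightarrow> e \<subseteq> {1..n} \<and> card e = 2"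
proof -
  assume "e \<in> E"
  then obtain m j where e: "e = edge m j" "j \<in> {1..k}" unfolding E_eq by blast
  have "{vert n m, vert n (m - int j)} \<in> E" using \<open>e \<in> E\<close> unfolding e(1) edge_def .
  then have "vert n m \<noteq> vert n (m - int j)"
    using near_of_edge near_not_cong n4k by (metis cong_refl le_add2 less_le_trans not_le mult_le_mono1 one_le_numeral mult_1)
  then show ?thesis unfolding e edge_def using vmem by auto
qed

text \<open>Each edge of \<open>\<gamma>\<close> belongs to exactly one back set, namely that of its later end point.\<close>

definition backset :: "nat set set \<Rightarrow> int \<Rightarrow> nat set" where
  "backset \<gamma> m = {j \<in> {1..k}. edge m j \<in> \<gamma>}"

definition idx :: "int \<Rightarrow> nat set set \<Rightarrow> nat set" where
  "idx r \<gamma> = {i. i < n \<and> vert n (r + int i) \<in> \<Union>\<gamma>}"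

text \<open>Connectivity by cuts instead of paths: a vertex set that no edge crosses contains all
  covered vertices or none. A failure of this property is itself the splitting used in
  \<open>decomp_exists\<close>.\<close>

definition connected_edges :: "nat set set \<Rightarrow> bool" where
  "connected_edges \<gamma> \<longleftrightarrow> (\<forall>U. (\<forall>e\<in>\<gamma>. e \<subseteq> U \<or> e \<inter> U = {}) \<longrightarrow> \<Union>\<gamma> \<subseteq> U \<or> \<Union>\<gamma> \<inter> U = {})"

text \<open>These contain the restrictions to \<open>\<Union>S\<close> of all permutations that map
  the edges in \<open>S\<close> into \<open>E\<close>. Being defined on \<open>\<Union>S\<close>
  only, they can be counted component by component.\<close>

definition Emb :: "nat set set \<Rightarrow> (nat \<Rightarrow> nat) set" where
  "Emb S = {f \<in> \<Union>S \<rightarrow>\<^sub>E {1..n}. inj_on f (\<Union>S) \<and> (\<forall>e\<in>S. f ` e \<in> E)}"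

definition full :: "nat set set \<Rightarrow> int \<Rightarrow> bool" where
  "full \<gamma> m \<longleftrightarrow> backset \<gamma> m = {1..k}"

text \<open>A vertex outside this set closes a run of \<open>k + 1\<close> full vertices, so its image under an embedding is determined by
  the images of its \<open>k + 1\<close> predecessors. The positions up to \<open>k\<close> are excluded because their predecessors may
  lie across the starting point \<open>r\<close>.\<close>

definition nondet :: "int \<Rightarrow> nat set set \<Rightarrow> nat set" where
  "nondet r \<gamma> = {i \<in> idx r \<gamma>. \<not> (i \<ge> k + 1 \<and> (\<forall>a\<le>k. full \<gamma> (r + int i - int a)))}"

lemma finite_idx [simp]: "finite (idx r \<gamma>)"
  unfolding idx_def by simp

lemma backset_nonempty_idx: "i < n \<Longrightarrow> j \<in> backset \<gamma> (r + int i) \<Longrightarrow> i \<in> idx r \<gamma>"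
  unfolding backset_def idx_def edge_def by auto

lemma backset_verts: "j \<in> backset \<gamma> m \<Longrightarrow> vert n m \<in> \<Union>\<gamma> \<and> vert n (m - int j) \<in> \<Union>\<gamma>"
  unfolding backset_def edge_def by auto

lemma edges_bij:
  assumes "\<gamma> \<subseteq> E"
  shows "bij_betw (\<lambda>(i, j). edge (r + int i) j) (SIGMA i:idx r \<gamma>. backset \<gamma> (r + int i)) \<gamma>"
  unfolding bij_betw_def
proof
  show "inj_on (\<lambda>(i, j). edge (r + int i) j) (SIGMA i:idx r \<gamma>. backset \<gamma> (r + int i))"
    by (intro inj_onI) (use edge_inj in \<open>fastforce simp: idx_def backset_def\<close>)
  show "(\<lambda>(i, j). edge (r + int i) j) ` (SIGMA i:idx r \<gamma>. backset \<gamma> (r + int i)) = \<gamma>"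
  proof (intro equalityI subsetI)
    fix e assume e: "e \<in> \<gamma>"
    then obtain i j where ij: "i < n" "j \<in> {1..k}" "e = edge (r + int i) j"
      using assms edge_exists[of e r] by blast
    then have "j \<in> backset \<gamma> (r + int i)" using e unfolding backset_def by auto
    with ij show "e \<in> (\<lambda>(i, j). edge (r + int i) j) ` (SIGMA i:idx r \<gamma>. backset \<gamma> (r + int i))"
      using backset_nonempty_idx by force
  qed (auto simp: backset_def)
qed

lemma card_edges:
  assumes "\<gamma> \<subseteq> E"
  shows "card \<gamma> = (\<Sum>i\<in>idx r \<gamma>. card (backset \<gamma> (r + int i)))"
  using bij_betw_same_card[OF edges_bij[OF assms, of r]]
  by (subst (asm) card_SigmaI) (auto simp: backset_def)

lemma verts_bij:
  assumes "\<gamma> \<subseteq> E"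
  shows "bij_betw (\<lambda>i. vert n (r + int i)) (idx r \<gamma>) (\<Union>\<gamma>)"
  unfolding bij_betw_def
proof
  show "inj_on (\<lambda>i. vert n (r + int i)) (idx r \<gamma>)"
    by (intro inj_onI) (auto simp: idx_def veq cong_add_lcancel intro: small_cong)
  show "(\<lambda>i. vert n (r + int i)) ` idx r \<gamma> = \<Union>\<gamma>"
  proof (intro equalityI subsetI)
    fix u assume u: "u \<in> \<Union>\<gamma>"
    then have uA: "u \<in> {1..n}" using assms E_edge by blast
    define i where "i = nat ((int u - r) mod int n)"
    have ii: "int i = (int u - r) mod int n" unfolding i_def using n1 by simp
    then have "i < n" using n1 by (metis of_nat_less_iff pos_mod_bound of_nat_0_less_iff less_le_trans zero_less_one)
    have "[r + int i = r + (int u - r)] (mod int n)"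
      unfolding ii by (intro cong_add cong_refl) simp
    then have "vert n (r + int i) = u"
      using vert_of_nat[OF n1 uA] veq by (metis add.commute diff_add_cancel)
    then show "u \<in> (\<lambda>i. vert n (r + int i)) ` idx r \<gamma>"
      using u \<open>i < n\<close> unfolding idx_def by force
  qed (auto simp: idx_def)
qed

lemma card_verts: "\<gamma> \<subseteq> E \<Longrightarrow> card (\<Union>\<gamma>) = card (idx r \<gamma>)"
  using bij_betw_same_card[OF verts_bij] by metis

text \<open>An undetermined position is at most \<open>k\<close> or follows a non-full one at
  distance at most \<open>k\<close>. Each non-full position accounts for \<open>k + 1\<close> of
  them, and the final \<open>+ 1\<close> for the positions up to \<open>k\<close>.\<close>

lemma card_nondet:
  assumes "\<gamma> \<subseteq> E"
  shows "card (nondet r \<gamma>) \<le> (k + 1) * (card {i \<in> idx r \<gamma>. \<not> full \<gamma> (r + int i)} + 1)"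
proof -
  let ?N = "{i \<in> idx r \<gamma>. \<not> full \<gamma> (r + int i)}"
  have sub: "nondet r \<gamma> \<subseteq> {..k} \<union> (\<Union>i\<in>?N. {i..i + k})"
  proof
    fix i assume i: "i \<in> nondet r \<gamma>"
    then have ii: "i \<in> idx r \<gamma>" unfolding nondet_def by auto
    show "i \<in> {..k} \<union> (\<Union>i\<in>?N. {i..i + k})"
    proof (cases "i \<le> k")
      case False
      then obtain a where a: "a \<le> k" "\<not> full \<gamma> (r + int i - int a)"
        using i unfolding nondet_def by auto
      show ?thesis
      proof (cases "full \<gamma> (r + int i)")
        case True
        \<comment> \<open>The full vertex at \<open>i\<close> is joined to the one at
          \<open>i - a\<close>, which is therefore covered and counts as a non-full
          position.\<close>
        then have "a \<noteq> 0" using a(2) by (metis diff_zero of_nat_0)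
        then have "a \<in> backset \<gamma> (r + int i)" using True a(1) unfolding full_def by auto
        then have "vert n (r + int i - int a) \<in> \<Union>\<gamma>" using backset_verts by blast
        moreover have eq: "r + int (i - a) = r + int i - int a" using False a(1) by auto
        ultimately have "i - a \<in> ?N" using ii a(2) unfolding idx_def mem_Collect_eq eq by auto
          then show ?thesis using a(1) False by (intro UnI2 UN_I[of "i - a"]) auto
      next
        case f: False
        then have "i \<in> ?N" using ii by auto
        then show ?thesis by force
      qed
    qed auto
  qed
  have "card (nondet r \<gamma>) \<le> card ({..k} \<union> (\<Union>i\<in>?N. {i..i + k}))"
    by (rule card_mono[OF _ sub]) auto
  also have "\<dots> \<le> card {..k} + card (\<Union>i\<in>?N. {i..i + k})" by (rule card_Un_le)
  also have "card (\<Union>i\<in>?N. {i..i + k}) \<le> (\<Sum>i\<in>?N. card {i..i + k})"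
    by (rule card_UN_le) simp
  also have "\<dots> = card ?N * (k + 1)" by simp
  finally show ?thesis by (simp add: algebra_simps)
qed

section \<open>Embeddings of connected edge sets\<close>

text \<open>The residues of \<open>-k, ..., k\<close>. The residue \<open>0\<close> never arises
  from near vertices; it is the default value for missing edges in \<open>card_Emb\<close>.\<close>

definition offs :: "int set" where
  "offs = {0..int k} \<union> {int n - int k..int n - 1}"

lemma card_offs: "finite offs" "card offs \<le> 2 * k + 1"
proof -
  show "finite offs" unfolding offs_def by simp
  show "card offs \<le> 2 * k + 1"
    unfolding offs_def by (rule order.trans[OF card_Un_le]) simp
qed

lemma near_offs: "near n k a b \<Longrightarrow> (a - b) mod int n \<in> offs"
proof -
  assume "near n k a b"
  then obtain d where d: "d \<noteq> 0" "\<bar>d\<bar> \<le> int k" "[a = b + d] (mod int n)"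
    unfolding near_def by blast
  have "[a - b = d] (mod int n)"
    using cong_diff[OF d(3) cong_refl[of b]] by simp
  then have e: "(a - b) mod int n = d mod int n" by (simp add: cong_def)
  show ?thesis
  proof (cases "d \<ge> 0")
    case True
    then have "d mod int n = d" using d n4k by (intro mod_pos_pos_trivial) auto
    then show ?thesis using e True d unfolding offs_def by auto
  next
    case False
    have "d mod int n = (d + int n) mod int n" by simp
    also have "\<dots> = d + int n" using False d n4k by (intro mod_pos_pos_trivial) auto
    finally show ?thesis using e False d unfolding offs_def by auto
  qed
qed

lemma near_of_Emb:
  assumes "f \<in> Emb \<gamma>" "j \<in> backset \<gamma> m"
  shows "near n k (int (f (vert n m))) (int (f (vert n (m - int j))))"
proof -
  have "f ` edge m j \<in> E" using assms unfolding Emb_def backset_def by auto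
  then show ?thesis unfolding edge_def by (intro near_of_edge) simp
qed

lemma near_of_Emb_full:
  assumes "f \<in> Emb \<gamma>" "full \<gamma> (m - int i)" "i < j" "j \<le> i + k"
  shows "near n k (int (f (vert n (m - int i)))) (int (f (vert n (m - int j))))"
proof -
  have "j - i \<in> backset \<gamma> (m - int i)" using assms unfolding full_def by auto
  from near_of_Emb[OF assms(1) this] show ?thesis using assms(3) by (simp add: of_nat_diff)
qed

lemma full_in_verts:
  assumes "full \<gamma> (m - int i)" "i \<le> j" "j \<le> i + k"
  shows "vert n (m - int j) \<in> \<Union>\<gamma>"
proof (cases "i = j")
  case True
  have "1 \<in> backset \<gamma> (m - int i)" using assms k1 unfolding full_def by auto
  then show ?thesis using backset_verts True by blast
next
  case False
  then have "j - i \<in> backset \<gamma> (m - int i)" using assms unfolding full_def by auto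
  then have "vert n (m - int i - int (j - i)) \<in> \<Union>\<gamma>" using backset_verts by blast
  then show ?thesis using assms(2) by (simp add: of_nat_diff)
qed

text \<open>As the positions before \<open>m\<close> are full, \<open>f\<close> maps the window
  \<open>m - 1, ..., m - k - 1\<close> to a \<open>(k + 1)\<close>-clique. Both \<open>f\<close> at
  \<open>m\<close> and the rotated \<open>g\<close> at \<open>m\<close> continue this clique, and
  injectivity keeps them away from the image of \<open>m - k - 1\<close>, so
  \<open>extension_unique\<close> identifies them.\<close>

lemma Emb_propagate:
  assumes f: "f \<in> Emb \<gamma>" and g: "g \<in> Emb \<gamma>"
    and full: "\<And>a. a \<le> k \<Longrightarrow> full \<gamma> (m - int a)"
    and h: "\<And>t. t \<in> {1..k+1} \<Longrightarrow> [int (f (vert n (m - int t))) = int (g (vert n (m - int t))) + c] (mod int n)"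
  shows "[int (f (vert n m)) = int (g (vert n m)) + c] (mod int n)"
proof (rule extension_unique[OF n4k k1, where u = "\<lambda>t. int (f (vert n (m - int t)))"])
  have verts: "vert n m \<in> \<Union>\<gamma>" "vert n (m - int (k + 1)) \<in> \<Union>\<gamma>"
    using full_in_verts[of \<gamma> m 0 0] full_in_verts[of \<gamma> m 1 "k+1"] full[of 0] full[of 1] k1 by auto
  have ne: "vert n m \<noteq> vert n (m - int (k + 1))"
  proof
    assume "vert n m = vert n (m - int (k + 1))"
    then have "int n dvd int (k + 1)" unfolding veq cong_iff_dvd_diff by simp
    then have "n dvd k + 1" by presburger
    then have "n \<le> k + 1" by (intro dvd_imp_le) auto
    then show False using n4k k1 by linarith
  qed
  have apart: "\<not> [int (f' (vert n m)) = int (f' (vert n (m - int (k + 1))))] (mod int n)" if f': "f' \<in> Emb \<gamma>" for f'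
  proof
    assume a: "[int (f' (vert n m)) = int (f' (vert n (m - int (k + 1))))] (mod int n)"
    have "f' (vert n m) \<in> {1..n}" "f' (vert n (m - int (k + 1))) \<in> {1..n}"
      using f' verts unfolding Emb_def by blast+
    from cong_int_eq_range[OF this a] show False
      using f' verts ne unfolding Emb_def inj_on_def by blast
  qed
  show "near n k (int (f (vert n (m - int i)))) (int (f (vert n (m - int j))))"
    if "1 \<le> i" "i < j" "j \<le> k + 1" for i j
    using that by (intro near_of_Emb_full[OF f] full) auto
  show "near n k (int (f (vert n m))) (int (f (vert n (m - int i))))" if "1 \<le> i" "i \<le> k" for i
    using near_of_Emb_full[OF f, of m 0 i] full[of 0] that by simp
  show "\<not> [int (f (vert n m)) = int (f (vert n (m - int (k + 1))))] (mod int n)"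
    using apart[OF f] .
  show "near n k (int (g (vert n m)) + c) (int (f (vert n (m - int i))))" if "1 \<le> i" "i \<le> k" for i
  proof (rule near_cong[OF cong_refl])
    show "[int (g (vert n (m - int i))) + c = int (f (vert n (m - int i)))] (mod int n)"
      using h[of i] that by (simp add: cong_sym)
    show "near n k (int (g (vert n m)) + c) (int (g (vert n (m - int i))) + c)"
      unfolding near_translate using near_of_Emb_full[OF g, of m 0 i] full[of 0] that by simp
  qed
  show "\<not> [int (g (vert n m)) + c = int (f (vert n (m - int (k + 1))))] (mod int n)"
    using apart[OF g] h[of "k + 1"] by (metis cong_add_rcancel cong_trans atLeastAtMost_iff le_add2 order_refl)
qed

text \<open>The back differences at the undetermined vertices fix an embedding up to a rotation.\<close>

lemma Emb_rigid:
  assumes \<gamma>: "\<gamma> \<subseteq> E" "connected_edges \<gamma>" "vert n r \<in> \<Union>\<gamma>"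
    and f: "f \<in> Emb \<gamma>" and g: "g \<in> Emb \<gamma>" and start: "f (vert n r) = g (vert n r)"
    and data: "\<And>i j. i \<in> nondet r \<gamma> \<Longrightarrow> j \<in> backset \<gamma> (r + int i) \<Longrightarrow>
        (int (f (vert n (r + int i))) - int (f (vert n (r + int i - int j)))) mod int n =
        (int (g (vert n (r + int i))) - int (g (vert n (r + int i - int j)))) mod int n"
  shows "f = g"
proof -
  define h where "h m = int (f (vert n m)) - int (g (vert n m))" for m
  \<comment> \<open>The difference \<open>h\<close> is constant along every edge. At undetermined
    positions this is the assumption \<open>data\<close>, at the others it propagates from earlier
    positions.\<close>
  have const: "\<forall>j\<in>backset \<gamma> (r + int i). [h (r + int i) = h (r + int i - int j)] (mod int n)" if "i < n" for i
    using that
  proof (induction i rule: less_induct)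
    case (less i)
    show ?case
    proof
      fix j assume j: "j \<in> backset \<gamma> (r + int i)"
      then have ii: "i \<in> idx r \<gamma>" using backset_nonempty_idx less.prems by blast
      show "[h (r + int i) = h (r + int i - int j)] (mod int n)"
      proof (cases "i \<in> nondet r \<gamma>")
        case True
        have "[int (f (vert n (r + int i))) - int (f (vert n (r + int i - int j))) =
          int (g (vert n (r + int i))) - int (g (vert n (r + int i - int j)))] (mod int n)"
          using data[OF True j] by (simp add: cong_def)
        then show ?thesis unfolding h_def by (simp add: cong_iff_dvd_diff algebra_simps)
      next
        case False
        define m where "m = r + int i"
        have ik: "i \<ge> k + 1" and fl: "\<And>a. a \<le> k \<Longrightarrow> full \<gamma> (m - int a)"
          using False ii unfolding nondet_def m_def by auto
        \<comment> \<open>The position \<open>m - 1\<close> is full and earlier than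
          \<open>m\<close>, so the induction hypothesis gives all of the window the same value of
          \<open>h\<close>.\<close>
        define c where "c = h (m - 1)"
        have win: "[h (m - int t) = c] (mod int n)" if t: "t \<in> {1..k+1}" for t
        proof (cases "t = 1")
          case True
          then show ?thesis by (simp add: c_def)
        next
          case f: False
          have "t - 1 \<in> backset \<gamma> (m - int 1)" using fl[of 1] k1 t f unfolding full_def by auto
          then have "t - 1 \<in> backset \<gamma> (r + int (i - 1))" using ik by (simp add: m_def of_nat_diff algebra_simps)
          then have "[h (r + int (i - 1)) = h (r + int (i - 1) - int (t - 1))] (mod int n)"
            using less.IH[of "i - 1"] less.prems ik by auto
          moreover have "r + int (i - 1) = m - 1" "r + int (i - 1) - int (t - 1) = m - int t"
            using ik t by (auto simp: m_def of_nat_diff)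
          ultimately show ?thesis by (simp add: c_def cong_sym)
        qed
        have "[int (f (vert n m)) = int (g (vert n m)) + c] (mod int n)"
        proof (rule Emb_propagate[OF f g fl])
          fix t assume "t \<in> {1..k+1}"
          then show "[int (f (vert n (m - int t))) = int (g (vert n (m - int t))) + c] (mod int n)"
            using win[of t] unfolding h_def by (simp add: cong_iff_dvd_diff algebra_simps)
        qed
        then have "[h m = c] (mod int n)" unfolding h_def by (simp add: cong_iff_dvd_diff algebra_simps)
        moreover have "j \<in> {1..k+1}" using j unfolding backset_def by auto
        ultimately show ?thesis using win[of j] unfolding m_def by (metis cong_sym cong_trans)
      qed
    qed
  qed
  \<comment> \<open>No edge crosses the set where \<open>f\<close> and \<open>g\<close> agree and it
    contains the starting vertex, so connectivity makes it everything.\<close>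
  define U where "U = {x \<in> \<Union>\<gamma>. [int (f x) = int (g x)] (mod int n)}"
  have "\<forall>e\<in>\<gamma>. e \<subseteq> U \<or> e \<inter> U = {}"
  proof
    fix e assume e: "e \<in> \<gamma>"
    then obtain i j where ij: "i < n" "j \<in> {1..k}" "e = edge (r + int i) j"
      using edge_exists[of e r] \<gamma>(1) by blast
    have j: "j \<in> backset \<gamma> (r + int i)" using ij e unfolding backset_def by simp
    have c: "[h (r + int i) = h (r + int i - int j)] (mod int n)" using const ij(1) j by blast
    have U: "vert n m \<in> U \<longleftrightarrow> [h m = 0] (mod int n)" if "vert n m \<in> \<Union>\<gamma>" for m
      using that unfolding U_def h_def by (simp add: cong_iff_dvd_diff)
    have "vert n (r + int i) \<in> U \<longleftrightarrow> vert n (r + int i - int j) \<in> U"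
      using U backset_verts[OF j] c by (metis cong_sym cong_trans)
    then show "e \<subseteq> U \<or> e \<inter> U = {}" unfolding ij(3) edge_def by auto
  qed
  then have "\<Union>\<gamma> \<subseteq> U \<or> \<Union>\<gamma> \<inter> U = {}" using \<gamma>(2) unfolding connected_edges_def by blast
  moreover have "vert n r \<in> U" using \<gamma>(3) start unfolding U_def by simp
  ultimately have U: "\<Union>\<gamma> \<subseteq> U" using \<gamma>(3) by blast
  have "f x = g x" for x
  proof (cases "x \<in> \<Union>\<gamma>")
    case True
    then have "[int (f x) = int (g x)] (mod int n)" using U unfolding U_def by auto
    moreover have "f x \<in> {1..n}" "g x \<in> {1..n}" using f g True unfolding Emb_def by blast+
    ultimately show ?thesis using cong_int_eq_range by blast
  next
    case False
    have "f \<in> extensional (\<Union>\<gamma>)" "g \<in> extensional (\<Union>\<gamma>)"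
      using f g unfolding Emb_def PiE_def by blast+
    then show ?thesis using False by (simp add: extensional_def)
  qed
  then show ?thesis by auto
qed

lemma finite_nondet [simp]: "finite (nondet r \<gamma>)"
  unfolding nondet_def by simp

text \<open>By \<open>Emb_rigid\<close> the image of the starting vertex, with \<open>n\<close>
  choices, and the back differences at the undetermined positions suffice. Each such position has
  \<open>k\<close> differences with at most \<open>2 * k + 1\<close> values.\<close>

lemma card_Emb:
  assumes \<gamma>: "\<gamma> \<subseteq> E" "connected_edges \<gamma>" "vert n r \<in> \<Union>\<gamma>"
  shows "card (Emb \<gamma>) \<le> n * ((2 * k + 1) ^ k) ^ card (nondet r \<gamma>)"
proof -
  define \<Phi> where "\<Phi> f = (f (vert n r), (\<lambda>i\<in>nondet r \<gamma>. \<lambda>j\<in>{1..k}. if j \<in> backset \<gamma> (r + int i)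
    then (int (f (vert n (r + int i))) - int (f (vert n (r + int i - int j)))) mod int n else 0))" for f
  let ?T = "{1..n} \<times> (nondet r \<gamma> \<rightarrow>\<^sub>E ({1..k} \<rightarrow>\<^sub>E offs))"
  have finT: "finite ?T" using card_offs by (intro finite_cartesian_product finite_PiE) auto
  have "inj_on \<Phi> (Emb \<gamma>)"
  proof (rule inj_onI)
    fix f g assume f: "f \<in> Emb \<gamma>" and g: "g \<in> Emb \<gamma>" and eq: "\<Phi> f = \<Phi> g"
    show "f = g"
    proof (rule Emb_rigid[OF \<gamma> f g])
      show "f (vert n r) = g (vert n r)" using eq unfolding \<Phi>_def by simp
      fix i j assume i: "i \<in> nondet r \<gamma>" and j: "j \<in> backset \<gamma> (r + int i)"
      have jk: "j \<in> {1..k}" using j unfolding backset_def by auto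
      have "snd (\<Phi> f) i j = snd (\<Phi> g) i j" using eq by simp
      then show "(int (f (vert n (r + int i))) - int (f (vert n (r + int i - int j)))) mod int n =
        (int (g (vert n (r + int i))) - int (g (vert n (r + int i - int j)))) mod int n"
        unfolding \<Phi>_def using i j jk by simp
    qed
  qed
  moreover have "\<Phi> ` Emb \<gamma> \<subseteq> ?T"
  proof
    fix z assume "z \<in> \<Phi> ` Emb \<gamma>"
    then obtain f where f: "f \<in> Emb \<gamma>" "z = \<Phi> f" by blast
    have "f (vert n r) \<in> {1..n}" using f \<gamma>(3) unfolding Emb_def by blast
    moreover have "0 \<in> offs" unfolding offs_def by auto
    ultimately show "z \<in> ?T"
      unfolding f(2) \<Phi>_def using near_offs[OF near_of_Emb[OF f(1)]]
      by (auto simp: restrict_PiE_iff)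
  qed
  ultimately have "card (Emb \<gamma>) \<le> card ?T" using finT by (metis card_inj_on_le)
  also have "\<dots> = n * (card offs ^ k) ^ card (nondet r \<gamma>)"
    by (simp add: card_cartesian_product card_PiE)
  also have "\<dots> \<le> n * ((2 * k + 1) ^ k) ^ card (nondet r \<gamma>)"
    using card_offs by (intro mult_left_mono power_mono) auto
  finally show ?thesis .
qed

end

section \<open>Scanning an edge set along the cycle\<close>

lemma strict_sorted_nth:
  fixes A :: "nat set"
  assumes "finite A" "i < j" "j < card A"
  shows "sorted_list_of_set A ! i < sorted_list_of_set A ! j"
  using assms sorted_wrt_nth_less[OF strict_sorted_list_of_set, of i j A] by simp

lemma sorted_list_pred:
  fixes A :: "nat set"
  assumes "finite A" "x \<in> A" "i < card A" "x < sorted_list_of_set A ! i"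
  shows "i \<ge> 1 \<and> x \<le> sorted_list_of_set A ! (i - 1)"
proof -
  let ?X = "sorted_list_of_set A"
  have "x \<in> set ?X" using assms by simp
  then obtain j where j: "j < card A" "?X ! j = x"
    using assms(1) by (metis in_set_conv_nth length_sorted_list_of_set)
  have "j < i"
  proof (rule ccontr)
    assume "\<not> j < i"
    then consider "j = i" | "i < j" by linarith
    then show False using strict_sorted_nth[OF assms(1), of i j] j assms(4) by cases auto
  qed
  then consider "j = i - 1" | "j < i - 1" by linarith
  then have "?X ! j \<le> ?X ! (i - 1)"
  proof cases
    case 2
    then show ?thesis using strict_sorted_nth[OF assms(1) 2] assms(3) by linarith
  qed simp
  then show ?thesis using j \<open>j < i\<close> by auto
qed

lemma sorted_list_0:
  fixes A :: "nat set"
  assumes "finite A" "0 \<in> A"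
  shows "sorted_list_of_set A ! 0 = 0"
proof (rule ccontr)
  assume "sorted_list_of_set A ! 0 \<noteq> 0"
  moreover have "0 < card A" using assms card_gt_0_iff by blast
  ultimately show False using sorted_list_pred[OF assms, of 0] by auto
qed

lemma card_le_nth:
  fixes A :: "nat set"
  assumes "finite A" "i < card A"
  shows "card {x \<in> A. x < sorted_list_of_set A ! i} \<le> i"
proof -
  let ?X = "sorted_list_of_set A"
  have "{x \<in> A. x < ?X ! i} \<subseteq> (\<lambda>j. ?X ! j) ` {..<i}"
  proof
    fix x assume x: "x \<in> {x \<in> A. x < ?X ! i}"
    then have "x \<in> set ?X" using assms by simp
    then obtain j where j: "j < card A" "?X ! j = x"
    using assms(1) by (metis in_set_conv_nth length_sorted_list_of_set)
    have "j < i"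
    proof (rule ccontr)
      assume "\<not> j < i"
      then consider "j = i" | "i < j" by linarith
      then show False using strict_sorted_nth[OF assms(1), of i j] j x by cases auto
    qed
    then show "x \<in> (\<lambda>j. ?X ! j) ` {..<i}" using j by auto
  qed
  then have "card {x \<in> A. x < ?X ! i} \<le> card ((\<lambda>j. ?X ! j) ` {..<i})" by (intro card_mono) auto
  also have "\<dots> \<le> card {..<i}" by (rule card_image_le) simp
  finally show ?thesis by simp
qed

context cycle_power
begin

definition pos :: "int \<Rightarrow> nat set set \<Rightarrow> nat \<Rightarrow> nat" where
  "pos r \<gamma> i = sorted_list_of_set (idx r \<gamma>) ! i"

text \<open>The first distance is set to \<open>1\<close> by convention, which keeps the code within the alphabet \<open>letters\<close>.\<close>

definition code :: "int \<Rightarrow> nat set set \<Rightarrow> nat \<Rightarrow> nat \<times> nat set" where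
  "code r \<gamma> = (\<lambda>i\<in>{..<card (idx r \<gamma>)}.
     (if i = 0 then 1 else pos r \<gamma> i - pos r \<gamma> (i - 1), backset \<gamma> (r + int (pos r \<gamma> i))))"

text \<open>A full vertex is joined to its immediate predecessor, so its distance is
  \<open>1\<close>. Hence exactly one letter carries \<open>k\<close> edges, and the leading term of
  \<open>rate\<close> has no combinatorial factor that could spoil the sharp constant.\<close>

definition letters :: "(nat \<times> nat set) set" where
  "letters = {(g, B). g \<in> {1..k} \<and> B \<subseteq> {1..k} \<and> (B = {1..k} \<longrightarrow> g = 1)}"

lemma finite_letters [simp]: "finite letters"
  by (rule finite_subset[of _ "{1..k} \<times> Pow {1..k}"]) (auto simp: letters_def)

lemma zero_idx: "vert n r \<in> \<Union>\<gamma> \<Longrightarrow> 0 \<in> idx r \<gamma>"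
  unfolding idx_def using n1 by auto

lemma pos_bij: "bij_betw (pos r \<gamma>) {..<card (idx r \<gamma>)} (idx r \<gamma>)"
  unfolding pos_def using bij_betw_nth[of "sorted_list_of_set (idx r \<gamma>)"] by simp

lemma pos_surj: "x \<in> idx r \<gamma> \<Longrightarrow> \<exists>i<card (idx r \<gamma>). x = pos r \<gamma> i"
proof -
  assume "x \<in> idx r \<gamma>"
  then have "x \<in> pos r \<gamma> ` {..<card (idx r \<gamma>)}"
    unfolding bij_betw_imp_surj_on[OF pos_bij[of r \<gamma>]] .
  then show ?thesis by blast
qed

lemma pos_mem: "i < card (idx r \<gamma>) \<Longrightarrow> pos r \<gamma> i \<in> idx r \<gamma>"
  using pos_bij bij_betwE by blast

lemma pos_mono: "i < j \<Longrightarrow> j < card (idx r \<gamma>) \<Longrightarrow> pos r \<gamma> i < pos r \<gamma> j"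
  unfolding pos_def by (rule strict_sorted_nth) auto

lemma pos_0: "vert n r \<in> \<Union>\<gamma> \<Longrightarrow> pos r \<gamma> 0 = 0"
  unfolding pos_def by (rule sorted_list_0) (auto simp: zero_idx)

lemma pos_pred:
  "x \<in> idx r \<gamma> \<Longrightarrow> i < card (idx r \<gamma>) \<Longrightarrow> x < pos r \<gamma> i \<Longrightarrow> i \<ge> 1 \<and> x \<le> pos r \<gamma> (i - 1)"
  unfolding pos_def by (rule sorted_list_pred) auto

text \<open>The first position is \<open>0\<close> because \<open>r\<close> is covered. The
  distances then give back all positions, and the back sets give back all edges.\<close>

lemma code_inj:
  assumes "\<gamma> \<subseteq> E" "vert n r \<in> \<Union>\<gamma>" "\<gamma>' \<subseteq> E" "vert n r \<in> \<Union>\<gamma>'"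
    and card: "card (idx r \<gamma>) = card (idx r \<gamma>')" and code: "code r \<gamma> = code r \<gamma>'"
  shows "\<gamma> = \<gamma>'"
proof -
  let ?v = "card (idx r \<gamma>)"
  have pos: "i < ?v \<Longrightarrow> pos r \<gamma> i = pos r \<gamma>' i" for i
  proof (induction i)
    case 0
    then show ?case using pos_0 assms by simp
  next
    case (Suc i)
    have "fst (code r \<gamma> (Suc i)) = fst (code r \<gamma>' (Suc i))" using code by simp
    then have "pos r \<gamma> (Suc i) - pos r \<gamma> i = pos r \<gamma>' (Suc i) - pos r \<gamma>' i"
      using Suc.prems card by (simp add: code_def)
    moreover have "pos r \<gamma> i < pos r \<gamma> (Suc i)" "pos r \<gamma>' i < pos r \<gamma>' (Suc i)"
      using Suc.prems card by (auto intro: pos_mono)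
    ultimately show ?case using Suc by simp
  qed
  have idx: "idx r \<gamma> = idx r \<gamma>'"
  proof -
    have "idx r \<gamma> = pos r \<gamma> ` {..<?v}"
      using bij_betw_imp_surj_on[OF pos_bij[of r \<gamma>]] by (rule sym)
    also have "\<dots> = pos r \<gamma>' ` {..<?v}" using pos by (intro image_cong) auto
    also have "\<dots> = idx r \<gamma>'"
      unfolding card by (rule bij_betw_imp_surj_on[OF pos_bij[of r \<gamma>']])
    finally show ?thesis .
  qed
  have "backset \<gamma> (r + int x) = backset \<gamma>' (r + int x)" if "x \<in> idx r \<gamma>" for x
  proof -
    obtain i where i: "i < ?v" "x = pos r \<gamma> i" using pos_surj[OF \<open>x \<in> idx r \<gamma>\<close>] by blast
    have "snd (code r \<gamma> i) = snd (code r \<gamma>' i)" using code by simp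
    then show ?thesis using i card pos[OF i(1)] by (simp add: code_def)
  qed
  then have *: "(SIGMA i:idx r \<gamma>. backset \<gamma> (r + int i)) = (SIGMA i:idx r \<gamma>'. backset \<gamma>' (r + int i))"
    using idx by (intro Sigma_cong) auto
  show ?thesis
    using bij_betw_imp_surj_on[OF edges_bij[OF assms(1), of r]]
      bij_betw_imp_surj_on[OF edges_bij[OF assms(3), of r]] unfolding * by simp
qed

text \<open>The choices \<open>(2 * k + 1) ^ k\<close> of \<open>card_Emb\<close>, for each of the
  \<open>k + 1\<close> positions that one non-full vertex can leave undetermined.\<close>

definition Q :: real where "Q = (real ((2 * k + 1) ^ k)) ^ (k + 1)"

lemma Q_ge_1: "Q \<ge> 1"
  unfolding Q_def by (intro one_le_power) (metis le_add2 of_nat_1 of_nat_le_iff one_le_power)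

definition letter_weight :: "real \<Rightarrow> real \<Rightarrow> nat \<times> nat set \<Rightarrow> real" where
  "letter_weight Y s l = s / n * Y ^ card (snd l) * (if snd l = {1..k} then 1 else Q)"

text \<open>Here \<open>s / n\<close> is the price of a covered vertex, with \<open>s = 1\<close> if
  few vertices are covered and \<open>s = e \<rho>\<close> in general. All three factors become
  products over the components.\<close>

definition weight :: "real \<Rightarrow> real \<Rightarrow> nat set set \<Rightarrow> real" where
  "weight y s \<gamma> = y ^ card \<gamma> * real (card (Emb \<gamma>)) * (s / n) ^ card (\<Union>\<gamma>)"

text \<open>The factor \<open>n\<close> stands for the image of the starting vertex, and the single
  \<open>Q\<close> for the positions left undetermined by the cut at \<open>r\<close>. All other
  contributions are local and go into the letters.\<close>

lemma weight_le_prod: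
  assumes \<gamma>: "\<gamma> \<subseteq> E" "connected_edges \<gamma>" "vert n r \<in> \<Union>\<gamma>" and y: "0 \<le> y" "y \<le> Y" and s: "s \<ge> 0"
  shows "weight y s \<gamma> \<le> n * Q * (\<Prod>i<card (idx r \<gamma>). letter_weight Y s (code r \<gamma> i))"
proof -
  let ?I = "idx r \<gamma>"
  let ?N = "{i \<in> ?I. \<not> full \<gamma> (r + int i)}"
  have "real (card (Emb \<gamma>)) \<le> real (n * ((2 * k + 1) ^ k) ^ card (nondet r \<gamma>))"
    using card_Emb[OF \<gamma>] by (rule of_nat_mono)
  also have "\<dots> \<le> n * (real ((2 * k + 1) ^ k)) ^ ((k + 1) * (card ?N + 1))"
    unfolding of_nat_mult of_nat_power
    by (intro mult_left_mono power_increasing card_nondet \<gamma>) (auto simp flip: of_nat_power)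
  also have "\<dots> = n * Q ^ (card ?N + 1)" by (simp only: Q_def power_mult)
  also have "\<dots> = n * Q * Q ^ card ?N" by simp
  also have "Q ^ card ?N = (\<Prod>i\<in>?I. if full \<gamma> (r + int i) then 1 else Q)"
  proof -
    have "?I \<inter> - {i. full \<gamma> (r + int i)} = ?N" by auto
    then show ?thesis by (simp add: prod.If_cases)
  qed
  finally have emb: "real (card (Emb \<gamma>)) \<le> n * Q * (\<Prod>i\<in>?I. if full \<gamma> (r + int i) then 1 else Q)" .
  have "weight y s \<gamma> \<le> Y ^ card \<gamma> * (n * Q * (\<Prod>i\<in>?I. if full \<gamma> (r + int i) then 1 else Q)) * (s / n) ^ card (\<Union>\<gamma>)"
    unfolding weight_def using y s emb by (intro mult_mono power_mono) auto
  also have "Y ^ card \<gamma> = (\<Prod>i\<in>?I. Y ^ card (backset \<gamma> (r + int i)))"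
    unfolding card_edges[OF \<gamma>(1), of r] by (simp add: power_sum)
  also have "(s / n) ^ card (\<Union>\<gamma>) = (\<Prod>i\<in>?I. s / n)"
    unfolding card_verts[OF \<gamma>(1), of r] by simp
  also have "(\<Prod>i\<in>?I. Y ^ card (backset \<gamma> (r + int i))) * (n * Q * (\<Prod>i\<in>?I. if full \<gamma> (r + int i) then 1 else Q)) *
     (\<Prod>i\<in>?I. s / n) = n * Q * (\<Prod>i\<in>?I. s / n * Y ^ card (backset \<gamma> (r + int i)) * (if full \<gamma> (r + int i) then 1 else Q))"
    unfolding prod.distrib by (simp add: algebra_simps)
  also have "(\<Prod>i\<in>?I. s / n * Y ^ card (backset \<gamma> (r + int i)) * (if full \<gamma> (r + int i) then 1 else Q)) =
     (\<Prod>i<card ?I. letter_weight Y s (code r \<gamma> i))"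
    unfolding prod.reindex_bij_betw[OF pos_bij[of r \<gamma>], symmetric]
    by (intro prod.cong refl) (simp add: letter_weight_def code_def full_def)
  finally show ?thesis .
qed

text \<open>For a fixed number of vertices the code is injective, so the sum over polymers is at
  most the sum over all words, which factors by position.\<close>

lemma sum_weight_le_prod:
  assumes G: "\<And>\<gamma>. \<gamma> \<in> \<G> \<Longrightarrow> \<gamma> \<subseteq> E \<and> connected_edges \<gamma> \<and> vert n r \<in> \<Union>\<gamma> \<and> card (idx r \<gamma>) = v \<and>
       (\<forall>i<v. code r \<gamma> i \<in> L i)"
    and L: "\<And>i. finite (L i)" and y: "0 \<le> y" "y \<le> Y" and s: "s \<ge> 0"
  shows "(\<Sum>\<gamma>\<in>\<G>. weight y s \<gamma>) \<le> n * Q * (\<Prod>i<v. \<Sum>l\<in>L i. letter_weight Y s l)"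
proof -
  have inj: "inj_on (code r) \<G>" by (intro inj_onI code_inj) (use G in auto)
  have sub: "code r ` \<G> \<subseteq> PiE {..<v} L"
    using G by (force simp: code_def PiE_def Pi_def extensional_def)
  have wt0: "letter_weight Y s l \<ge> 0" for l unfolding letter_weight_def using y s Q_ge_1 by auto
  have "(\<Sum>\<gamma>\<in>\<G>. weight y s \<gamma>) \<le> (\<Sum>\<gamma>\<in>\<G>. n * Q * (\<Prod>i<v. letter_weight Y s (code r \<gamma> i)))"
  proof (rule sum_mono)
    fix \<gamma> assume "\<gamma> \<in> \<G>"
    then have g: "\<gamma> \<subseteq> E" "connected_edges \<gamma>" "vert n r \<in> \<Union>\<gamma>" "card (idx r \<gamma>) = v" using G by blast+
    show "weight y s \<gamma> \<le> n * Q * (\<Prod>i<v. letter_weight Y s (code r \<gamma> i))"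
      using weight_le_prod[OF g(1-3) y s] unfolding g(4) .
  qed
  also have "\<dots> = n * Q * (\<Sum>c\<in>code r ` \<G>. \<Prod>i<v. letter_weight Y s (c i))"
    by (simp add: sum_distrib_left sum.reindex[OF inj])
  also have "\<dots> \<le> n * Q * (\<Sum>c\<in>PiE {..<v} L. \<Prod>i<v. letter_weight Y s (c i))"
    using sub L Q_ge_1 wt0 by (intro mult_left_mono sum_mono2 finite_PiE prod_nonneg) auto
  also have "\<dots> = n * Q * (\<Prod>i<v. \<Sum>l\<in>L i. letter_weight Y s l)"
    by (subst prod_sum_PiE) (use L in auto)
  finally show ?thesis .
qed

text \<open>If no \<open>k\<close> consecutive positions before \<open>r\<close> are covered, then no edge passes over the starting point \<open>r\<close>. A polymer
  without such a starting point covers at least \<open>n / k\<close> vertices, and has exponentially small weight.\<close>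

definition nowrap :: "int \<Rightarrow> nat set set \<Rightarrow> bool" where
  "nowrap r \<gamma> \<longleftrightarrow> (\<forall>t\<in>{1..k}. vert n (r - int t) \<notin> \<Union>\<gamma>)"

lemma idx_back:
  assumes "x \<in> idx r \<gamma>" "t \<le> x" "vert n (r + int x - int t) \<in> \<Union>\<gamma>"
  shows "x - t \<in> idx r \<gamma>"
proof -
  have eq: "r + int (x - t) = r + int x - int t" using assms(2) by simp
  show ?thesis using assms(1,3) unfolding idx_def mem_Collect_eq eq by auto
qed

lemma nowrap_back:
  assumes "nowrap r \<gamma>" "j \<in> backset \<gamma> (r + int x)" "x \<in> idx r \<gamma>"
  shows "j \<le> x \<and> x - j \<in> idx r \<gamma>"
proof -
  have j: "vert n (r + int x - int j) \<in> \<Union>\<gamma>" "j \<in> {1..k}" using backset_verts[OF assms(2)] assms(2) by (auto simp: backset_def)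
  have "j \<le> x"
  proof (rule ccontr)
    assume "\<not> j \<le> x"
    then have "r + int x - int j = r - int (j - x)" "j - x \<in> {1..k}" using j(2) by auto
    then show False using assms(1) j(1) unfolding nowrap_def by metis
  qed
  then show ?thesis using idx_back assms(3) j(1) by blast
qed

lemma code_letters:
  assumes "vert n r \<in> \<Union>\<gamma>" "i < card (idx r \<gamma>)"
    and gap: "i \<ge> 1 \<Longrightarrow> pos r \<gamma> i \<le> pos r \<gamma> (i - 1) + k"
  shows "code r \<gamma> i \<in> letters"
proof (cases "i = 0")
  case True
  then show ?thesis using assms k1 by (auto simp: code_def letters_def backset_def)
next
  case False
  have mono: "pos r \<gamma> (i - 1) < pos r \<gamma> i" using False assms by (intro pos_mono) auto
  have "pos r \<gamma> i = Suc (pos r \<gamma> (i - 1))" if "backset \<gamma> (r + int (pos r \<gamma> i)) = {1..k}"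
  proof -
    have "1 \<in> backset \<gamma> (r + int (pos r \<gamma> i))" using that k1 by simp
    then have "vert n (r + int (pos r \<gamma> i) - int 1) \<in> \<Union>\<gamma>" using backset_verts by blast
    then have "pos r \<gamma> i - 1 \<in> idx r \<gamma>" using mono by (intro idx_back[OF pos_mem[OF assms(2)]]) auto
    then have "pos r \<gamma> i - 1 \<le> pos r \<gamma> (i - 1)" using pos_pred[OF _ assms(2), of "pos r \<gamma> i - 1"] mono by linarith
    then show ?thesis using mono by simp
  qed
  then show ?thesis using assms(2) gap mono False by (auto simp: code_def letters_def backset_def)
qed

lemma edge_coord:
  assumes "\<gamma> \<subseteq> E" "e \<in> \<gamma>"
  shows "\<exists>x\<in>idx r \<gamma>. \<exists>j\<in>backset \<gamma> (r + int x). e = edge (r + int x) j"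
proof -
  obtain i j where ij: "i < n" "j \<in> {1..k}" "e = edge (r + int i) j"
    using assms edge_exists[of e r] by blast
  then have "j \<in> backset \<gamma> (r + int i)" using assms(2) unfolding backset_def by auto
  with ij show ?thesis using backset_nonempty_idx by blast
qed

text \<open>A gap longer than \<open>k\<close> would disconnect the positions before it from those
  after it: no edge spans it, and by \<open>nowrap\<close> no edge joins the two sides through the
  cut.\<close>

lemma gap_nowrap:
  assumes \<gamma>: "\<gamma> \<subseteq> E" "connected_edges \<gamma>" "vert n r \<in> \<Union>\<gamma>" and nw: "nowrap r \<gamma>"
    and i: "1 \<le> i" "i < card (idx r \<gamma>)"
  shows "pos r \<gamma> i \<le> pos r \<gamma> (i - 1) + k"
proof (rule ccontr)
  assume big: "\<not> pos r \<gamma> i \<le> pos r \<gamma> (i - 1) + k"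
  define a where "a = pos r \<gamma> (i - 1)"
  define U where "U = (\<lambda>x. vert n (r + int x)) ` {x \<in> idx r \<gamma>. x \<le> a}"
  have U: "vert n (r + int x) \<in> U \<longleftrightarrow> x \<le> a" if "x \<in> idx r \<gamma>" for x
    using that verts_bij[OF \<gamma>(1), of r] unfolding U_def bij_betw_def inj_on_def by auto
  have "\<forall>e\<in>\<gamma>. e \<subseteq> U \<or> e \<inter> U = {}"
  proof
    fix e assume "e \<in> \<gamma>"
    obtain x j where xj: "x \<in> idx r \<gamma>" "j \<in> backset \<gamma> (r + int x)" "e = edge (r + int x) j"
      using edge_coord[OF \<gamma>(1) \<open>e \<in> \<gamma>\<close>] by blast
    have b: "j \<le> x" "x - j \<in> idx r \<gamma>" using nowrap_back[OF nw xj(2,1)] by auto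
    have eq: "e = {vert n (r + int x), vert n (r + int (x - j))}"
      unfolding xj(3) edge_def using b(1) by (simp add: algebra_simps)
    have "x \<le> a \<longleftrightarrow> x - j \<le> a"
    proof
      assume "x - j \<le> a"
      moreover have "j \<le> k" using xj(2) unfolding backset_def by auto
      ultimately have "x < pos r \<gamma> i" using big b unfolding a_def by auto
      then show "x \<le> a" using pos_pred[OF xj(1) i(2)] unfolding a_def by auto
    qed auto
    then show "e \<subseteq> U \<or> e \<inter> U = {}" unfolding eq using U xj(1) b(2) by auto
  qed
  then have "\<Union>\<gamma> \<subseteq> U \<or> \<Union>\<gamma> \<inter> U = {}" using \<gamma>(2) unfolding connected_edges_def by blast
  moreover have "vert n r \<in> U" using U[OF zero_idx[OF \<gamma>(3)]] by simp
  moreover have "vert n (r + int (pos r \<gamma> i)) \<notin> U" "vert n (r + int (pos r \<gamma> i)) \<in> \<Union>\<gamma>"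
    using U[OF pos_mem[OF i(2)]] big pos_mem[OF i(2)] unfolding a_def idx_def by auto
  ultimately show False using \<gamma>(3) by blast
qed

text \<open>Back neighbours are distinct earlier positions. This keeps the first vertices of a
  polymer from collecting \<open>k\<close> edges each.\<close>

lemma card_back_nowrap:
  assumes nw: "nowrap r \<gamma>" and i: "i < card (idx r \<gamma>)"
  shows "card (backset \<gamma> (r + int (pos r \<gamma> i))) \<le> i"
proof -
  let ?x = "pos r \<gamma> i"
  have "card (backset \<gamma> (r + int ?x)) = card ((\<lambda>j. ?x - j) ` backset \<gamma> (r + int ?x))"
    by (intro card_image[symmetric] inj_onI)
       (metis nowrap_back[OF nw _ pos_mem[OF i]] diff_diff_cancel)
  also have "\<dots> \<le> card {y \<in> idx r \<gamma>. y < ?x}"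
  proof (intro card_mono)
    show "(\<lambda>j. ?x - j) ` backset \<gamma> (r + int ?x) \<subseteq> {y \<in> idx r \<gamma>. y < ?x}"
      using nowrap_back[OF nw _ pos_mem[OF i]] by (fastforce simp: backset_def)
  qed auto
  also have "\<dots> \<le> i" unfolding pos_def using i by (intro card_le_nth) auto
  finally show ?thesis .
qed

text \<open>Every covered vertex has a covered one at most \<open>k\<close> before it, which bounds
  the gaps directly. At the starting vertex this yields a covered position of at least
  \<open>n - k\<close>, and it is reached from \<open>0\<close> in steps of at most
  \<open>k\<close>.\<close>

lemma gap_wrap:
  assumes r: "vert n r \<in> \<Union>\<gamma>"
    and wr: "\<And>u. vert n u \<in> \<Union>\<gamma> \<Longrightarrow> \<not> nowrap u \<gamma>"
  shows "\<And>i. 1 \<le> i \<Longrightarrow> i < card (idx r \<gamma>) \<Longrightarrow> pos r \<gamma> i \<le> pos r \<gamma> (i - 1) + k"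
    and "n \<le> k * card (idx r \<gamma>)"
proof -
  show gap: "pos r \<gamma> i \<le> pos r \<gamma> (i - 1) + k" if i: "1 \<le> i" "i < card (idx r \<gamma>)" for i
  proof -
    have "vert n (r + int (pos r \<gamma> i)) \<in> \<Union>\<gamma>" using pos_mem[OF i(2)] unfolding idx_def by auto
    then obtain t where t: "t \<in> {1..k}" "vert n (r + int (pos r \<gamma> i) - int t) \<in> \<Union>\<gamma>"
      using wr unfolding nowrap_def by blast
    show ?thesis
    proof (cases "t \<le> pos r \<gamma> i")
      case True
      then have "pos r \<gamma> i - t \<in> idx r \<gamma>" using idx_back[OF pos_mem[OF i(2)]] t(2) by blast
      moreover have "pos r \<gamma> i - t < pos r \<gamma> i" using t(1) True by auto
      ultimately have "pos r \<gamma> i - t \<le> pos r \<gamma> (i - 1)" using pos_pred[OF _ i(2)] by blast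
      then show ?thesis using t(1) by auto
    qed (use t(1) in auto)
  qed
  let ?v = "card (idx r \<gamma>)"
  have v1: "?v \<ge> 1" using zero_idx[OF r] by (metis One_nat_def Suc_leI card_gt_0_iff empty_iff finite_idx)
  have up: "i < ?v \<Longrightarrow> pos r \<gamma> i \<le> k * i" for i
  proof (induction i)
    case (Suc i)
    then show ?case using gap[of "Suc i"] by auto
  qed (simp add: pos_0[OF r])
  obtain t where t: "t \<in> {1..k}" "vert n (r - int t) \<in> \<Union>\<gamma>"
    using wr[OF r] unfolding nowrap_def by blast
  have "vert n (r + int (n - t)) = vert n (r - int t)"
    unfolding veq cong_iff_dvd_diff using t(1) n4k by (simp add: of_nat_diff)
  then have "n - t \<in> idx r \<gamma>" using t n4k unfolding idx_def by auto
  then obtain i where i: "i < ?v" "pos r \<gamma> i = n - t"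
    using pos_surj by metis
  have "n - t \<le> k * i" using up i by metis
  also have "\<dots> \<le> k * (?v - 1)" using i(1) by (intro mult_left_mono) auto
  finally have "n \<le> k * (?v - 1) + k" using t(1) by auto
  also have "\<dots> = k * ?v" using v1 by (simp add: diff_mult_distrib2)
  finally show "n \<le> k * ?v" .
qed

end

section \<open>The total weight of polymers on at least three vertices\<close>

lemma sum_UN_le:
  fixes f :: "'a \<Rightarrow> real"
  assumes "finite I" "\<And>i. i \<in> I \<Longrightarrow> finite (A i)" "\<And>x. f x \<ge> 0"
  shows "sum f (\<Union>i\<in>I. A i) \<le> (\<Sum>i\<in>I. sum f (A i))"
  using assms(1,2)
proof (induction I rule: finite_induct)
  case (insert i I)
  have "sum f (\<Union>j\<in>insert i I. A j) = sum f (A i \<union> (\<Union>j\<in>I. A j))" by simp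
  also have "\<dots> = sum f (A i) + sum f (\<Union>j\<in>I. A j) - sum f (A i \<inter> (\<Union>j\<in>I. A j))"
    using insert by (intro sum_Un) auto
  also have "\<dots> \<le> sum f (A i) + sum f (\<Union>j\<in>I. A j)" using assms(3) by (simp add: sum_nonneg)
  also have "\<dots> \<le> sum f (A i) + (\<Sum>j\<in>I. sum f (A j))" using insert by simp
  finally show ?case using insert by simp
qed simp

lemma sum_UN_le_const:
  fixes f :: "'a \<Rightarrow> real"
  assumes "finite I" "\<And>i. i \<in> I \<Longrightarrow> finite (A i)" "\<And>x. f x \<ge> 0"
    and "\<And>i. i \<in> I \<Longrightarrow> sum f (A i) \<le> c"
  shows "sum f (\<Union>i\<in>I. A i) \<le> real (card I) * c"
  using sum_UN_le[OF assms(1-3)] sum_bounded_above[of I "\<lambda>i. sum f (A i)" c] assms(4)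
  by (meson order.trans)

lemma geometric_sum_le:
  fixes q :: real
  assumes "0 \<le> q" "q < 1"
  shows "(\<Sum>m\<le>N. q ^ m) \<le> 1 / (1 - q)"
proof -
  have "(\<Sum>m\<le>N. q ^ m) = (1 - q ^ Suc N) / (1 - q)"
    using assms by (simp add: sum_gp0)
  also have "\<dots> \<le> 1 / (1 - q)" using assms by (intro divide_right_mono) auto
  finally show ?thesis .
qed

context cycle_power
begin

text \<open>The number of letters is at most \<open>k * 2 ^ k\<close>, and \<open>Q\<close> bounds
  the freedom of each of them.\<close>

definition \<kappa> :: real where "\<kappa> = k * 2 ^ k * Q"

lemma \<kappa>_nonneg: "\<kappa> \<ge> 0"
  unfolding \<kappa>_def using Q_ge_1 by simp

lemma card_letters: "card letters \<le> k * 2 ^ k"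
proof -
  have "card letters \<le> card ({1..k} \<times> Pow {1..k})"
    by (intro card_mono) (auto simp: letters_def)
  then show ?thesis by (simp add: card_cartesian_product card_Pow)
qed

lemma sum_letter_weight_le:
  assumes "Y \<ge> 1" "s \<ge> 0" "A \<subseteq> letters" "\<And>l. l \<in> A \<Longrightarrow> card (snd l) \<le> i"
  shows "(\<Sum>l\<in>A. letter_weight Y s l) \<le> \<kappa> * (s / n) * Y ^ i"
proof -
  have "(\<Sum>l\<in>A. letter_weight Y s l) \<le> (\<Sum>l\<in>A. s / n * Y ^ i * Q)"
  proof (rule sum_mono)
    fix l assume "l \<in> A"
    then show "letter_weight Y s l \<le> s / n * Y ^ i * Q"
      unfolding letter_weight_def using assms Q_ge_1 by (intro mult_mono power_increasing) auto
  qed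
  also have "\<dots> = card A * (s / n * Y ^ i * Q)" by simp
  also have "\<dots> \<le> (k * 2 ^ k) * (s / n * Y ^ i * Q)"
  proof (rule mult_right_mono)
    have "card A \<le> k * 2 ^ k" using card_mono[OF finite_letters assms(3)] card_letters by linarith
    then show "real (card A) \<le> real (k * 2 ^ k)" by (rule of_nat_mono)
    show "0 \<le> s / n * Y ^ i * Q" using assms Q_ge_1 by auto
  qed
  also have "\<dots> = \<kappa> * (s / n) * Y ^ i" unfolding \<kappa>_def by simp
  finally show ?thesis .
qed

text \<open>The first term is the one full letter, the second bounds all others, which have at most
  \<open>k - 1\<close> edges. For \<open>Y ^ k\<close> of order \<open>n\<close> the second term is
  of order \<open>1 / Y\<close>, so constants do not matter there.\<close>

definition rate :: "real \<Rightarrow> real \<Rightarrow> real" where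
  "rate Y s = s / n * Y ^ k + \<kappa> * (s / n) * Y ^ (k - 1)"

lemma sum_letters_le:
  assumes "Y \<ge> 1" "s \<ge> 0"
  shows "(\<Sum>l\<in>letters. letter_weight Y s l) \<le> rate Y s"
proof -
  let ?F = "{l \<in> letters. snd l = {1..k}}"
  have F: "?F = {(1, {1..k})}" using k1 by (auto simp: letters_def)
  have "(\<Sum>l\<in>letters. letter_weight Y s l) = (\<Sum>l\<in>?F. letter_weight Y s l) + (\<Sum>l\<in>letters - ?F. letter_weight Y s l)"
    using sum.subset_diff[of ?F letters "letter_weight Y s"] by (simp add: add.commute)
  also have "(\<Sum>l\<in>?F. letter_weight Y s l) = s / n * Y ^ k" unfolding F by (simp add: letter_weight_def)
  also have "(\<Sum>l\<in>letters - ?F. letter_weight Y s l) \<le> \<kappa> * (s / n) * Y ^ (k - 1)"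
  proof (rule sum_letter_weight_le[OF assms])
    fix l assume "l \<in> letters - ?F"
    then have "snd l \<subset> {1..k}" by (auto simp: letters_def)
    then have "card (snd l) < card {1..k}" by (intro psubset_card_mono) auto
    then show "card (snd l) \<le> k - 1" by simp
  qed auto
  finally show ?thesis unfolding rate_def by simp
qed

lemma rate_nonneg: "Y \<ge> 1 \<Longrightarrow> s \<ge> 0 \<Longrightarrow> 0 \<le> rate Y s"
  unfolding rate_def using \<kappa>_nonneg by auto

lemma weight_nonneg: "y \<ge> 0 \<Longrightarrow> s \<ge> 0 \<Longrightarrow> 0 \<le> weight y s \<gamma>"
  unfolding weight_def by auto

lemma sum_weight_nowrap:
  assumes k: "k \<ge> 3" and y: "0 \<le> y" "y \<le> Y" "Y \<ge> 1" and s: "s \<ge> 0"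
    and G: "\<And>\<gamma>. \<gamma> \<in> \<G> \<Longrightarrow> \<gamma> \<subseteq> E \<and> connected_edges \<gamma> \<and> vert n r \<in> \<Union>\<gamma> \<and> card (idx r \<gamma>) = 3 + m \<and> nowrap r \<gamma>"
  shows "(\<Sum>\<gamma>\<in>\<G>. weight y s \<gamma>) \<le> n * Q * ((\<kappa> * (s / n) * Y) ^ 3 * rate Y s ^ m)"
proof -
  define L where "L i = {l \<in> letters. card (snd l) \<le> i}" for i
  define a where "a i = (\<Sum>l\<in>L i. letter_weight Y s l)" for i
  have a0: "a i \<ge> 0" for i unfolding a_def letter_weight_def using y s Q_ge_1 by (intro sum_nonneg) auto
  have a_small: "a i \<le> \<kappa> * (s / n) * Y ^ i" for i
    unfolding a_def by (rule sum_letter_weight_le) (use y s in \<open>auto simp: L_def\<close>)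
  have a_rate: "a i \<le> rate Y s" for i
  proof -
    have "a i \<le> (\<Sum>l\<in>letters. letter_weight Y s l)"
      unfolding a_def L_def letter_weight_def using y s Q_ge_1 by (intro sum_mono2) auto
    then show ?thesis using sum_letters_le[OF y(3) s] by linarith
  qed
  have "(\<Sum>\<gamma>\<in>\<G>. weight y s \<gamma>) \<le> n * Q * (\<Prod>i<3 + m. \<Sum>l\<in>L i. letter_weight Y s l)"
  proof (rule sum_weight_le_prod[OF _ _ y(1,2) s])
    fix \<gamma> assume g: "\<gamma> \<in> \<G>"
    then have g': "\<gamma> \<subseteq> E" "connected_edges \<gamma>" "vert n r \<in> \<Union>\<gamma>" "card (idx r \<gamma>) = 3 + m" "nowrap r \<gamma>"
      using G by blast+
    have "code r \<gamma> i \<in> L i" if i: "i < 3 + m" for i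
    proof -
      have i': "i < card (idx r \<gamma>)" using i g'(4) by simp
      have "code r \<gamma> i \<in> letters"
        using gap_nowrap[OF g'(1-3,5)] i' by (intro code_letters[OF g'(3) i']) auto
      moreover have "card (snd (code r \<gamma> i)) \<le> i"
        using card_back_nowrap[OF g'(5) i'] i' by (simp add: code_def)
      ultimately show ?thesis unfolding L_def by simp
    qed
    then show "\<gamma> \<subseteq> E \<and> connected_edges \<gamma> \<and> vert n r \<in> \<Union>\<gamma> \<and> card (idx r \<gamma>) = 3 + m \<and> (\<forall>i<3 + m. code r \<gamma> i \<in> L i)"
      using g' by blast
  qed (simp add: L_def)
  also have "(\<Prod>i<3 + m. \<Sum>l\<in>L i. letter_weight Y s l) \<le> (\<kappa> * (s / n) * Y) ^ 3 * rate Y s ^ m"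
    unfolding a_def[symmetric]
  proof (induction m)
    case 0
    have "(\<Prod>i<3 + 0. a i) = a 0 * a 1 * a 2" by (simp add: numeral_3_eq_3 numeral_2_eq_2)
    \<comment> \<open>The first three vertices send back at most 0, 1 and 2 edges, together
      \<open>Y ^ 3\<close>, however dense the polymer is.\<close>
    also have "\<dots> \<le> (\<kappa> * (s / n) * Y ^ 0) * (\<kappa> * (s / n) * Y ^ 1) * (\<kappa> * (s / n) * Y ^ 2)"
      using y s \<kappa>_nonneg a0 by (intro mult_mono a_small mult_nonneg_nonneg) auto
    also have "\<dots> = (\<kappa> * (s / n) * Y) ^ 3 * rate Y s ^ 0" by (simp add: power2_eq_square power3_eq_cube)
    finally show ?case .
  next
    case (Suc m)
    have "(\<Prod>i<3 + Suc m. a i) = (\<Prod>i<3 + m. a i) * a (3 + m)"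
      by (simp only: add_Suc_right prod.lessThan_Suc)
    also have "\<dots> \<le> ((\<kappa> * (s / n) * Y) ^ 3 * rate Y s ^ m) * rate Y s"
      using y s \<kappa>_nonneg a0 rate_nonneg[OF y(3) s] by (intro mult_mono Suc a_rate) auto
    finally show ?case by (simp add: algebra_simps)
  qed
  finally show ?thesis using Q_ge_1 by (simp add: mult_left_mono)
qed

lemma sum_weight_wrap:
  assumes y: "0 \<le> y" "y \<le> Y" "Y \<ge> 1" and s: "s \<ge> 0"
    and G: "\<And>\<gamma>. \<gamma> \<in> \<G> \<Longrightarrow> \<gamma> \<subseteq> E \<and> connected_edges \<gamma> \<and> vert n r \<in> \<Union>\<gamma> \<and> card (idx r \<gamma>) = v \<and>
        (\<forall>u. vert n u \<in> \<Union>\<gamma> \<longrightarrow> \<not> nowrap u \<gamma>)"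
  shows "(\<Sum>\<gamma>\<in>\<G>. weight y s \<gamma>) \<le> n * Q * rate Y s ^ v"
proof -
  have "(\<Sum>\<gamma>\<in>\<G>. weight y s \<gamma>) \<le> n * Q * (\<Prod>i<v. \<Sum>l\<in>letters. letter_weight Y s l)"
  proof (rule sum_weight_le_prod[OF _ _ y(1,2) s])
    fix \<gamma> assume g: "\<gamma> \<in> \<G>"
    then have g': "\<gamma> \<subseteq> E" "connected_edges \<gamma>" "vert n r \<in> \<Union>\<gamma>" "card (idx r \<gamma>) = v"
       "\<And>u. vert n u \<in> \<Union>\<gamma> \<Longrightarrow> \<not> nowrap u \<gamma>"
      using G by blast+
    have "code r \<gamma> i \<in> letters" if i: "i < v" for i
      using gap_wrap(1)[OF g'(3,5)] i g'(4) by (intro code_letters[OF g'(3)]) auto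
    then show "\<gamma> \<subseteq> E \<and> connected_edges \<gamma> \<and> vert n r \<in> \<Union>\<gamma> \<and> card (idx r \<gamma>) = v \<and> (\<forall>i<v. code r \<gamma> i \<in> letters)"
      using g' by blast
  qed simp
  also have "(\<Prod>i<v. \<Sum>l\<in>letters. letter_weight Y s l) \<le> rate Y s ^ v"
  proof -
    have "0 \<le> (\<Sum>l\<in>letters. letter_weight Y s l)" unfolding letter_weight_def using y s Q_ge_1 by (intro sum_nonneg) auto
    then show ?thesis using sum_letters_le[OF y(3) s] by (simp add: power_mono)
  qed
  finally show ?thesis using Q_ge_1 by (simp add: mult_left_mono)
qed

text \<open>The outer \<open>n\<close> counts starting vertices, the inner one their images. Two
  factors \<open>n\<close> against three factors \<open>1 / n\<close> leave the order
  \<open>Y ^ 3 / n\<close>; the second term belongs to the polymers that go round the cycle.\<close>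

definition large_bound :: "real \<Rightarrow> real \<Rightarrow> real" where
  "large_bound Y s = n * (n * Q * (\<kappa> * (s / n) * Y) ^ 3 / (1 - rate Y s) +
     n * Q * rate Y s ^ (n div k) / (1 - rate Y s))"

lemma sum_weight_large:
  assumes k: "k \<ge> 3" and y: "0 \<le> y" "y \<le> Y" "Y \<ge> 1" and s: "s \<ge> 0" and rate: "rate Y s < 1"
  shows "(\<Sum>\<gamma>\<in>{\<gamma>. \<gamma> \<subseteq> E \<and> connected_edges \<gamma> \<and> card (\<Union>\<gamma>) \<ge> 3}. weight y s \<gamma>) \<le> large_bound Y s"
proof -
  let ?q = "rate Y s"
  define A where "A r m = {\<gamma>. \<gamma> \<subseteq> E \<and> connected_edges \<gamma> \<and> vert n (int r) \<in> \<Union>\<gamma> \<and> card (idx (int r) \<gamma>) = 3 + m \<and> nowrap (int r) \<gamma>}" for r m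
  define B where "B r m = {\<gamma>. \<gamma> \<subseteq> E \<and> connected_edges \<gamma> \<and> vert n (int r) \<in> \<Union>\<gamma> \<and> card (idx (int r) \<gamma>) = n div k + m \<and>
     (\<forall>u. vert n u \<in> \<Union>\<gamma> \<longrightarrow> \<not> nowrap u \<gamma>)}" for r m
  have fin: "finite (A r m)" "finite (B r m)" for r m
    unfolding A_def B_def by (auto intro: finite_subset[of _ "Pow E"])
  note wn = weight_nonneg[OF y(1) s] and q0 = rate_nonneg[OF y(3) s]
  \<comment> \<open>The cut is placed at a \<open>nowrap\<close> start if there is one, and at any
    covered vertex otherwise.\<close>
  have cover: "{\<gamma>. \<gamma> \<subseteq> E \<and> connected_edges \<gamma> \<and> card (\<Union>\<gamma>) \<ge> 3} \<subseteq> (\<Union>r\<in>{1..n}. (\<Union>m\<in>{..n}. A r m) \<union> (\<Union>m\<in>{..n}. B r m))"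
  proof
    fix \<gamma> assume "\<gamma> \<in> {\<gamma>. \<gamma> \<subseteq> E \<and> connected_edges \<gamma> \<and> card (\<Union>\<gamma>) \<ge> 3}"
    then have g: "\<gamma> \<subseteq> E" "connected_edges \<gamma>" "card (\<Union>\<gamma>) \<ge> 3" by auto
    have idxn: "card (idx r \<gamma>) \<le> n" for r
      using card_mono[of "{..<n}" "idx r \<gamma>"] by (auto simp: idx_def)
    show "\<gamma> \<in> (\<Union>r\<in>{1..n}. (\<Union>m\<in>{..n}. A r m) \<union> (\<Union>m\<in>{..n}. B r m))"
    proof (cases "\<exists>u. vert n u \<in> \<Union>\<gamma> \<and> nowrap u \<gamma>")
      case True
      then obtain u where u: "vert n u \<in> \<Union>\<gamma>" "nowrap u \<gamma>" by blast
      define r where "r = vert n u"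
      have r: "r \<in> {1..n}" "[int r = u] (mod int n)" unfolding r_def by (rule vmem, rule vcong)
      have same: "vert n (int r) = vert n u" using r(2) by (simp add: veq)
      have "vert n (int r - int t) = vert n (u - int t)" for t
        using r(2) by (simp add: veq cong_diff)
      then have "nowrap (int r) \<gamma>" using u(2) unfolding nowrap_def by simp
      then have "\<gamma> \<in> A r (card (idx (int r) \<gamma>) - 3)"
        unfolding A_def using g u(1) same card_verts[OF g(1), of "int r"] by auto
      moreover have "card (idx (int r) \<gamma>) - 3 \<in> {..n}" using idxn[of "int r"] by auto
      ultimately show ?thesis using r(1) by blast
    next
      case False
      have "\<Union>\<gamma> \<noteq> {}" using g(3) by force
      then obtain r where r: "r \<in> \<Union>\<gamma>" by blast
      then have rn: "r \<in> {1..n}" using g(1) E_edge by blast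
      have rv: "vert n (int r) \<in> \<Union>\<gamma>" using r vert_of_nat[OF n1 rn] by simp
      have "n \<le> k * card (idx (int r) \<gamma>)" using gap_wrap(2)[OF rv] False by blast
      then have "n div k \<le> card (idx (int r) \<gamma>)"
        using div_le_mono[of n "k * card (idx (int r) \<gamma>)" k] k1 by simp
      then have "\<gamma> \<in> B r (card (idx (int r) \<gamma>) - n div k)"
        unfolding B_def using g rv False by auto
      moreover have "card (idx (int r) \<gamma>) - n div k \<in> {..n}" using idxn[of "int r"] by auto
      ultimately show ?thesis using rn by blast
    qed
  qed
  have SA: "(\<Sum>\<gamma>\<in>(\<Union>m\<in>{..n}. A r m). weight y s \<gamma>) \<le> n * Q * (\<kappa> * (s / n) * Y) ^ 3 / (1 - ?q)" for r
  proof -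
    have "(\<Sum>\<gamma>\<in>(\<Union>m\<in>{..n}. A r m). weight y s \<gamma>) \<le> (\<Sum>m\<in>{..n}. \<Sum>\<gamma>\<in>A r m. weight y s \<gamma>)"
      using fin wn by (intro sum_UN_le) auto
    also have "\<dots> \<le> (\<Sum>m\<in>{..n}. n * Q * ((\<kappa> * (s / n) * Y) ^ 3 * ?q ^ m))"
      by (intro sum_mono sum_weight_nowrap[OF k y s]) (auto simp: A_def)
    also have "\<dots> = n * Q * (\<kappa> * (s / n) * Y) ^ 3 * (\<Sum>m\<le>n. ?q ^ m)"
      by (simp add: sum_distrib_left mult.assoc)
    also have "\<dots> \<le> n * Q * (\<kappa> * (s / n) * Y) ^ 3 * (1 / (1 - ?q))"
      using Q_ge_1 \<kappa>_nonneg s y by (intro mult_left_mono geometric_sum_le q0 rate) auto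
    finally show ?thesis by simp
  qed
  have SB: "(\<Sum>\<gamma>\<in>(\<Union>m\<in>{..n}. B r m). weight y s \<gamma>) \<le> n * Q * ?q ^ (n div k) / (1 - ?q)" for r
  proof -
    have "(\<Sum>\<gamma>\<in>(\<Union>m\<in>{..n}. B r m). weight y s \<gamma>) \<le> (\<Sum>m\<in>{..n}. \<Sum>\<gamma>\<in>B r m. weight y s \<gamma>)"
      using fin wn by (intro sum_UN_le) auto
    also have "\<dots> \<le> (\<Sum>m\<in>{..n}. n * Q * ?q ^ (n div k + m))"
      by (intro sum_mono sum_weight_wrap[OF y s]) (auto simp: B_def)
    also have "\<dots> = n * Q * ?q ^ (n div k) * (\<Sum>m\<le>n. ?q ^ m)"
      by (simp add: sum_distrib_left mult.assoc power_add)
    also have "\<dots> \<le> n * Q * ?q ^ (n div k) * (1 / (1 - ?q))"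
      using Q_ge_1 q0 by (intro mult_left_mono geometric_sum_le q0 rate) auto
    finally show ?thesis by simp
  qed
  have "(\<Sum>\<gamma>\<in>{\<gamma>. \<gamma> \<subseteq> E \<and> connected_edges \<gamma> \<and> card (\<Union>\<gamma>) \<ge> 3}. weight y s \<gamma>)
      \<le> (\<Sum>\<gamma>\<in>(\<Union>r\<in>{1..n}. (\<Union>m\<in>{..n}. A r m) \<union> (\<Union>m\<in>{..n}. B r m)). weight y s \<gamma>)"
    using fin wn cover by (intro sum_mono2) auto
  also have "\<dots> \<le> real (card {1..n}) * (n * Q * (\<kappa> * (s / n) * Y) ^ 3 / (1 - ?q) + n * Q * ?q ^ (n div k) / (1 - ?q))"
  proof (rule sum_UN_le_const)
    fix r
    let ?SA = "\<Union>m\<in>{..n}. A r m" and ?SB = "\<Union>m\<in>{..n}. B r m"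
    have "sum (weight y s) (?SA \<union> ?SB) = sum (weight y s) ?SA + sum (weight y s) ?SB - sum (weight y s) (?SA \<inter> ?SB)"
      using fin by (intro sum_Un) auto
    also have "\<dots> \<le> sum (weight y s) ?SA + sum (weight y s) ?SB" using wn by (simp add: sum_nonneg)
    finally show "sum (weight y s) (?SA \<union> ?SB) \<le> n * Q * (\<kappa> * (s / n) * Y) ^ 3 / (1 - ?q) + n * Q * ?q ^ (n div k) / (1 - ?q)"
      using SA[of r] SB[of r] by linarith
  qed (use fin wn in auto)
  finally show ?thesis unfolding large_bound_def by simp
qed

section \<open>Single edges and the sum over all polymers\<close>

lemma card_adj: "card {(u, v). {u, v} \<in> E} \<le> 2 * k * n"
proof -
  let ?f = "\<lambda>(i, j, b). if b then (vert n (int i), vert n (int i - int j)) else (vert n (int i - int j), vert n (int i))"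
  have "{(u, v). {u, v} \<in> E} \<subseteq> ?f ` ({..<n} \<times> {1..k} \<times> UNIV)"
  proof
    fix z assume "z \<in> {(u, v). {u, v} \<in> E}"
    then obtain u v where z: "z = (u, v)" "{u, v} \<in> E" by auto
    then obtain i j where ij: "i < n" "j \<in> {1..k}" "{u, v} = edge (0 + int i) j" using edge_exists[of _ 0] by blast
    then have "(u, v) = ?f (i, j, True) \<or> (u, v) = ?f (i, j, False)"
      unfolding edge_def doubleton_eq_iff by auto
    then show "z \<in> ?f ` ({..<n} \<times> {1..k} \<times> UNIV)" using ij z by blast
  qed
  then have "card {(u, v). {u, v} \<in> E} \<le> card (?f ` ({..<n} \<times> {1..k} \<times> (UNIV :: bool set)))"
    by (intro card_mono) auto
  also have "\<dots> \<le> card ({..<n} \<times> {1..k} \<times> (UNIV :: bool set))" by (intro card_image_le) auto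
  finally show ?thesis by (simp add: card_cartesian_product mult_ac)
qed

lemma finite_adj: "finite {(u, v). {u, v} \<in> E}"
  by (rule finite_subset[of _ "{1..n} \<times> {1..n}"]) (use E_edge in auto)

lemma card_Emb_edge:
  assumes "e \<in> E"
  shows "card (Emb {e}) \<le> 2 * k * n"
proof -
  obtain a b where ab: "e = {a, b}" using E_edge[OF assms] by (auto simp: card_2_iff)
  have "inj_on (\<lambda>f. (f a, f b)) (Emb {e})"
  proof (rule inj_onI)
    fix f g assume f: "f \<in> Emb {e}" and g: "g \<in> Emb {e}" and eq: "(f a, f b) = (g a, g b)"
    have "f \<in> e \<rightarrow>\<^sub>E {1..n}" "g \<in> e \<rightarrow>\<^sub>E {1..n}" using f g unfolding Emb_def by auto
    then show "f = g" using eq unfolding ab by (intro PiE_ext[of f "{a, b}" "\<lambda>_. {1..n}" g]) auto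
  qed
  moreover have "(\<lambda>f. (f a, f b)) ` Emb {e} \<subseteq> {(u, v). {u, v} \<in> E}"
    unfolding Emb_def ab by auto
  ultimately have "card (Emb {e}) \<le> card {(u, v). {u, v} \<in> E}"
    by (rule card_inj_on_le[OF _ _ finite_adj])
  then show ?thesis using card_adj by linarith
qed

definition polymers :: "nat set set set" where
  "polymers = {\<gamma>. \<gamma> \<subseteq> E \<and> connected_edges \<gamma> \<and> \<gamma> \<noteq> {}}"

lemma finite_polymers [simp]: "finite polymers"
  unfolding polymers_def by (auto intro: finite_subset[of _ "Pow E"])

lemma small_polymer:
  assumes "\<gamma> \<subseteq> E" "e \<in> \<gamma>" "card (\<Union>\<gamma>) < 3"
  shows "\<gamma> = {e}"
proof -
  have fin: "finite (\<Union>\<gamma>)"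
    by (rule finite_subset[of _ "{1..n}"]) (use assms(1) E_edge in blast, simp)
  have two: "card e' = 2" if "e' \<in> \<gamma>" for e' using that assms(1) E_edge by blast
  have eq: "e' = \<Union>\<gamma>" if "e' \<in> \<gamma>" for e'
    by (rule card_seteq[OF fin]) (use that two[OF that] assms(3) in auto)
  then show ?thesis using assms(2) by blast
qed

text \<open>The first summand comes from \<open>k * n\<close> single edges with
  \<open>2 * k * n\<close> possible images each. At \<open>s = 1\<close> its constant must be sharp,
  because it is precisely what the tilt cancels.\<close>

lemma sum_polymers_le:
  assumes k: "k \<ge> 3" and y: "0 \<le> y" "y \<le> Y" "Y \<ge> 1" and s: "s \<ge> 0" and rate: "rate Y s < 1"
  shows "(\<Sum>\<gamma>\<in>polymers. weight y s \<gamma>) \<le> 2 * real k ^ 2 * y * s ^ 2 + large_bound Y s"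
proof -
  let ?L = "{\<gamma>. \<gamma> \<subseteq> E \<and> connected_edges \<gamma> \<and> card (\<Union>\<gamma>) \<ge> 3}"
  note wn = weight_nonneg[OF y(1) s]
  have finL: "finite ?L" by (auto intro: finite_subset[of _ "Pow E"])
  have sub: "polymers \<subseteq> (\<lambda>e. {e}) ` E \<union> ?L"
  proof
    fix \<gamma> assume g: "\<gamma> \<in> polymers"
    then obtain e where e: "e \<in> \<gamma>" unfolding polymers_def by blast
    show "\<gamma> \<in> (\<lambda>e. {e}) ` E \<union> ?L"
      using small_polymer[OF _ e] g e unfolding polymers_def by (cases "card (\<Union>\<gamma>) < 3") auto
  qed
  have "(\<Sum>\<gamma>\<in>polymers. weight y s \<gamma>) \<le> (\<Sum>\<gamma>\<in>(\<lambda>e. {e}) ` E \<union> ?L. weight y s \<gamma>)"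
    using sub wn finL by (intro sum_mono2) auto
  also have "\<dots> \<le> (\<Sum>\<gamma>\<in>(\<lambda>e. {e}) ` E. weight y s \<gamma>) + (\<Sum>\<gamma>\<in>?L. weight y s \<gamma>)"
    using sum_Un[of "(\<lambda>e. {e}) ` E" ?L "weight y s"] finL
      sum_nonneg[of "(\<lambda>e. {e}) ` E \<inter> ?L" "weight y s", OF wn] by simp
  also have "(\<Sum>\<gamma>\<in>(\<lambda>e. {e}) ` E. weight y s \<gamma>) = (\<Sum>e\<in>E. weight y s {e})"
    by (subst sum.reindex) (auto simp: inj_on_def)
  also have "\<dots> \<le> (\<Sum>e\<in>E. y * (2 * k * n) * (s / n) ^ 2)"
  proof (rule sum_mono)
    fix e assume e: "e \<in> E"
    have "real (card (Emb {e})) \<le> real (2 * k * n)" using card_Emb_edge[OF e] by (rule of_nat_mono)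
    then show "weight y s {e} \<le> y * (2 * k * n) * (s / n) ^ 2"
      unfolding weight_def using y s E_edge[OF e] by (auto intro!: mult_right_mono mult_left_mono)
  qed
  also have "\<dots> = 2 * real k ^ 2 * y * s ^ 2"
    using n1 by (simp add: card_E power2_eq_square field_simps)
  finally show ?thesis using sum_weight_large[OF k y s rate] by linarith
qed

end

section \<open>Expansion into polymers\<close>

lemma fact_lower:
  assumes "v \<le> n"
  shows "fact (n - v) * (n - v) ^ v \<le> (fact n :: nat)"
  using assms
proof (induction v)
  case (Suc v)
  have "fact (n - Suc v) * (n - Suc v) ^ Suc v \<le> fact (n - Suc v) * (n - Suc v) * (n - v) ^ v"
    by (simp add: power_mono)
  also have "\<dots> \<le> fact (n - Suc v) * (n - v) * (n - v) ^ v" by (intro mult_right_mono mult_left_mono) auto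
  also have "fact (n - Suc v) * (n - v) = fact (n - v)"
    using Suc.prems by (metis Suc_diff_Suc Suc_le_lessD fact_Suc mult.commute of_nat_id)
  also have "fact (n - v) * (n - v) ^ v \<le> fact n" using Suc by simp
  finally show ?case .
qed simp

text \<open>From \<open>n! / (n - v)! \<ge> (n - v) ^ v\<close> and Bernoulli's inequality. For few
  vertices no factor \<open>e ^ v\<close> is lost, which keeps the constant of the single edges
  sharp.\<close>

lemma fact_diff_le_small:
  assumes "v \<le> V" "real V ^ 2 < real n"
  shows "fact (n - v) \<le> fact n * (1 / real n) ^ v / (1 - real V ^ 2 / real n)"
proof -
  have n: "real n > 0" using assms(2) by (meson le_less_trans zero_le_power2)
  have "V \<le> V ^ 2" by (simp add: power2_eq_square)
  moreover have "V ^ 2 < n" using assms(2) by (metis of_nat_less_iff of_nat_power)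
  ultimately have vn: "v \<le> n" using assms(1) by linarith
  have pos: "1 - real V ^ 2 / real n > 0" using assms(2) n by simp
  have "1 - real V ^ 2 / real n \<le> 1 + real v * (- (real v / real n))"
    using assms(1) n by (simp add: divide_right_mono power_mono flip: power2_eq_square)
  also have "\<dots> \<le> (1 + (- (real v / real n))) ^ v"
    using vn n by (intro Bernoulli_inequality) simp
  also have "1 + (- (real v / real n)) = real (n - v) / real n" using vn n by (simp add: of_nat_diff field_simps)
  finally have "1 - real V ^ 2 / real n \<le> real (n - v) ^ v / real n ^ v" by (simp add: power_divide)
  then have "fact (n - v) * (real n ^ v * (1 - real V ^ 2 / real n)) \<le> fact (n - v) * real (n - v) ^ v"
    using n by (intro mult_left_mono) (simp_all add: field_simps)
  also have "\<dots> \<le> fact n"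
    using fact_lower[OF vn] by (metis of_nat_fact of_nat_le_iff of_nat_mult of_nat_power)
  finally show ?thesis using pos n by (simp add: field_simps power_divide)
qed

text \<open>Lowering \<open>n\<close> and \<open>v\<close> together reduces the step to
  \<open>(1 + 1 / m) ^ v \<le> e\<close> for \<open>v \<le> m\<close>, where
  \<open>n = m + 1\<close>.\<close>

lemma fact_diff_le:
  assumes "v \<le> n"
  shows "fact (n - v) \<le> fact n * (exp 1 / real n) ^ v"
  using assms
proof (induction v arbitrary: n)
  case (Suc v)
  then obtain m where m: "n = Suc m" "v \<le> m" by (cases n) auto
  show ?case
  proof (cases "m = 0")
    case True
    then show ?thesis using m by simp
  next
    case False
    have "(real n / real m) ^ v = (1 + 1 / real m) ^ v" using m False by (simp add: field_simps)
    also have "\<dots> \<le> exp (1 / real m) ^ v" by (intro power_mono exp_ge_add_one_self) auto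
    also have "\<dots> = exp (real v / real m)" by (simp flip: exp_of_nat_mult)
    also have "\<dots> \<le> exp 1" using m False by simp
    finally have *: "real n ^ v \<le> exp 1 * real m ^ v" using False by (simp add: power_divide field_simps)
    have "fact (n - Suc v) = fact (m - v)" using m by simp
    also have "\<dots> \<le> fact m * (exp 1 / real m) ^ v" using Suc.IH[OF m(2)] .
    also have "\<dots> = fact m * exp 1 ^ v * (1 / real m ^ v)" by (simp add: power_divide)
    also have "\<dots> \<le> fact m * exp 1 ^ v * (exp 1 / real n ^ v)"
      using * False m by (intro mult_left_mono) (auto simp: field_simps)
    also have "\<dots> = (real n * fact m) * (exp 1 / real n) ^ Suc v"
      using m by (simp add: power_divide)
    also have "real n * fact m = fact n" using m by simp
    finally show ?thesis .
  qed
qed simp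

lemma sum_Pow_prod:
  fixes f :: "'a \<Rightarrow> real"
  assumes "finite A"
  shows "(\<Sum>X\<in>Pow A. \<Prod>x\<in>X. f x) = (\<Prod>x\<in>A. 1 + f x)"
  using prod_add[OF assms, of f "\<lambda>_. 1"] by (simp add: add.commute)

text \<open>Composed with the inverse of one fixed extension, every other extension becomes a
  permutation that fixes \<open>V\<close> pointwise.\<close>

lemma card_perms_extending:
  assumes "finite A" "V \<subseteq> A"
  shows "card {\<sigma>. \<sigma> permutes A \<and> restrict \<sigma> V = f} \<le> fact (card A - card V)"
proof (cases "{\<sigma>. \<sigma> permutes A \<and> restrict \<sigma> V = f} = {}")
  case False
  then obtain \<tau> where \<tau>: "\<tau> permutes A" "restrict \<tau> V = f" by blast
  let ?F = "{\<sigma>. \<sigma> permutes A \<and> restrict \<sigma> V = f}"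
  have "inj_on (\<lambda>\<sigma>. inv \<tau> \<circ> \<sigma>) ?F"
  proof (intro inj_onI ext)
    fix \<sigma> \<rho> x assume "inv \<tau> \<circ> \<sigma> = inv \<tau> \<circ> \<rho>"
    then have "inv \<tau> (\<sigma> x) = inv \<tau> (\<rho> x)" by (metis comp_apply)
    then show "\<sigma> x = \<rho> x" by (rule injD[OF permutes_inj[OF permutes_inv[OF \<tau>(1)]]])
  qed
  moreover have "(\<lambda>\<sigma>. inv \<tau> \<circ> \<sigma>) ` ?F \<subseteq> {\<pi>. \<pi> permutes (A - V)}"
  proof clarify
    fix \<sigma> assume \<sigma>: "\<sigma> permutes A" "f = restrict \<sigma> V"
    have "\<sigma> x = \<tau> x" if "x \<in> V" for x using \<tau>(2) \<sigma>(2) that by (metis restrict_apply')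
    then have "(inv \<tau> \<circ> \<sigma>) x = x" if "x \<in> V" for x
      using that permutes_inverses(2)[OF \<tau>(1)] by simp
    then show "inv \<tau> \<circ> \<sigma> permutes (A - V)"
      by (intro permutes_superset[OF permutes_compose[OF \<sigma>(1) permutes_inv[OF \<tau>(1)]]]) auto
  qed
  ultimately have "card ?F \<le> card {\<pi>. \<pi> permutes (A - V)}"
    by (rule card_inj_on_le) (use assms in \<open>simp add: finite_permutations\<close>)
  also have "\<dots> = fact (card A - card V)"
    using assms by (intro card_permutations) (auto intro: card_Diff_subset finite_subset)
  finally show ?thesis .
next
  case True
  then show ?thesis by (simp only: card.empty)
qed

context cycle_power
begin

section \<open>Decomposition of an edge set into connected components\<close>

definition decomp :: "nat set set \<Rightarrow> nat set set set \<Rightarrow> bool" where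
  "decomp S \<Gamma> \<longleftrightarrow> \<Gamma> \<subseteq> polymers \<and> (\<forall>\<gamma>\<in>\<Gamma>. \<forall>\<gamma>'\<in>\<Gamma>. \<gamma> \<noteq> \<gamma>' \<longrightarrow> \<Union>\<gamma> \<inter> \<Union>\<gamma>' = {}) \<and> \<Union>\<Gamma> = S"

text \<open>If \<open>S\<close> is not connected, a violating cut \<open>U\<close> splits it into
  two proper subsets. Their decompositions combine, since the vertices of one lie inside
  \<open>U\<close> and those of the other outside.\<close>

lemma decomp_exists:
  assumes "S \<subseteq> E"
  shows "\<exists>\<Gamma>. decomp S \<Gamma>"
proof -
  have "finite S" using assms finite_E finite_subset by blast
  then show ?thesis using assms
  proof (induction S rule: finite_psubset_induct)
    case (psubset S)
    consider "S = {}" | "S \<noteq> {}" "connected_edges S" | "\<not> connected_edges S" by blast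
    then show ?case
    proof cases
      case 1
      then show ?thesis unfolding decomp_def by (intro exI[of _ "{}"]) auto
    next
      case 2
      then show ?thesis using psubset.prems unfolding decomp_def polymers_def by (intro exI[of _ "{S}"]) auto
    next
      case 3
      then have "\<exists>U. (\<forall>e\<in>S. e \<subseteq> U \<or> e \<inter> U = {}) \<and> \<not> (\<Union>S \<subseteq> U \<or> \<Union>S \<inter> U = {})"
        unfolding connected_edges_def by (simp only: not_all not_imp)
      then obtain U where "\<forall>e\<in>S. e \<subseteq> U \<or> e \<inter> U = {}" and notU: "\<not> (\<Union>S \<subseteq> U \<or> \<Union>S \<inter> U = {})"
        by (elim exE conjE)
      then have U: "\<And>e. e \<in> S \<Longrightarrow> e \<subseteq> U \<or> e \<inter> U = {}" by simp
      define S1 where "S1 = {e \<in> S. e \<subseteq> U}"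
      define S2 where "S2 = {e \<in> S. \<not> e \<subseteq> U}"
      obtain e2 where "e2 \<in> S" "\<not> e2 \<subseteq> U" using notU by blast
      obtain e1 where "e1 \<in> S" "e1 \<inter> U \<noteq> {}" using notU by blast
      then have "e1 \<subseteq> U" using U by blast
      have "S1 \<subset> S" using \<open>e2 \<in> S\<close> \<open>\<not> e2 \<subseteq> U\<close> unfolding S1_def by blast
      moreover have "S2 \<subset> S" using \<open>e1 \<in> S\<close> \<open>e1 \<subseteq> U\<close> unfolding S2_def by blast
      ultimately obtain \<Gamma>1 \<Gamma>2 where G: "decomp S1 \<Gamma>1" "decomp S2 \<Gamma>2"
        using psubset.IH[of S1] psubset.IH[of S2] psubset.prems by (meson order.trans psubset_imp_subset)
      have A: "\<Union>\<gamma> \<subseteq> U" if "\<gamma> \<in> \<Gamma>1" for \<gamma>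
      proof -
        have "\<gamma> \<subseteq> S1" using G(1) that unfolding decomp_def by auto
        then show ?thesis unfolding S1_def by blast
      qed
      have B: "\<Union>\<gamma> \<inter> U = {}" if "\<gamma> \<in> \<Gamma>2" for \<gamma>
      proof -
        have "\<gamma> \<subseteq> S2" using G(2) that unfolding decomp_def by auto
        then have "e \<inter> U = {}" if "e \<in> \<gamma>" for e using that U unfolding S2_def by auto
        then show ?thesis by blast
      qed
      have cross: "\<Union>\<gamma> \<inter> \<Union>\<gamma>' = {}" if "\<gamma> \<in> \<Gamma>1" "\<gamma>' \<in> \<Gamma>2" for \<gamma> \<gamma>' using A[OF that(1)] B[OF that(2)] by blast
      have "decomp S (\<Gamma>1 \<union> \<Gamma>2)"
        unfolding decomp_def
      proof (intro conjI ballI impI)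
        show "\<Gamma>1 \<union> \<Gamma>2 \<subseteq> polymers" using G unfolding decomp_def by simp
        have "\<Union>\<Gamma>1 = S1" "\<Union>\<Gamma>2 = S2" using G unfolding decomp_def by auto
        moreover have "S1 \<union> S2 = S" unfolding S1_def S2_def by auto
        ultimately show "\<Union>(\<Gamma>1 \<union> \<Gamma>2) = S" by (simp only: Union_Un_distrib)
        have G1: "\<Union>\<gamma> \<inter> \<Union>\<gamma>' = {}" if "\<gamma> \<in> \<Gamma>1" "\<gamma>' \<in> \<Gamma>1" "\<gamma> \<noteq> \<gamma>'" for \<gamma> \<gamma>'
          using G(1) that unfolding decomp_def by simp
        have G2: "\<Union>\<gamma> \<inter> \<Union>\<gamma>' = {}" if "\<gamma> \<in> \<Gamma>2" "\<gamma>' \<in> \<Gamma>2" "\<gamma> \<noteq> \<gamma>'" for \<gamma> \<gamma>'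
          using G(2) that unfolding decomp_def by simp
        fix \<gamma> \<gamma>' assume g: "\<gamma> \<in> \<Gamma>1 \<union> \<Gamma>2" "\<gamma>' \<in> \<Gamma>1 \<union> \<Gamma>2" "\<gamma> \<noteq> \<gamma>'"
        from g(1) show "\<Union>\<gamma> \<inter> \<Union>\<gamma>' = {}"
        proof
          assume 1: "\<gamma> \<in> \<Gamma>1"
          from g(2) show ?thesis using G1[OF 1 _ g(3)] cross[OF 1] by (rule UnE)
        next
          assume 1: "\<gamma> \<in> \<Gamma>2"
          from g(2) show ?thesis
          proof
            assume "\<gamma>' \<in> \<Gamma>1"
            from cross[OF this 1] show ?thesis by (simp only: Int_commute)
          qed (rule G2[OF 1 _ g(3)])
        qed
      qed
      then show ?thesis by blast
    qed
  qed
qed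

definition comps :: "nat set set \<Rightarrow> nat set set set" where
  "comps S = (SOME \<Gamma>. decomp S \<Gamma>)"

lemma decomp_comps: "S \<subseteq> E \<Longrightarrow> decomp S (comps S)"
  unfolding comps_def by (rule someI_ex[OF decomp_exists])

lemma comps_polymers: "S \<subseteq> E \<Longrightarrow> comps S \<subseteq> polymers"
  using decomp_comps[of S] by (simp add: decomp_def)

lemma Union_comps: "S \<subseteq> E \<Longrightarrow> \<Union>(comps S) = S"
  using decomp_comps[of S] by (simp add: decomp_def)

lemma finite_comps: "S \<subseteq> E \<Longrightarrow> finite (comps S)"
  using comps_polymers finite_polymers finite_subset by blast

lemma comps_disjoint:
  "S \<subseteq> E \<Longrightarrow> \<gamma> \<in> comps S \<Longrightarrow> \<gamma>' \<in> comps S \<Longrightarrow> \<gamma> \<noteq> \<gamma>' \<Longrightarrow> \<Union>\<gamma> \<inter> \<Union>\<gamma>' = {}"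
  using decomp_comps[of S] by (simp add: decomp_def)

lemma finite_verts: "\<gamma> \<subseteq> E \<Longrightarrow> finite (\<Union>\<gamma>)"
  by (rule finite_subset[of _ "{1..n}"]) (use E_edge in blast, simp)

lemma card_comps:
  assumes "S \<subseteq> E"
  shows "card S = (\<Sum>\<gamma>\<in>comps S. card \<gamma>)"
proof -
  have P: "\<gamma> \<subseteq> E" if "\<gamma> \<in> comps S" for \<gamma> using comps_polymers[OF assms] that unfolding polymers_def by blast
  have "card (\<Union>(comps S)) = (\<Sum>\<gamma>\<in>comps S. card \<gamma>)"
  proof (rule card_Union_disjoint)
    show "pairwise disjnt (comps S)"
      unfolding pairwise_def disjnt_def
    proof (intro ballI impI)
      fix \<gamma> \<gamma>' assume g: "\<gamma> \<in> comps S" "\<gamma>' \<in> comps S" "\<gamma> \<noteq> \<gamma>'"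
      have "e \<noteq> {}" if "e \<in> \<gamma>" for e using E_edge P[OF g(1)] that by fastforce
      then show "\<gamma> \<inter> \<gamma>' = {}" using comps_disjoint[OF assms g] by blast
    qed
    show "finite \<gamma>" if "\<gamma> \<in> comps S" for \<gamma> using P[OF that] finite_subset finite_E by blast
  qed
  then show ?thesis unfolding Union_comps[OF assms] .
qed

lemma card_verts_comps:
  assumes "S \<subseteq> E"
  shows "card (\<Union>S) = (\<Sum>\<gamma>\<in>comps S. card (\<Union>\<gamma>))"
proof -
  have P: "\<gamma> \<subseteq> E" if "\<gamma> \<in> comps S" for \<gamma> using comps_polymers[OF assms] that unfolding polymers_def by blast
  have "\<Union>(\<Union>(comps S)) = (\<Union>\<gamma>\<in>comps S. \<Union>\<gamma>)" by blast
  also have "card \<dots> = (\<Sum>\<gamma>\<in>comps S. card (\<Union>\<gamma>))"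
    by (rule card_UN_disjoint) (simp_all add: finite_comps[OF assms] finite_verts P comps_disjoint[OF assms])
  finally show ?thesis unfolding Union_comps[OF assms] .
qed

lemma finite_Emb: "S \<subseteq> E \<Longrightarrow> finite (Emb S)"
  unfolding Emb_def
  by (rule finite_subset[of _ "\<Union>S \<rightarrow>\<^sub>E {1..n}"]) (auto intro!: finite_PiE finite_verts)

text \<open>An embedding is determined by its restrictions to the components. Equality can fail,
  since embeddings of different components may have overlapping images.\<close>

lemma card_Emb_comps:
  assumes "S \<subseteq> E"
  shows "card (Emb S) \<le> (\<Prod>\<gamma>\<in>comps S. card (Emb \<gamma>))"
proof -
  have P: "\<gamma> \<subseteq> E" if "\<gamma> \<in> comps S" for \<gamma> using comps_polymers[OF assms] that unfolding polymers_def by blast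
  define F where "F f = (\<lambda>\<gamma>\<in>comps S. restrict f (\<Union>\<gamma>))" for f :: "nat \<Rightarrow> nat"
  have inj: "inj_on F (Emb S)"
  proof (rule inj_onI)
    fix f g assume f: "f \<in> Emb S" and g: "g \<in> Emb S" and eq: "F f = F g"
    have "f \<in> \<Union>S \<rightarrow>\<^sub>E {1..n}" "g \<in> \<Union>S \<rightarrow>\<^sub>E {1..n}" using f g unfolding Emb_def by auto
    then show "f = g"
    proof (rule PiE_ext)
      fix x assume "x \<in> \<Union>S"
      then have "x \<in> \<Union>(\<Union>(comps S))" unfolding Union_comps[OF assms] .
      then obtain \<gamma> where \<gamma>: "\<gamma> \<in> comps S" "x \<in> \<Union>\<gamma>" by blast
      have "F f \<gamma> x = F g \<gamma> x" using eq by simp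
      then show "f x = g x" using \<gamma> unfolding F_def by simp
    qed
  qed
  have sub: "F ` Emb S \<subseteq> PiE (comps S) Emb"
  proof
    fix h assume "h \<in> F ` Emb S"
    then obtain f where f: "f \<in> Emb S" "h = F f" by blast
    have "restrict f (\<Union>\<gamma>) \<in> Emb \<gamma>" if \<gamma>: "\<gamma> \<in> comps S" for \<gamma>
    proof -
      have "\<gamma> \<subseteq> \<Union>(comps S)" using \<gamma> by blast
      then have sub: "\<gamma> \<subseteq> S" unfolding Union_comps[OF assms] .
      note sub = sub Union_mono[OF sub]
      have "restrict f (\<Union>\<gamma>) ` e = f ` e" if "e \<in> \<gamma>" for e
        using that by (intro image_cong) auto
      moreover have "f ` e \<in> E" if "e \<in> \<gamma>" for e using that f(1) sub(1) unfolding Emb_def by blast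
      moreover have "inj_on f (\<Union>\<gamma>)" using f(1) sub(2) inj_on_subset unfolding Emb_def by blast
      moreover have "f x \<in> {1..n}" if "x \<in> \<Union>\<gamma>" for x using that f(1) sub(2) unfolding Emb_def by blast
      ultimately show ?thesis unfolding Emb_def by auto
    qed
    then show "h \<in> PiE (comps S) Emb" unfolding f(2) F_def by (simp add: restrict_PiE_iff)
  qed
  have fin: "finite (PiE (comps S) Emb)" using finite_comps[OF assms] finite_Emb P by (intro finite_PiE) auto
  have "card (Emb S) \<le> card (PiE (comps S) Emb)" by (rule card_inj_on_le[OF inj sub fin])
  then show ?thesis using finite_comps[OF assms] by (simp add: card_PiE)
qed

section \<open>The average of \<open>(1 + y) ^ overlap \<sigma>\<close> over permutations\<close>

abbreviation perms :: "(nat \<Rightarrow> nat) set" where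
  "perms \<equiv> {\<sigma>. \<sigma> permutes {1..n}}"

lemma card_perms_preserving:
  assumes "S \<subseteq> E"
  shows "card {\<sigma> \<in> perms. \<forall>e\<in>S. \<sigma> ` e \<in> E} \<le> card (Emb S) * fact (n - card (\<Union>S))"
proof -
  let ?V = "\<Union>S"
  have V: "?V \<subseteq> {1..n}" using assms E_edge by blast
  have "{\<sigma> \<in> perms. \<forall>e\<in>S. \<sigma> ` e \<in> E} \<subseteq> (\<Union>f\<in>Emb S. {\<sigma>. \<sigma> permutes {1..n} \<and> restrict \<sigma> ?V = f})"
  proof clarify
    fix \<sigma> assume \<sigma>: "\<sigma> permutes {1..n}" "\<forall>e\<in>S. \<sigma> ` e \<in> E"
    have "restrict \<sigma> ?V ` e = \<sigma> ` e" if "e \<in> S" for e using that by (intro image_cong) auto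
    moreover have "\<sigma> x \<in> {1..n}" if "x \<in> ?V" for x using permutes_in_image[OF \<sigma>(1)] V that by blast
    moreover have "inj_on \<sigma> ?V" using permutes_inj_on[OF \<sigma>(1)] .
    ultimately have "restrict \<sigma> ?V \<in> Emb S" unfolding Emb_def using \<sigma>(2) by auto
    then show "\<sigma> \<in> (\<Union>f\<in>Emb S. {\<sigma>. \<sigma> permutes {1..n} \<and> restrict \<sigma> ?V = f})" using \<sigma>(1) by blast
  qed
  then have "card {\<sigma> \<in> perms. \<forall>e\<in>S. \<sigma> ` e \<in> E} \<le> card (\<Union>f\<in>Emb S. {\<sigma>. \<sigma> permutes {1..n} \<and> restrict \<sigma> ?V = f})"
    by (intro card_mono finite_UN_I finite_Emb assms) (auto intro: finite_subset[OF _ finite_permutations[of "{1..n}"]])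
  also have "\<dots> \<le> (\<Sum>f\<in>Emb S. card {\<sigma>. \<sigma> permutes {1..n} \<and> restrict \<sigma> ?V = f})"
    by (rule card_UN_le[OF finite_Emb[OF assms]])
  also have "\<dots> \<le> (\<Sum>f\<in>Emb S. fact (n - card ?V))"
    using card_perms_extending[OF _ V] by (intro sum_mono) simp
  finally show ?thesis by simp
qed

definition overlap :: "(nat \<Rightarrow> nat) \<Rightarrow> nat" where
  "overlap \<sigma> = card {e \<in> E. \<sigma> ` e \<in> E}"

text \<open>\<open>comps\<close> is injective, as its union returns \<open>S\<close>. Forgetting
  that components are disjoint enlarges the sum to all sets of polymers, which is a product of
  factors \<open>1 + weight\<close>.\<close>

lemma sum_comps_le:
  assumes "y \<ge> 0" "s \<ge> 0"
  shows "(\<Sum>S\<in>Pow E. \<Prod>\<gamma>\<in>comps S. weight y s \<gamma>) \<le> exp (\<Sum>\<gamma>\<in>polymers. weight y s \<gamma>)"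
proof -
  note wn = weight_nonneg[OF assms]
  have "inj_on comps (Pow E)" by (intro inj_onI) (metis PowD Union_comps)
  then have "(\<Sum>S\<in>Pow E. \<Prod>\<gamma>\<in>comps S. weight y s \<gamma>) = (\<Sum>\<Gamma>\<in>comps ` Pow E. \<Prod>\<gamma>\<in>\<Gamma>. weight y s \<gamma>)"
    by (simp add: sum.reindex)
  also have "\<dots> \<le> (\<Sum>\<Gamma>\<in>Pow polymers. \<Prod>\<gamma>\<in>\<Gamma>. weight y s \<gamma>)"
    using comps_polymers wn by (intro sum_mono2) (auto intro: prod_nonneg)
  also have "\<dots> = (\<Prod>\<gamma>\<in>polymers. 1 + weight y s \<gamma>)" by (rule sum_Pow_prod) simp
  also have "\<dots> \<le> (\<Prod>\<gamma>\<in>polymers. exp (weight y s \<gamma>))"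
    using wn by (intro prod_mono) (auto simp: add_nonneg_nonneg exp_ge_add_one_self)
  also have "\<dots> = exp (\<Sum>\<gamma>\<in>polymers. weight y s \<gamma>)" by (simp add: exp_sum)
  finally show ?thesis .
qed

text \<open>For sets on \<open>v > V\<close> vertices the factor
  \<open>\<rho> ^ (v - V) \<ge> 1\<close> is inserted: \<open>\<rho> ^ v\<close> is absorbed by the
  vertex weights and \<open>1 / \<rho> ^ V\<close> stays in front.\<close>

lemma sum_perms_le:
  assumes y: "y \<ge> 0" and \<rho>: "\<rho> \<ge> 1" and V: "real V ^ 2 < real n"
  shows "(\<Sum>\<sigma>\<in>perms. (1 + y) ^ overlap \<sigma>) \<le> fact n *
     (exp (\<Sum>\<gamma>\<in>polymers. weight y 1 \<gamma>) / (1 - real V ^ 2 / real n) + exp (\<Sum>\<gamma>\<in>polymers. weight y (exp 1 * \<rho>) \<gamma>) / \<rho> ^ V)"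
proof -
  let ?D = "1 - real V ^ 2 / real n"
  have n0: "real n > 0" using n1 by simp
  have D: "?D > 0" using V n0 by simp
  have finp: "finite perms" by (simp add: finite_permutations)
  have "(\<Sum>\<sigma>\<in>perms. (1 + y) ^ overlap \<sigma>) = (\<Sum>\<sigma>\<in>perms. \<Sum>S\<in>{S \<in> Pow E. \<forall>e\<in>S. \<sigma> ` e \<in> E}. y ^ card S)"
  proof (intro sum.cong refl)
    fix \<sigma>
    have "(1 + y) ^ overlap \<sigma> = (\<Sum>S\<in>Pow {e \<in> E. \<sigma> ` e \<in> E}. y ^ card S)"
      using sum_Pow_prod[of "{e \<in> E. \<sigma> ` e \<in> E}" "\<lambda>_. y"] by (simp add: overlap_def)
    also have "Pow {e \<in> E. \<sigma> ` e \<in> E} = {S \<in> Pow E. \<forall>e\<in>S. \<sigma> ` e \<in> E}" by blast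
    finally show "(1 + y) ^ overlap \<sigma> = (\<Sum>S\<in>{S \<in> Pow E. \<forall>e\<in>S. \<sigma> ` e \<in> E}. y ^ card S)" .
  qed
  also have "\<dots> = (\<Sum>S\<in>Pow E. \<Sum>\<sigma>\<in>{\<sigma> \<in> perms. \<forall>e\<in>S. \<sigma> ` e \<in> E}. y ^ card S)"
    by (rule sum.swap_restrict) (use finp in auto)
  also have "\<dots> \<le> (\<Sum>S\<in>Pow E. fact n * ((\<Prod>\<gamma>\<in>comps S. weight y 1 \<gamma>) / ?D + (\<Prod>\<gamma>\<in>comps S. weight y (exp 1 * \<rho>) \<gamma>) / \<rho> ^ V))"
  proof (rule sum_mono)
    fix S assume "S \<in> Pow E"
    then have S: "S \<subseteq> E" by simp
    let ?v = "card (\<Union>S)"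
    let ?e = "\<Prod>\<gamma>\<in>comps S. y ^ card \<gamma> * real (card (Emb \<gamma>))"
    have w: "(\<Prod>\<gamma>\<in>comps S. weight y s \<gamma>) = ?e * (s / n) ^ ?v" for s
      unfolding weight_def prod.distrib card_verts_comps[OF S] by (simp add: power_sum)
    have e0: "?e \<ge> 0" using y by (intro prod_nonneg) auto
    have v: "?v \<le> n" using card_mono[of "{1..n}" "\<Union>S"] S E_edge by fastforce
    \<comment> \<open>Each summand alone settles one of the two cases. Adding them leaves both sums
      running over all \<open>S\<close>, as \<open>sum_comps_le\<close> requires.\<close>
    have fact: "fact (n - ?v) \<le> fact n * ((1 / n) ^ ?v / ?D + (exp 1 * \<rho> / n) ^ ?v / \<rho> ^ V)"
    proof (cases "?v \<le> V")
      case True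
      have "fact (n - ?v) \<le> fact n * (1 / real n) ^ ?v / ?D" by (rule fact_diff_le_small[OF True V])
      also have "\<dots> \<le> fact n * ((1 / n) ^ ?v / ?D + (exp 1 * \<rho> / n) ^ ?v / \<rho> ^ V)"
        using \<rho> by (simp add: distrib_left)
      finally show ?thesis .
    next
      case False
      have "fact (n - ?v) \<le> fact n * (exp 1 / real n) ^ ?v * 1" using fact_diff_le[OF v] by simp
      also have "\<dots> \<le> fact n * (exp 1 / real n) ^ ?v * (\<rho> ^ ?v / \<rho> ^ V)"
        using False \<rho> by (intro mult_left_mono) (auto simp: field_simps intro: power_increasing)
      also have "\<dots> = fact n * ((exp 1 * \<rho> / n) ^ ?v / \<rho> ^ V)" by (simp add: power_divide power_mult_distrib)
      also have "\<dots> \<le> fact n * ((1 / n) ^ ?v / ?D + (exp 1 * \<rho> / n) ^ ?v / \<rho> ^ V)"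
        using D by (simp add: distrib_left)
      finally show ?thesis .
    qed
    have "(\<Sum>\<sigma>\<in>{\<sigma> \<in> perms. \<forall>e\<in>S. \<sigma> ` e \<in> E}. y ^ card S) = y ^ card S * card {\<sigma> \<in> perms. \<forall>e\<in>S. \<sigma> ` e \<in> E}"
      by simp
    also have "\<dots> \<le> y ^ card S * ((\<Prod>\<gamma>\<in>comps S. real (card (Emb \<gamma>))) * fact (n - ?v))"
    proof (rule mult_left_mono)
      have "card {\<sigma> \<in> perms. \<forall>e\<in>S. \<sigma> ` e \<in> E} \<le> (\<Prod>\<gamma>\<in>comps S. card (Emb \<gamma>)) * fact (n - ?v)"
        using card_perms_preserving[OF S] card_Emb_comps[OF S] by (meson le_trans mult_le_mono1)
      then have "real (card {\<sigma> \<in> perms. \<forall>e\<in>S. \<sigma> ` e \<in> E}) \<le> real ((\<Prod>\<gamma>\<in>comps S. card (Emb \<gamma>)) * fact (n - ?v))"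
        by (rule of_nat_mono)
      then show "real (card {\<sigma> \<in> perms. \<forall>e\<in>S. \<sigma> ` e \<in> E}) \<le> (\<Prod>\<gamma>\<in>comps S. real (card (Emb \<gamma>))) * fact (n - ?v)"
        by simp
    qed (use y in simp)
    also have "\<dots> = ?e * fact (n - ?v)"
      unfolding card_comps[OF S] prod.distrib by (simp add: power_sum)
    also have "\<dots> \<le> ?e * (fact n * ((1 / n) ^ ?v / ?D + (exp 1 * \<rho> / n) ^ ?v / \<rho> ^ V))"
      using fact e0 by (rule mult_left_mono)
    also have "\<dots> = fact n * ((\<Prod>\<gamma>\<in>comps S. weight y 1 \<gamma>) / ?D + (\<Prod>\<gamma>\<in>comps S. weight y (exp 1 * \<rho>) \<gamma>) / \<rho> ^ V)"
      unfolding w by (simp add: algebra_simps)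
    finally show "(\<Sum>\<sigma>\<in>{\<sigma> \<in> perms. \<forall>e\<in>S. \<sigma> ` e \<in> E}. y ^ card S)
      \<le> fact n * ((\<Prod>\<gamma>\<in>comps S. weight y 1 \<gamma>) / ?D + (\<Prod>\<gamma>\<in>comps S. weight y (exp 1 * \<rho>) \<gamma>) / \<rho> ^ V)" .
  qed
  also have "\<dots> = fact n * ((\<Sum>S\<in>Pow E. \<Prod>\<gamma>\<in>comps S. weight y 1 \<gamma>) / ?D + (\<Sum>S\<in>Pow E. \<Prod>\<gamma>\<in>comps S. weight y (exp 1 * \<rho>) \<gamma>) / \<rho> ^ V)"
    by (simp only: sum_distrib_left[symmetric] sum.distrib sum_divide_distrib)
  also have "\<dots> \<le> fact n * (exp (\<Sum>\<gamma>\<in>polymers. weight y 1 \<gamma>) / ?D + exp (\<Sum>\<gamma>\<in>polymers. weight y (exp 1 * \<rho>) \<gamma>) / \<rho> ^ V)"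
    using y \<rho> D by (intro mult_left_mono add_mono divide_right_mono sum_comps_le) auto
  finally show ?thesis .
qed

end

section \<open>The tilted second moment\<close>

text \<open>Integrate \<open>2 a Z \<le> Z^2 + a^2\<close> on \<open>A\<close>, where off
  \<open>A\<close> the variable vanishes. The value of \<open>a\<close> below is the optimal one and
  gives the Cauchy-Schwarz bound.\<close>

lemma paley_zygmund:
  fixes Z :: "'a \<Rightarrow> real"
  assumes fin: "finite (set_pmf M)" and Z0: "\<And>x. x \<notin> A \<Longrightarrow> Z x = 0"
    and pos: "measure_pmf.expectation M Z > 0"
  shows "measure_pmf.prob M A \<ge> measure_pmf.expectation M Z ^ 2 / measure_pmf.expectation M (\<lambda>x. Z x ^ 2)"
proof -
  let ?E = "measure_pmf.expectation M"
  have int: "integrable (measure_pmf M) f" for f :: "'a \<Rightarrow> real"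
    using fin by (rule integrable_measure_pmf_finite)
  have sq0: "?E (\<lambda>x. Z x ^ 2) \<ge> 0" by (intro integral_nonneg_AE) auto
  show ?thesis
  \<comment> \<open>If the second moment is zero, the quotient is zero by the convention for
    division.\<close>
  proof (cases "?E (\<lambda>x. Z x ^ 2) = 0")
    case False
    then have sq: "?E (\<lambda>x. Z x ^ 2) > 0" using sq0 by linarith
    define a where "a = ?E (\<lambda>x. Z x ^ 2) / ?E Z"
    have a: "a > 0" unfolding a_def using sq pos by simp
    have "?E (\<lambda>x. 2 * a * Z x) \<le> ?E (\<lambda>x. Z x ^ 2 + a ^ 2 * indicator A x)"
    proof (intro integral_mono int)
      fix x
      show "2 * a * Z x \<le> Z x ^ 2 + a ^ 2 * indicator A x"
      proof (cases "x \<in> A")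
        case True
        have "0 \<le> (Z x - a) ^ 2" by simp
        then show ?thesis using True by (simp add: power2_diff algebra_simps)
      qed (simp add: Z0)
    qed
    also have "\<dots> = ?E (\<lambda>x. Z x ^ 2) + a ^ 2 * measure_pmf.prob M A"
      by (subst Bochner_Integration.integral_add[OF int int]) simp
    finally have "2 * a * ?E Z \<le> ?E (\<lambda>x. Z x ^ 2) + a ^ 2 * measure_pmf.prob M A" by simp
    moreover have "a * ?E Z = ?E (\<lambda>x. Z x ^ 2)" unfolding a_def using pos by simp
    ultimately have "?E (\<lambda>x. Z x ^ 2) \<le> a ^ 2 * measure_pmf.prob M A" by linarith
    then have "?E (\<lambda>x. Z x ^ 2) / a ^ 2 \<le> measure_pmf.prob M A"
      using a by (simp add: field_simps)
    moreover have "?E (\<lambda>x. Z x ^ 2) / a ^ 2 = ?E Z ^ 2 / ?E (\<lambda>x. Z x ^ 2)"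
      unfolding a_def using sq pos by (simp add: field_simps power2_eq_square)
    ultimately show ?thesis by simp
  qed simp
qed

section \<open>Expectations of products over the potential edges\<close>

lemma finite_potential_edges [simp]: "finite (potential_edges n)"
  unfolding potential_edges_def by (rule finite_subset[of _ "Pow {1..n}"]) auto

lemma card_potential_edges: "real (card (potential_edges n)) \<le> real n ^ 2 / 2"
proof -
  have "card (potential_edges n) = n choose 2"
    unfolding potential_edges_def using n_subsets[of "{1..n}" 2] by simp
  then have "2 * card (potential_edges n) \<le> n * (n - 1)"
    by (simp add: choose_two)
  also have "\<dots> \<le> n * n" by simp
  finally have "2 * card (potential_edges n) \<le> n * n" .
  then have "real (2 * card (potential_edges n)) \<le> real (n * n)" by (rule of_nat_mono)
  then show ?thesis by (simp add: power2_eq_square)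
qed

definition edge_pmf :: "nat \<Rightarrow> real \<Rightarrow> (nat set \<Rightarrow> bool) pmf" where
  "edge_pmf n p = Pi_pmf (potential_edges n) False (\<lambda>_. bernoulli_pmf p)"

lemma finite_edge_pmf: "finite (set_pmf (edge_pmf n p))"
proof -
  have "set_pmf (edge_pmf n p) \<subseteq> PiE_dflt (potential_edges n) False (set_pmf \<circ> (\<lambda>_. bernoulli_pmf p))"
    unfolding edge_pmf_def by (rule set_Pi_pmf_subset') simp
  moreover have "finite (PiE_dflt (potential_edges n) False (set_pmf \<circ> (\<lambda>_. bernoulli_pmf p)))"
    by (intro finite_PiE_dflt) auto
  ultimately show ?thesis by (rule finite_subset)
qed

text \<open>The factor of a potential edge \<open>e\<close> in the tilted indicator that all edges of \<open>T\<close> are present.\<close>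

definition tilt :: "real \<Rightarrow> 'a set \<Rightarrow> 'a \<Rightarrow> bool \<Rightarrow> real" where
  "tilt \<beta> T e b = (if b then \<beta> else if e \<in> T then 0 else 1)"

text \<open>Products of tilted indicators are again tilted indicators, so the second moment is
  computed by the same formula as the first.\<close>

lemma tilt_mult: "tilt \<beta> T e b * tilt \<beta> T' e b = tilt (\<beta> ^ 2) (T \<union> T') e b"
  unfolding tilt_def by (auto simp: power2_eq_square)

text \<open>\<open>1 - p + p * \<beta>\<close> is the normalisation for one potential edge, and
  \<open>p * \<beta> / (1 - p + p * \<beta>)\<close> is the edge probability under the tilted
  measure.\<close>

lemma expectation_tilt:
  assumes p: "0 \<le> p" "p \<le> 1" and \<beta>: "\<beta> \<ge> 0" and T: "T \<subseteq> potential_edges n"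
    and g: "1 - p + p * \<beta> > 0"
  shows "measure_pmf.expectation (edge_pmf n p) (\<lambda>x. \<Prod>e\<in>potential_edges n. tilt \<beta> T e (x e)) =
     (1 - p + p * \<beta>) ^ card (potential_edges n) * (p * \<beta> / (1 - p + p * \<beta>)) ^ card T"
proof -
  let ?g = "1 - p + p * \<beta>" and ?N = "potential_edges n"
  have finT: "finite T" using T finite_potential_edges finite_subset by blast
  have "measure_pmf.expectation (edge_pmf n p) (\<lambda>x. \<Prod>e\<in>?N. tilt \<beta> T e (x e)) =
     (\<Prod>e\<in>?N. measure_pmf.expectation (bernoulli_pmf p) (tilt \<beta> T e))"
    unfolding edge_pmf_def
    by (rule expectation_prod_Pi_pmf) (auto simp: tilt_def \<beta> intro!: integrable_measure_pmf_finite)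
  also have "\<dots> = (\<Prod>e\<in>?N. ?g * (if e \<in> T then p * \<beta> / ?g else 1))"
  proof (rule prod.cong[OF refl])
    fix e
    have "measure_pmf.expectation (bernoulli_pmf p) (tilt \<beta> T e) = p * tilt \<beta> T e True + (1 - p) * tilt \<beta> T e False"
      using p by simp
    then show "measure_pmf.expectation (bernoulli_pmf p) (tilt \<beta> T e) = ?g * (if e \<in> T then p * \<beta> / ?g else 1)"
      using g by (simp add: tilt_def)
  qed
  also have "\<dots> = ?g ^ card ?N * (\<Prod>e\<in>?N. if e \<in> T then p * \<beta> / ?g else 1)"
    by (simp add: prod.distrib)
  also have "(\<Prod>e\<in>?N. if e \<in> T then p * \<beta> / ?g else 1) = (\<Prod>e\<in>T. p * \<beta> / ?g)"
    using T by (intro prod.mono_neutral_cong_right) auto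
  finally show ?thesis by simp
qed

lemma prob_all_present:
  assumes p: "0 \<le> p" "p \<le> 1" and T: "T \<subseteq> potential_edges n"
  shows "measure_pmf.prob (edge_pmf n p) {x. \<forall>e\<in>T. x e} = p ^ card T"
proof -
  have "{x. \<forall>e\<in>T. x e} = Pi (potential_edges n) (\<lambda>e. if e \<in> T then {True} else UNIV)"
    using T by (auto simp: Pi_def)
  then have "measure_pmf.prob (edge_pmf n p) {x. \<forall>e\<in>T. x e} =
     (\<Prod>e\<in>potential_edges n. measure_pmf.prob (bernoulli_pmf p) (if e \<in> T then {True} else UNIV))"
    unfolding edge_pmf_def by (simp add: measure_Pi_pmf_Pi)
  also have "\<dots> = (\<Prod>e\<in>potential_edges n. if e \<in> T then p else 1)"
    using p by (intro prod.cong refl) (auto simp: measure_pmf_single)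
  also have "\<dots> = (\<Prod>e\<in>T. p)"
    using T by (intro prod.mono_neutral_cong_right) auto
  finally show ?thesis by simp
qed

section \<open>First and second moment of the number of copies\<close>

context cycle_power
begin

lemma image_E_potential: "\<sigma> permutes {1..n} \<Longrightarrow> (\<lambda>e. \<sigma> ` e) ` E \<subseteq> potential_edges n"
proof
  fix z assume s: "\<sigma> permutes {1..n}" and "z \<in> (\<lambda>e. \<sigma> ` e) ` E"
  then obtain e where e: "e \<in> E" "z = \<sigma> ` e" by blast
  have "\<sigma> ` e \<subseteq> \<sigma> ` {1..n}" using E_edge[OF e(1)] by (intro image_mono) simp
  then show "z \<in> potential_edges n"
    unfolding potential_edges_def e(2) using E_edge[OF e(1)] permutes_image[OF s]
    by (simp add: card_image[OF permutes_inj_on[OF s]])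
qed

lemma card_image_E: "\<sigma> permutes {1..n} \<Longrightarrow> card ((\<lambda>e. \<sigma> ` e) ` E) = k * n"
  using card_E by (subst card_image) (auto intro!: inj_onI simp: inj_image_eq_iff dest: permutes_inj)

text \<open>A copy has \<open>n\<close> vertices and so uses all of \<open>{1..n}\<close>. Its
  isomorphism becomes a permutation once it is extended by the identity.\<close>

lemma contains_copy_iff:
  assumes F: "F \<subseteq> potential_edges n"
  shows "contains_copy ({1..n}, F) (hamilton_cycle_power k n) \<longleftrightarrow> (\<exists>\<sigma>\<in>perms. \<forall>e\<in>E. \<sigma> ` e \<in> F)"
proof
  assume "contains_copy ({1..n}, F) (hamilton_cycle_power k n)"
  then obtain G' \<phi> where G: "subgraph G' ({1..n}, F)"
    and phi: "bij_betw \<phi> {1..n} (verts G')" "(\<lambda>e. \<phi> ` e) ` E = edges G'"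
    unfolding contains_copy_def graph_iso_def E_def by (auto simp: hamilton_cycle_power_def)
  have sub: "verts G' \<subseteq> {1..n}" "edges G' \<subseteq> F" using G unfolding subgraph_def by auto
  have "card (verts G') = card {1..n}" using bij_betw_same_card[OF phi(1)] by simp
  then have "verts G' = {1..n}" using sub(1) by (intro card_subset_eq) auto
  then have bij: "bij_betw \<phi> {1..n} {1..n}" using phi(1) by simp
  define \<sigma> where "\<sigma> x = (if x \<in> {1..n} then \<phi> x else x)" for x
  have "bij_betw \<sigma> {1..n} {1..n} = bij_betw \<phi> {1..n} {1..n}"
    by (rule bij_betw_cong) (simp add: \<sigma>_def)
  then have "bij_betw \<sigma> {1..n} {1..n}" using bij by simp
  then have "\<sigma> permutes {1..n}" by (rule bij_imp_permutes) (auto simp: \<sigma>_def)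
  moreover have "\<sigma> ` e \<in> F" if "e \<in> E" for e
  proof -
    have "\<sigma> ` e = \<phi> ` e" using E_edge[OF that] by (intro image_cong) (auto simp: \<sigma>_def)
    moreover have "\<phi> ` e \<in> edges G'" unfolding phi(2)[symmetric] using that by (rule imageI)
    ultimately show ?thesis using sub(2) by auto
  qed
  ultimately show "\<exists>\<sigma>\<in>perms. \<forall>e\<in>E. \<sigma> ` e \<in> F" by blast
next
  assume "\<exists>\<sigma>\<in>perms. \<forall>e\<in>E. \<sigma> ` e \<in> F"
  then obtain \<sigma> where s: "\<sigma> permutes {1..n}" "\<And>e. e \<in> E \<Longrightarrow> \<sigma> ` e \<in> F" by blast
  define G' where "G' = ({1..n}, (\<lambda>e. \<sigma> ` e) ` E)"
  have "subgraph G' ({1..n}, F)"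
    unfolding subgraph_def simple_graph_def G'_def
    using image_E_potential[OF s(1)] s(2) by (auto simp: potential_edges_def)
  moreover have "graph_iso (hamilton_cycle_power k n) G'"
    unfolding graph_iso_def G'_def E_def
    using permutes_imp_bij[OF s(1)] by (intro exI[of _ \<sigma>]) (simp add: hamilton_cycle_power_def)
  ultimately show "contains_copy ({1..n}, F) (hamilton_cycle_power k n)"
    unfolding contains_copy_def by blast
qed

lemma prob_contains_copy:
  "measure_pmf.prob (binomial_random_graph n p) {G. contains_copy G (hamilton_cycle_power k n)} =
   measure_pmf.prob (edge_pmf n p) {x. \<exists>\<sigma>\<in>perms. \<forall>e\<in>E. x (\<sigma> ` e)}"
proof -
  have "(\<lambda>x. ({1..n}, {e \<in> potential_edges n. x e})) -` {G. contains_copy G (hamilton_cycle_power k n)} =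
     {x. \<exists>\<sigma>\<in>perms. \<forall>e\<in>E. x (\<sigma> ` e)}"
  proof (intro set_eqI)
    fix x :: "nat set \<Rightarrow> bool"
    have "contains_copy ({1..n}, {e \<in> potential_edges n. x e}) (hamilton_cycle_power k n) \<longleftrightarrow>
       (\<exists>\<sigma>\<in>perms. \<forall>e\<in>E. \<sigma> ` e \<in> {e \<in> potential_edges n. x e})"
      by (rule contains_copy_iff) auto
    also have "\<dots> \<longleftrightarrow> (\<exists>\<sigma>\<in>perms. \<forall>e\<in>E. x (\<sigma> ` e))"
      using image_E_potential by fastforce
    finally show "x \<in> (\<lambda>x. ({1..n}, {e \<in> potential_edges n. x e})) -` {G. contains_copy G (hamilton_cycle_power k n)} \<longleftrightarrow>
       x \<in> {x. \<exists>\<sigma>\<in>perms. \<forall>e\<in>E. x (\<sigma> ` e)}" by simp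
  qed
  then show ?thesis unfolding binomial_random_graph_def edge_pmf_def by simp
qed

lemma first_moment:
  assumes p: "0 \<le> p" "p \<le> 1"
  shows "measure_pmf.prob (binomial_random_graph n p) {G. contains_copy G (hamilton_cycle_power k n)}
     \<le> fact n * p ^ (k * n)"
proof -
  have finp: "finite perms" by (simp add: finite_permutations)
  have "measure_pmf.prob (edge_pmf n p) {x. \<exists>\<sigma>\<in>perms. \<forall>e\<in>E. x (\<sigma> ` e)} =
     measure_pmf.prob (edge_pmf n p) (\<Union>\<sigma>\<in>perms. {x. \<forall>e\<in>(\<lambda>e. \<sigma> ` e) ` E. x e})"
    by (intro arg_cong[where f = "measure_pmf.prob (edge_pmf n p)"]) auto
  also have "\<dots> \<le> (\<Sum>\<sigma>\<in>perms. measure_pmf.prob (edge_pmf n p) {x. \<forall>e\<in>(\<lambda>e. \<sigma> ` e) ` E. x e})"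
    by (rule measure_pmf.finite_measure_subadditive_finite[OF finp]) auto
  also have "\<dots> = (\<Sum>\<sigma>\<in>perms. p ^ (k * n))"
    by (intro sum.cong refl) (simp only: mem_Collect_eq prob_all_present[OF p image_E_potential] card_image_E)
  also have "\<dots> = fact n * p ^ (k * n)"
    using card_permutations[of "{1..n}" n] by simp
  finally show ?thesis unfolding prob_contains_copy .
qed

lemma card_Int_images:
  assumes t: "\<tau> permutes {1..n}" and r: "\<rho> permutes {1..n}"
  shows "card ((\<lambda>e. (\<tau> \<circ> \<rho>) ` e) ` E \<inter> (\<lambda>e. \<tau> ` e) ` E) = overlap \<rho>"
proof -
  have "(\<lambda>e. (\<tau> \<circ> \<rho>) ` e) ` E \<inter> (\<lambda>e. \<tau> ` e) ` E = (\<lambda>e. (\<tau> \<circ> \<rho>) ` e) ` {e \<in> E. \<rho> ` e \<in> E}"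
  proof (intro equalityI subsetI)
    fix z assume "z \<in> (\<lambda>e. (\<tau> \<circ> \<rho>) ` e) ` E \<inter> (\<lambda>e. \<tau> ` e) ` E"
    then obtain e e' where e: "e \<in> E" "z = (\<tau> \<circ> \<rho>) ` e" "e' \<in> E" "z = \<tau> ` e'" by blast
    then have "\<tau> ` (\<rho> ` e) = \<tau> ` e'" by (simp add: image_comp)
    then have "\<rho> ` e = e'" using permutes_inj[OF t] by (simp add: inj_image_eq_iff)
    then show "z \<in> (\<lambda>e. (\<tau> \<circ> \<rho>) ` e) ` {e \<in> E. \<rho> ` e \<in> E}" using e by blast
  next
    fix z assume "z \<in> (\<lambda>e. (\<tau> \<circ> \<rho>) ` e) ` {e \<in> E. \<rho> ` e \<in> E}"
    then obtain e where e: "e \<in> E" "\<rho> ` e \<in> E" "z = (\<tau> \<circ> \<rho>) ` e" by blast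
    then have "z = \<tau> ` (\<rho> ` e)" by (simp add: image_comp)
    then show "z \<in> (\<lambda>e. (\<tau> \<circ> \<rho>) ` e) ` E \<inter> (\<lambda>e. \<tau> ` e) ` E" using e by blast
  qed
  moreover have "inj_on (\<lambda>e. (\<tau> \<circ> \<rho>) ` e) {e \<in> E. \<rho> ` e \<in> E}"
    by (intro inj_onI) (rule inj_image_eq_iff[OF permutes_inj[OF permutes_compose[OF r t]], THEN iffD1])
  ultimately show ?thesis unfolding overlap_def by (simp add: card_image)
qed

text \<open>\<open>R\<close> is the ratio of the second moment to the squared first moment of the
  tilted count over permutations; every copy is counted equally often, which cancels. With
  \<open>a\<close> the edge probability under the tilt \<open>\<beta> ^ 2\<close>, a shared edge
  gives \<open>1 / a = 1 + y\<close>.\<close>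

lemma second_moment:
  assumes p: "0 < p" "p \<le> 1" and \<beta>: "0 < \<beta>" "\<beta> \<le> 1"
  defines "g \<equiv> 1 - p + p * \<beta>" and "g2 \<equiv> 1 - p + p * \<beta> ^ 2" and "N \<equiv> card (potential_edges n)"
  defines "R \<equiv> (g2 / g ^ 2) ^ N * (\<beta> * g / g2) ^ (2 * (k * n)) *
      ((\<Sum>\<sigma>\<in>perms. (1 + (1 - p) / (p * \<beta> ^ 2)) ^ overlap \<sigma>) / fact n)"
  shows "R > 0" "measure_pmf.prob (binomial_random_graph n p) {G. contains_copy G (hamilton_cycle_power k n)} \<ge> 1 / R"
proof -
  let ?E = "measure_pmf.expectation (edge_pmf n p)"
  let ?h = "k * n"
  define y where "y = (1 - p) / (p * \<beta> ^ 2)"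
  define T where "T \<sigma> = (\<lambda>e. \<sigma> ` e) ` E" for \<sigma> :: "nat \<Rightarrow> nat"
  define W where "W \<sigma> x = (\<Prod>e\<in>potential_edges n. tilt \<beta> (T \<sigma>) e (x e))" for \<sigma> x
  define Z where "Z x = (\<Sum>\<sigma>\<in>perms. W \<sigma> x)" for x
  define a where "a = p * \<beta> ^ 2 / g2"
  have finp: "finite perms" by (simp add: finite_permutations)
  have cardp: "card perms = fact n" using card_permutations[of "{1..n}" n] by simp
  have int: "integrable (measure_pmf (edge_pmf n p)) f" for f :: "_ \<Rightarrow> real"
    using finite_edge_pmf by (rule integrable_measure_pmf_finite)
  have g: "g > 0" unfolding g_def using p \<beta> by (intro add_nonneg_pos) auto
  have g2: "g2 > 0" unfolding g2_def using p \<beta> by (intro add_nonneg_pos) auto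
  have a: "a > 0" "1 / a = 1 + y"
    unfolding a_def y_def using g2 p \<beta> by (auto simp: g2_def field_simps)
  have y: "y \<ge> 0" unfolding y_def using p \<beta> by simp
  have TP: "T \<sigma> \<subseteq> potential_edges n" "card (T \<sigma>) = ?h" "finite (T \<sigma>)" if "\<sigma> \<in> perms" for \<sigma>
    unfolding T_def using image_E_potential card_image_E that by auto
  have EW: "?E (W \<sigma>) = g ^ N * (p * \<beta> / g) ^ ?h" if "\<sigma> \<in> perms" for \<sigma>
    unfolding W_def N_def using expectation_tilt[of p \<beta> "T \<sigma>" n] p \<beta> TP[OF that] g
    unfolding g_def by simp
  have EZ: "?E Z = fact n * (g ^ N * (p * \<beta> / g) ^ ?h)"
  proof -
    have "?E Z = (\<Sum>\<sigma>\<in>perms. ?E (W \<sigma>))"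
      unfolding Z_def by (rule Bochner_Integration.integral_sum[OF int])
    also have "\<dots> = (\<Sum>\<sigma>\<in>perms. g ^ N * (p * \<beta> / g) ^ ?h)" by (intro sum.cong refl EW)
    also have "\<dots> = fact n * (g ^ N * (p * \<beta> / g) ^ ?h)"
      by (simp only: sum_constant cardp of_nat_fact)
    finally show ?thesis .
  qed
  then have EZ0: "?E Z > 0" using g p \<beta> by simp
  have EWW: "?E (\<lambda>x. W (\<tau> \<circ> \<rho>) x * W \<tau> x) = g2 ^ N * a ^ (2 * ?h) * (1 + y) ^ overlap \<rho>"
    if t: "\<tau> \<in> perms" and r: "\<rho> \<in> perms" for \<tau> \<rho>
  proof -
    have tr: "\<tau> \<circ> \<rho> \<in> perms" using permutes_compose t r by auto
    have "?E (\<lambda>x. W (\<tau> \<circ> \<rho>) x * W \<tau> x) =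
       ?E (\<lambda>x. \<Prod>e\<in>potential_edges n. tilt (\<beta> ^ 2) (T (\<tau> \<circ> \<rho>) \<union> T \<tau>) e (x e))"
      unfolding W_def by (simp add: prod.distrib[symmetric] tilt_mult)
    also have "\<dots> = g2 ^ N * a ^ card (T (\<tau> \<circ> \<rho>) \<union> T \<tau>)"
      unfolding N_def a_def g2_def
      by (rule expectation_tilt) (use p \<beta> TP[OF t] TP[OF tr] g2 in \<open>auto simp: g2_def\<close>)
    also have "card (T (\<tau> \<circ> \<rho>) \<union> T \<tau>) + overlap \<rho> = 2 * ?h"
      using card_Un_Int[of "T (\<tau> \<circ> \<rho>)" "T \<tau>"] TP[OF t] TP[OF tr] card_Int_images[of \<tau> \<rho>] t r
      unfolding T_def by simp
    then have "a ^ card (T (\<tau> \<circ> \<rho>) \<union> T \<tau>) * a ^ overlap \<rho> = a ^ (2 * ?h)" by (simp flip: power_add)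
    then have "a ^ card (T (\<tau> \<circ> \<rho>) \<union> T \<tau>) = a ^ (2 * ?h) * (1 + y) ^ overlap \<rho>"
      unfolding a(2)[symmetric] using a(1) by (simp add: power_divide field_simps)
    finally show ?thesis by (simp only: mult.assoc)
  qed
  have "?E (\<lambda>x. Z x ^ 2) = (\<Sum>\<tau>\<in>perms. \<Sum>\<sigma>\<in>perms. ?E (\<lambda>x. W \<sigma> x * W \<tau> x))"
  proof -
    have "Z x ^ 2 = (\<Sum>\<tau>\<in>perms. \<Sum>\<sigma>\<in>perms. W \<sigma> x * W \<tau> x)" for x
      unfolding Z_def power2_eq_square by (simp only: sum_distrib_left sum_distrib_right)
    then show ?thesis by (simp add: int Bochner_Integration.integral_sum)
  qed
  \<comment> \<open>Writing the second permutation as \<open>\<tau> \<circ> \<rho>\<close> makes the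
    inner sum the same for every \<open>\<tau>\<close>.\<close>
  also have "\<dots> = (\<Sum>\<tau>\<in>perms. \<Sum>\<rho>\<in>perms. ?E (\<lambda>x. W (\<tau> \<circ> \<rho>) x * W \<tau> x))"
  proof (rule sum.cong[OF refl])
    fix \<tau> assume "\<tau> \<in> perms"
    then have t: "\<tau> permutes {1..n}" by simp
    show "(\<Sum>\<sigma>\<in>perms. ?E (\<lambda>x. W \<sigma> x * W \<tau> x)) = (\<Sum>\<rho>\<in>perms. ?E (\<lambda>x. W (\<tau> \<circ> \<rho>) x * W \<tau> x))"
      by (rule setum_permutations_compose_left[OF t])
  qed
  also have "\<dots> = (\<Sum>\<tau>\<in>perms. \<Sum>\<rho>\<in>perms. g2 ^ N * a ^ (2 * ?h) * (1 + y) ^ overlap \<rho>)"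
    by (intro sum.cong refl EWW)
  also have "\<dots> = fact n * (g2 ^ N * a ^ (2 * ?h) * (\<Sum>\<rho>\<in>perms. (1 + y) ^ overlap \<rho>))"
    by (simp only: sum_constant cardp of_nat_fact sum_distrib_left)
  finally have EZ2: "?E (\<lambda>x. Z x ^ 2) = fact n * (g2 ^ N * a ^ (2 * ?h) * (\<Sum>\<rho>\<in>perms. (1 + y) ^ overlap \<rho>))" .
  have S0: "(\<Sum>\<rho>\<in>perms. (1 + y) ^ overlap \<rho>) > 0"
  proof (rule sum_pos[OF finp])
    show "perms \<noteq> {}" using permutes_id by blast
  qed (use y in auto)
  have bg: "\<beta> * g / g2 > 0" using \<beta> g g2 by simp
  show "R > 0" unfolding R_def y_def[symmetric] using S0 bg g g2 by simp
  have agg: "a / (p * \<beta> / g) = \<beta> * g / g2"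
    unfolding a_def using p \<beta> g g2 by (simp add: power2_eq_square field_simps)
  have "?E (\<lambda>x. Z x ^ 2) / ?E Z ^ 2 = (g2 ^ N / (g ^ N) ^ 2) * (a ^ (2 * ?h) / ((p * \<beta> / g) ^ ?h) ^ 2) *
     ((\<Sum>\<rho>\<in>perms. (1 + y) ^ overlap \<rho>) / fact n)"
    unfolding EZ EZ2 using g p \<beta> by (simp add: power2_eq_square field_simps)
  also have "g2 ^ N / (g ^ N) ^ 2 = (g2 / g ^ 2) ^ N"
    by (simp add: power_divide power_mult[symmetric] mult.commute)
  also have "a ^ (2 * ?h) / ((p * \<beta> / g) ^ ?h) ^ 2 = (a / (p * \<beta> / g)) ^ (2 * ?h)"
    by (metis power_divide power_mult mult.commute)
  finally have R: "?E (\<lambda>x. Z x ^ 2) / ?E Z ^ 2 = R" unfolding agg R_def y_def by simp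
  have "?E Z ^ 2 / ?E (\<lambda>x. Z x ^ 2) \<le> measure_pmf.prob (edge_pmf n p) {x. \<exists>\<sigma>\<in>perms. \<forall>e\<in>E. x (\<sigma> ` e)}"
  proof (rule paley_zygmund[OF finite_edge_pmf _ EZ0])
    fix x assume x: "x \<notin> {x. \<exists>\<sigma>\<in>perms. \<forall>e\<in>E. x (\<sigma> ` e)}"
    have "W \<sigma> x = 0" if s: "\<sigma> \<in> perms" for \<sigma>
    proof -
      obtain e where e: "e \<in> E" "\<not> x (\<sigma> ` e)" using x s by blast
      then have "\<sigma> ` e \<in> T \<sigma>" unfolding T_def by blast
      then have "\<sigma> ` e \<in> potential_edges n" "tilt \<beta> (T \<sigma>) (\<sigma> ` e) (x (\<sigma> ` e)) = 0"
        using TP[OF s] e(2) by (auto simp: tilt_def)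
      then show ?thesis unfolding W_def by (intro prod_zero) auto
    qed
    then show "Z x = 0" unfolding Z_def by simp
  qed
  then show "measure_pmf.prob (binomial_random_graph n p) {G. contains_copy G (hamilton_cycle_power k n)} \<ge> 1 / R"
    unfolding prob_contains_copy R[symmetric] by simp
qed

text \<open>With \<open>\<eta> = 1 - \<beta>\<close>, the logarithm of the left side is roughly
  \<open>1 - p\<close> times \<open>(n^2 / 2) p \<eta>^2 - 2 k n \<eta>\<close>. Its minimum, at
  \<open>\<eta> = 2k / (n p)\<close>, is \<open>-2 k^2 / p\<close>; hence the choice of
  \<open>\<beta>\<close>. The last exponential is the error from replacing \<open>g\<close> and
  \<open>g2\<close> by 1.\<close>

lemma tilt_factor_le:
  assumes p: "0 < p" "p \<le> 1" and \<beta>: "\<beta> = 1 - 2 * real k / (real n * p)" "\<beta> > 0"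
  shows "((1 - p + p * \<beta> ^ 2) / (1 - p + p * \<beta>) ^ 2) ^ card (potential_edges n) *
      (\<beta> * (1 - p + p * \<beta>) / (1 - p + p * \<beta> ^ 2)) ^ (2 * (k * n))
    \<le> exp (- (2 * real k ^ 2 * ((1 - p) / (p * \<beta> ^ 2)))) * exp (4 * real k ^ 2 / p * (1 / \<beta> ^ 2 - 1))"
proof -
  define g where "g = 1 - p + p * \<beta>"
  define g2 where "g2 = 1 - p + p * \<beta> ^ 2"
  define \<eta> where "\<eta> = 1 - \<beta>"
  define N where "N = card (potential_edges n)"
  have n0: "real n > 0" using n1 by simp
  have eta: "\<eta> = 2 * real k / (real n * p)" "\<eta> \<ge> 0" unfolding \<eta>_def \<beta>(1) using p n0 by auto
  have b1: "\<beta> \<le> 1" using eta(2) unfolding \<eta>_def by simp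
  have g: "g > 0" unfolding g_def using p \<beta>(2) by (intro add_nonneg_pos) auto
  have g2: "g2 > 0" unfolding g2_def using p \<beta>(2) by (intro add_nonneg_pos) auto
  have gb: "g \<ge> \<beta>"
  proof -
    have "g - \<beta> = (1 - p) * (1 - \<beta>)" unfolding g_def by (simp add: algebra_simps)
    also have "\<dots> \<ge> 0" using p b1 by simp
    finally show ?thesis by simp
  qed
  have g21: "g2 \<le> 1"
  proof -
    have "\<beta> ^ 2 \<le> 1" using b1 \<beta>(2) by (simp add: power_le_one)
    then have "p * \<beta> ^ 2 \<le> p * 1" using p by (intro mult_left_mono) auto
    then show ?thesis unfolding g2_def by simp
  qed
  \<comment> \<open>\<open>g2 - g ^ 2\<close> is the variance of a variable with value
    \<open>\<beta>\<close> with probability \<open>p\<close> and \<open>1\<close> otherwise, namely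
    \<open>p * (1 - p) * \<eta> ^ 2\<close>.\<close>
  have "g2 / g ^ 2 = 1 + p * (1 - p) * \<eta> ^ 2 / g ^ 2"
  proof -
    have "g2 = g ^ 2 + p * (1 - p) * \<eta> ^ 2"
      unfolding g2_def g_def \<eta>_def by (simp add: power2_eq_square algebra_simps)
    then show ?thesis using g by (simp add: add_divide_distrib)
  qed
  also have "\<dots> \<le> exp (p * (1 - p) * \<eta> ^ 2 / g ^ 2)" by (rule exp_ge_add_one_self)
  finally have A: "g2 / g ^ 2 \<le> exp (p * (1 - p) * \<eta> ^ 2 / g ^ 2)" .
  have "\<beta> * g / g2 = 1 + (- ((1 - p) * \<eta> / g2))"
  proof -
    have "\<beta> * g = g2 - (1 - p) * \<eta>"
      unfolding g2_def g_def \<eta>_def by (simp add: power2_eq_square algebra_simps)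
    then show ?thesis using g2 by (simp add: diff_divide_distrib)
  qed
  also have "\<dots> \<le> exp (- ((1 - p) * \<eta> / g2))" by (rule exp_ge_add_one_self)
  finally have B: "\<beta> * g / g2 \<le> exp (- ((1 - p) * \<eta> / g2))" .
  have "(g2 / g ^ 2) ^ N * (\<beta> * g / g2) ^ (2 * (k * n)) \<le>
     exp (p * (1 - p) * \<eta> ^ 2 / g ^ 2) ^ N * exp (- ((1 - p) * \<eta> / g2)) ^ (2 * (k * n))"
    using A B g g2 \<beta>(2) by (intro mult_mono power_mono) auto
  also have "\<dots> = exp (N * (p * (1 - p) * \<eta> ^ 2 / g ^ 2) - 2 * k * n * ((1 - p) * \<eta> / g2))"
    by (simp add: exp_of_nat_mult[symmetric] exp_add[symmetric] algebra_simps)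
  also have "\<dots> \<le> exp (- (2 * real k ^ 2 * ((1 - p) / (p * \<beta> ^ 2))) + 4 * real k ^ 2 / p * (1 / \<beta> ^ 2 - 1))"
  proof -
    define K where "K = 2 * real k ^ 2 / p"
    have K: "K \<ge> 0" unfolding K_def using p by simp
    have "N * (p * (1 - p) * \<eta> ^ 2 / g ^ 2) \<le> (real n ^ 2 / 2) * (p * (1 - p) * \<eta> ^ 2 / g ^ 2)"
      unfolding N_def using p card_potential_edges by (intro mult_right_mono) auto
    also have "\<dots> = (1 - p) * K / g ^ 2"
      unfolding eta(1) K_def using p n0 g by (simp add: power2_eq_square field_simps)
    also have "\<dots> \<le> (1 - p) * K / \<beta> ^ 2"
      using p K gb \<beta>(2) by (intro divide_left_mono power_mono mult_pos_pos zero_less_power g) auto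
    finally have 1: "N * (p * (1 - p) * \<eta> ^ 2 / g ^ 2) \<le> (1 - p) * K * (1 / \<beta> ^ 2)" by simp
    have eq: "2 * k * n * ((1 - p) * \<eta> / g2) = (1 - p) * K * (2 / g2)"
      unfolding eta(1) K_def using p n0 g2 by (simp add: power2_eq_square field_simps)
    have "(1 - p) * K * (2 / g2) \<ge> (1 - p) * K * 2"
    proof (rule mult_left_mono)
      show "2 \<le> 2 / g2" using g2 g21 by (simp add: field_simps)
      show "0 \<le> (1 - p) * K" using p K by (intro mult_nonneg_nonneg) auto
    qed
    then have 2: "2 * k * n * ((1 - p) * \<eta> / g2) \<ge> (1 - p) * K * 2" unfolding eq .
    have b2: "1 / \<beta> ^ 2 - 1 \<ge> 0" using b1 \<beta>(2) by (simp add: power_le_one)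
    \<comment> \<open>The exponent \<open>K' / \<beta>^2 - 2 K'\<close> with
      \<open>K' = (1 - p) K\<close> equals
      \<open>- K' / \<beta>^2 + 2 K' (1 / \<beta>^2 - 1)\<close>; in the error term the factor
      \<open>1 - p\<close> is then dropped.\<close>
    have "(1 - p) * (2 * K * (1 / \<beta> ^ 2 - 1)) \<le> 1 * (2 * K * (1 / \<beta> ^ 2 - 1))"
      using p K b2 by (intro mult_right_mono mult_nonneg_nonneg) auto
    then have "(1 - p) * K * (1 / \<beta> ^ 2) - (1 - p) * K * 2 \<le> - ((1 - p) * K * (1 / \<beta> ^ 2)) + 2 * K * (1 / \<beta> ^ 2 - 1)"
      by (simp add: algebra_simps)
    moreover have "(1 - p) * K * (1 / \<beta> ^ 2) = 2 * real k ^ 2 * ((1 - p) / (p * \<beta> ^ 2))"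
      unfolding K_def by simp
    moreover have "2 * K * (1 / \<beta> ^ 2 - 1) = 4 * real k ^ 2 / p * (1 / \<beta> ^ 2 - 1)"
      unfolding K_def by simp
    ultimately show ?thesis using 1 2 by simp
  qed
  finally show ?thesis unfolding exp_add g_def g2_def N_def .
qed

lemma rate_mono: "0 \<le> s \<Longrightarrow> s \<le> s' \<Longrightarrow> Y \<ge> 1 \<Longrightarrow> rate Y s \<le> rate Y s'"
  unfolding rate_def using \<kappa>_nonneg
  by (intro add_mono mult_right_mono mult_left_mono divide_right_mono) auto

text \<open>The single common edges give \<open>exp (2 k^2 y)\<close>, and the tilt factor gives its
  inverse. What is left depends on \<open>y\<close> only through its bound \<open>Y\<close>, and
  \<open>\<rho> ^ V\<close> has to outweigh the exponential above it.\<close>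

lemma contains_lower_bound:
  assumes k: "k \<ge> 3" and p: "0 < p" "p \<le> 1" and \<beta>: "\<beta> = 1 - 2 * real k / (real n * p)" "\<beta> > 0"
    and Y: "(1 - p) / (p * \<beta> ^ 2) \<le> Y" "Y \<ge> 1" and \<rho>: "\<rho> \<ge> 1" and V: "real V ^ 2 < real n"
    and rate: "rate Y (exp 1 * \<rho>) < 1"
  shows "measure_pmf.prob (binomial_random_graph n p) {G. contains_copy G (hamilton_cycle_power k n)} \<ge>
    1 / (exp (4 * real k ^ 2 / p * (1 / \<beta> ^ 2 - 1)) *
      (exp (large_bound Y 1) / (1 - real V ^ 2 / real n) +
       exp (2 * real k ^ 2 * Y * (exp 1 * \<rho>) ^ 2 + large_bound Y (exp 1 * \<rho>)) / \<rho> ^ V))"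
proof -
  let ?s = "exp 1 * \<rho>" and ?D = "1 - real V ^ 2 / real n" and ?c = "2 * real k ^ 2"
  define y where "y = (1 - p) / (p * \<beta> ^ 2)"
  have n0: "real n > 0" using n1 by simp
  have y: "0 \<le> y" "y \<le> Y" using p \<beta>(2) Y unfolding y_def by auto
  have D: "?D > 0" using V n0 by simp
  have s: "1 \<le> ?s" using \<rho> mult_mono[of 1 "exp 1" 1 \<rho>] by simp
  have b1: "\<beta> \<le> 1" unfolding \<beta>(1) using p n0 by simp
  let ?M = "(\<Sum>\<sigma>\<in>perms. (1 + y) ^ overlap \<sigma>) / fact n"
  let ?B = "exp (large_bound Y 1) / ?D + exp (?c * Y * ?s ^ 2 + large_bound Y ?s) / \<rho> ^ V"
  let ?F = "exp (4 * real k ^ 2 / p * (1 / \<beta> ^ 2 - 1))"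
  have "?M \<le> exp (\<Sum>\<gamma>\<in>polymers. weight y 1 \<gamma>) / ?D + exp (\<Sum>\<gamma>\<in>polymers. weight y ?s \<gamma>) / \<rho> ^ V"
    using sum_perms_le[OF y(1) \<rho> V] by (simp add: field_simps)
  also have "\<dots> \<le> exp (?c * y * 1 ^ 2 + large_bound Y 1) / ?D + exp (?c * y * ?s ^ 2 + large_bound Y ?s) / \<rho> ^ V"
    using D \<rho> s rate rate_mono[of 1 ?s Y] Y(2)
    by (intro add_mono divide_right_mono exp_le_cancel_iff[THEN iffD2] sum_polymers_le k y) auto
  \<comment> \<open>In the second summand the factor \<open>exp (?c * y) \<ge> 1\<close> is simply
    inserted, so that it can be taken out of both and cancel against the tilt.\<close>
  also have "\<dots> \<le> exp (?c * y) * ?B"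
  proof -
    have "exp (?c * y * ?s ^ 2 + large_bound Y ?s) \<le> exp (?c * y) * exp (?c * Y * ?s ^ 2 + large_bound Y ?s)"
    proof -
      have "?c * y * ?s ^ 2 \<le> ?c * Y * ?s ^ 2" using y by (intro mult_right_mono mult_left_mono) auto
      then have "exp (?c * y * ?s ^ 2 + large_bound Y ?s) \<le> 1 * exp (?c * Y * ?s ^ 2 + large_bound Y ?s)" by simp
      also have "\<dots> \<le> exp (?c * y) * exp (?c * Y * ?s ^ 2 + large_bound Y ?s)"
        using y by (intro mult_right_mono) auto
      finally show ?thesis .
    qed
    then have "exp (?c * y * ?s ^ 2 + large_bound Y ?s) / \<rho> ^ V \<le> exp (?c * y) * exp (?c * Y * ?s ^ 2 + large_bound Y ?s) / \<rho> ^ V"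
      using \<rho> by (intro divide_right_mono) auto
    then show ?thesis by (simp add: exp_add distrib_left)
  qed
  finally have M: "?M \<le> exp (?c * y) * ?B" .
  define R where "R = ((1 - p + p * \<beta> ^ 2) / (1 - p + p * \<beta>) ^ 2) ^ card (potential_edges n) *
      (\<beta> * (1 - p + p * \<beta>) / (1 - p + p * \<beta> ^ 2)) ^ (2 * (k * n)) * ?M"
  have R: "R > 0" "measure_pmf.prob (binomial_random_graph n p) {G. contains_copy G (hamilton_cycle_power k n)} \<ge> 1 / R"
    using second_moment[OF p \<beta>(2) b1] unfolding R_def y_def by blast+
  have "R \<le> (exp (- (?c * y)) * ?F) * (exp (?c * y) * ?B)"
    unfolding R_def
  proof (rule mult_mono[OF _ M])
    show "((1 - p + p * \<beta> ^ 2) / (1 - p + p * \<beta>) ^ 2) ^ card (potential_edges n) *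
      (\<beta> * (1 - p + p * \<beta>) / (1 - p + p * \<beta> ^ 2)) ^ (2 * (k * n)) \<le> exp (- (?c * y)) * ?F"
      using tilt_factor_le[OF p \<beta>] unfolding y_def .
    show "0 \<le> ?M" using y by (intro divide_nonneg_nonneg sum_nonneg) auto
  qed simp
  also have "\<dots> = ?F * ?B" by (simp add: exp_minus field_simps)
  finally have "1 / (?F * ?B) \<le> 1 / R" using R(1) by (simp add: frac_le)
  then show ?thesis using R(2) by linarith
qed

lemma large_bound_le:
  assumes Y: "Y \<ge> 1" and s: "0 \<le> s" "s \<le> s'" and q: "rate Y s' \<le> q" "q < 1"
  shows "large_bound Y s \<le> Q * (\<kappa> * s') ^ 3 / (1 - q) * (Y ^ 3 / n) + Q / (1 - q) * (real n ^ 2 * q ^ (n div k))"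
proof -
  have n0: "real n > 0" using n1 by simp
  have r: "0 \<le> rate Y s" "rate Y s \<le> q" using rate_nonneg[OF Y s(1)] rate_mono[OF s Y] q by auto
  have "n * Q * (\<kappa> * (s / n) * Y) ^ 3 / (1 - rate Y s) \<le> n * Q * (\<kappa> * (s' / n) * Y) ^ 3 / (1 - q)"
    using r q Q_ge_1 \<kappa>_nonneg s Y n0
    by (intro frac_le mult_left_mono power_mono mult_right_mono divide_right_mono) auto
  moreover have "n * Q * rate Y s ^ (n div k) / (1 - rate Y s) \<le> n * Q * q ^ (n div k) / (1 - q)"
    using r q Q_ge_1 by (intro frac_le mult_left_mono power_mono) auto
  ultimately have "large_bound Y s \<le> n * (n * Q * (\<kappa> * (s' / n) * Y) ^ 3 / (1 - q) + n * Q * q ^ (n div k) / (1 - q))"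
    unfolding large_bound_def by (intro mult_left_mono add_mono) auto
  also have "\<dots> = Q * (\<kappa> * s') ^ 3 / (1 - q) * (Y ^ 3 / n) + Q / (1 - q) * (real n ^ 2 * q ^ (n div k))"
  proof -
    define D where "D = 1 - q"
    have "D \<noteq> 0" using q unfolding D_def by simp
    then show ?thesis
      unfolding D_def[symmetric] using n0 by (simp add: power2_eq_square power3_eq_cube field_simps)
  qed
  finally show ?thesis .
qed

end

section \<open>The two sides of the threshold\<close>

lemma fact_upper:
  assumes "n \<ge> 1"
  shows "fact n \<le> exp 1 * real n * (real n / exp 1) ^ n"
  using assms
proof (induction n rule: dec_induct)
  case (step n)
  have n0: "real n > 0" using step by simp
  have "(real n / real (Suc n)) ^ Suc n = (1 + (- (1 / real (Suc n)))) ^ Suc n"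
    by (intro arg_cong2[where f = power]) (auto simp: field_simps)
  also have "\<dots> \<le> exp (- (1 / real (Suc n))) ^ Suc n"
    by (intro power_mono exp_ge_add_one_self) (auto simp: field_simps)
  also have "\<dots> = exp (-1)"
    unfolding exp_of_nat_mult[symmetric] by simp
  finally have "(real n / real (Suc n)) ^ Suc n \<le> exp (-1)" .
  then have *: "exp 1 * real n ^ Suc n \<le> real (Suc n) ^ Suc n"
    by (simp add: power_divide exp_minus field_simps del: power_Suc of_nat_Suc)
  have "fact (Suc n) = real (Suc n) * fact n" by simp
  also have "\<dots> \<le> real (Suc n) * (exp 1 * real n * (real n / exp 1) ^ n)"
    using step.IH by (intro mult_left_mono) auto
  also have "\<dots> = real (Suc n) * (exp 1 * real n ^ Suc n) / exp 1 ^ n" by (simp add: power_divide)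
  also have "\<dots> \<le> real (Suc n) * real (Suc n) ^ Suc n / exp 1 ^ n"
    using * by (intro divide_right_mono mult_left_mono) auto
  also have "\<dots> = exp 1 * real (Suc n) * (real (Suc n) / exp 1) ^ Suc n" by (simp add: power_divide)
  finally show ?case .
qed simp

lemma p_star_power:
  assumes "k \<ge> 1" "n \<ge> 1"
  shows "p_star k n ^ k = exp 1 / real n"
proof -
  have "p_star k n ^ k = p_star k n powr real k"
    unfolding p_star_def using assms by (subst powr_realpow) auto
  also have "\<dots> = exp 1 / real n" unfolding p_star_def using assms by (simp add: powr_powr)
  finally show ?thesis .
qed

lemma threshold_lower:
  fixes p :: "nat \<Rightarrow> real"
  assumes k: "k \<ge> 4" and \<epsilon>: "\<epsilon> > 0" and p: "\<And>n. 0 \<le> p n \<and> p n \<le> 1"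
    and small: "\<forall>\<^sub>F n in sequentially. p n \<le> (1 - \<epsilon>) * p_star k n"
  shows "with_high_probability (\<lambda>n. binomial_random_graph n (p n))
              (\<lambda>n G. \<not> contains_copy G (hamilton_cycle_power k n))"
proof -
  \<comment> \<open>\<open>\<epsilon>\<close> may exceed 1, and the maximum keeps the base of the
    powers nonnegative.\<close>
  define c where "c = max 0 (1 - \<epsilon>)"
  have c: "0 \<le> c" "c < 1" unfolding c_def using \<epsilon> by auto
  have ck: "norm (c ^ k) < 1" using c k by (simp add: power_Suc_less_one power_less_one_iff)
  let ?P = "\<lambda>n. measure_pmf.prob (binomial_random_graph n (p n))
    {G. contains_copy G (hamilton_cycle_power k n)}"
  have lim: "(\<lambda>n. exp 1 * (real n * (c ^ k) ^ n)) \<longlonglongrightarrow> 0"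
    using tendsto_mult_right_zero[OF powser_times_n_limit_0[OF ck]] by simp
  have bound: "\<forall>\<^sub>F n in sequentially. ?P n \<le> exp 1 * (real n * (c ^ k) ^ n)"
    using small eventually_gt_at_top[of "4 * k"]
  proof eventually_elim
    case (elim n)
    interpret cycle_power n k by unfold_locales (use k elim in auto)
    have ps: "p_star k n \<ge> 0" unfolding p_star_def by simp
    have "(1 - \<epsilon>) * p_star k n \<le> c * p_star k n"
      using ps by (intro mult_right_mono) (auto simp: c_def)
    then have pc: "p n \<le> c * p_star k n" using elim by linarith
    have "?P n \<le> fact n * p n ^ (k * n)" using p by (intro first_moment) auto
    also have "\<dots> \<le> fact n * (c * p_star k n) ^ (k * n)"
      using p pc by (intro mult_left_mono power_mono) auto
    also have "\<dots> = fact n * (c ^ k * (exp 1 / real n)) ^ n"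
      using p_star_power[of k n] k1 n1 by (simp add: power_mult power_mult_distrib)
    also have "\<dots> \<le> (exp 1 * real n * (real n / exp 1) ^ n) * (c ^ k * (exp 1 / real n)) ^ n"
      using fact_upper[OF n1] c by (intro mult_right_mono) auto
    also have "\<dots> = exp 1 * (real n * (c ^ k) ^ n)"
      using n1 by (simp add: power_mult_distrib power_divide)
    finally show ?case .
  qed
  have P0: "?P \<longlonglongrightarrow> 0"
    by (rule tendsto_sandwich[OF _ bound tendsto_const lim]) auto
  have "measure_pmf.prob (binomial_random_graph n (p n)) {G. \<not> contains_copy G (hamilton_cycle_power k n)} = 1 - ?P n" for n
    using measure_pmf.prob_compl[of "{G. contains_copy G (hamilton_cycle_power k n)}" "binomial_random_graph n (p n)"]
    by (simp add: Compl_eq_Diff_UNIV[symmetric] Collect_neg_eq)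
  then show ?thesis
    unfolding with_high_probability_def using tendsto_diff[OF tendsto_const P0, of 1] by simp
qed

lemma threshold_upper:
  fixes p :: "nat \<Rightarrow> real"
  assumes k: "k \<ge> 4" and \<epsilon>: "\<epsilon> > 0" and p: "\<And>n. 0 \<le> p n \<and> p n \<le> 1"
    and large: "\<forall>\<^sub>F n in sequentially. p n \<ge> (1 + \<epsilon>) * p_star k n"
  shows "with_high_probability (\<lambda>n. binomial_random_graph n (p n))
              (\<lambda>n G. contains_copy G (hamilton_cycle_power k n))"
proof -
  define c where "c = 1 + \<epsilon>"
  \<comment> \<open>The room between \<open>c'\<close> and \<open>c\<close> absorbs the factor
    \<open>1 / \<beta> ^ 2\<close> in \<open>y \<le> Y\<close>. The room between \<open>1\<close>
    and \<open>c'\<close> makes \<open>c'\<close> usable as \<open>\<rho>\<close>.\<close>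
  define c' where "c' = 1 + \<epsilon> / 2"
  have c: "1 < c'" "c' < c" unfolding c_def c'_def using \<epsilon> by auto
  define s where "s = exp 1 * c'"
  have s: "s \<ge> 1" unfolding s_def using c mult_mono[of 1 "exp 1" 1 c'] by simp
  \<comment> \<open>This is the value of \<open>s / n * Y n ^ k\<close>, the contribution of a full
    vertex. One of the \<open>k\<close> factors \<open>1 / c'\<close> in \<open>Y n ^ k\<close> pays
    for \<open>\<rho>\<close>, and the others bring it below 1.\<close>
  define r where "r = c' / c' ^ k"
  have r: "0 < r" "r < 1"
  proof -
    have "c' ^ 1 < c' ^ k" using c k by (intro power_strict_increasing) auto
    then show "0 < r" "r < 1" unfolding r_def using c by auto
  qed
  \<comment> \<open>The room above \<open>r\<close> absorbs the letters that are not full, whose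
    part of the rate tends to zero.\<close>
  define q where "q = (1 + r) / 2"
  have q: "0 < q" "q < 1" "r < q" unfolding q_def using r by auto
  \<comment> \<open>\<open>Q\<close> and \<open>\<kappa>\<close> depend on \<open>k\<close> alone,
    so they are constants as \<open>n\<close> grows.\<close>
  define Qc where "Qc = cycle_power.Q k"
  define Kc where "Kc = cycle_power.\<kappa> k"
  define Y0 where "Y0 n = (real n / exp 1) powr (1 / real k)" for n :: nat
  define Y where "Y n = Y0 n / c'" for n
  define b0 where "b0 n = 1 - 2 * real k * (Y0 n / real n)" for n
  \<comment> \<open>The exponent lies below \<open>1/2\<close>, so that \<open>V ^ 2 / n\<close>
    vanishes, and above \<open>1/4\<close>, so that \<open>c' ^ V\<close> beats
    \<open>exp (A * Y)\<close>.\<close>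
  define V where "V n = nat \<lfloor>real n powr (2/5)\<rfloor>" for n :: nat
  \<comment> \<open>The powers \<open>-1/4\<close>, \<open>-1/2\<close> and \<open>-1/5\<close> of
    \<open>n\<close> in \<open>L\<close>, \<open>T\<close> and \<open>U\<close> bound
    \<open>Y ^ 3 / n\<close>, \<open>Y0 ^ 2 / n\<close> and \<open>V ^ 2 / n\<close>.\<close>
  define L where "L n = Qc * (Kc * s) ^ 3 / (1 - q) * real n powr (-1/4) + Qc / (1 - q) * (real n ^ 2 * q ^ (n div k))" for n :: nat
  define T where "T n = 16 * real k ^ 3 * (real n powr (-1/2) / b0 n ^ 2)" for n
  define A where "A = 2 * real k ^ 2 * s ^ 2"
  \<comment> \<open>The last summand \<open>ln c'\<close> pays for rounding down in
    \<open>V\<close>.\<close>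
  define G where "G n = L n + (A * real n powr (1/4) - ln c' * real n powr (2/5) + ln c')" for n :: nat
  define U where "U n = exp (T n) * (exp (L n) / (1 - real n powr (-1/5)) + exp (G n))" for n
  let ?P = "\<lambda>n. measure_pmf.prob (binomial_random_graph n (p n))
    {G. contains_copy G (hamilton_cycle_power k n)}"
  \<comment> \<open>Here \<open>k \<ge> 4\<close> becomes an exponent. For \<open>n \<ge> 3\<close>
    the base \<open>n / e\<close> is at least 1, so a larger exponent gives a larger power.\<close>
  have Y0_le: "Y0 n \<le> real n powr (1/4)" if "n \<ge> 3" for n
  proof -
    have e: "1 \<le> real n / exp 1" using that e_less_272 by (simp add: field_simps)
    have "Y0 n \<le> (real n / exp 1) powr (1/4)"
      unfolding Y0_def using e k by (intro powr_mono) (auto simp: field_simps)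
    also have "\<dots> \<le> real n powr (1/4)"
    proof (rule powr_mono2)
      have "real n * 1 \<le> real n * exp 1" by (intro mult_left_mono) auto
      then show "real n / exp 1 \<le> real n" by (simp add: field_simps)
    qed auto
    finally show ?thesis .
  qed
  have Y0_top: "filterlim Y0 at_top sequentially"
    unfolding Y0_def using k by real_asymp
  have Y_top: "filterlim Y at_top sequentially"
    unfolding Y_def using filterlim_tendsto_pos_mult_at_top[OF tendsto_const _ Y0_top, of "1 / c'"] c by simp
  have Y0_lim: "(\<lambda>n. Y0 n / real n) \<longlonglongrightarrow> 0"
  proof (rule tendsto_sandwich[OF _ _ tendsto_const])
    show "(\<lambda>n. real n powr (1/4) / real n) \<longlonglongrightarrow> 0" by real_asymp
    show "\<forall>\<^sub>F n in sequentially. Y0 n / real n \<le> real n powr (1/4) / real n"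
      using eventually_ge_at_top[of 3] by eventually_elim (auto intro: divide_right_mono Y0_le)
  qed (simp add: Y0_def)
  have b0_lim: "b0 \<longlonglongrightarrow> 1"
    unfolding b0_def using tendsto_diff[OF tendsto_const tendsto_mult_right_zero[OF Y0_lim], of 1] by simp
  have T_lim: "T \<longlonglongrightarrow> 0"
  proof -
    have "(\<lambda>n. real n powr (-1/2)) \<longlonglongrightarrow> 0" by real_asymp
    from tendsto_divide[OF this tendsto_power[OF b0_lim, of 2]]
    have "(\<lambda>n. real n powr (-1/2) / b0 n ^ 2) \<longlonglongrightarrow> 0" by simp
    then show ?thesis unfolding T_def by (rule tendsto_mult_right_zero)
  qed
  have geo: "(\<lambda>n. real n ^ 2 * q ^ (n div k)) \<longlonglongrightarrow> 0"
  proof (rule tendsto_sandwich[OF _ _ tendsto_const])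
    define d where "d = - ln q / real k"
    have "d > 0" unfolding d_def using q k by (simp add: divide_neg_pos)
    then have "(\<lambda>n. real n ^ 2 * exp (- d * real n)) \<longlonglongrightarrow> 0" by real_asymp
    \<comment> \<open>The factor \<open>exp (- ln q) = 1 / q\<close> accounts for
      \<open>n div k \<ge> n / k - 1\<close>.\<close>
    then have "(\<lambda>n. exp (- ln q) * (real n ^ 2 * exp (- d * real n))) \<longlonglongrightarrow> 0"
      by (rule tendsto_mult_right_zero)
    moreover have "exp (- ln q) * (real n ^ 2 * exp (- d * real n)) = real n ^ 2 * exp ((real n / real k - 1) * ln q)" for n
    proof -
      have "(real n / real k - 1) * ln q = - ln q + - d * real n" unfolding d_def by (simp add: algebra_simps)
      then show ?thesis by (simp only: exp_add mult_ac)
    qed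
    ultimately show "(\<lambda>n. real n ^ 2 * exp ((real n / real k - 1) * ln q)) \<longlonglongrightarrow> 0" by (simp only:)
    show "\<forall>\<^sub>F n in sequentially. real n ^ 2 * q ^ (n div k) \<le> real n ^ 2 * exp ((real n / real k - 1) * ln q)"
    proof (rule always_eventually, rule allI, rule mult_left_mono)
      fix n :: nat
      have "n \<le> k * (n div k) + k" using k by (metis add_le_mono le_refl less_imp_le mod_less_divisor
            mult_div_mod_eq not_gr_zero not_numeral_le_zero)
      then have "real n \<le> real (k * (n div k) + k)" by (rule of_nat_mono)
      then have d: "real n / real k - 1 \<le> real (n div k)" using k by (simp add: field_simps)
      have "q ^ (n div k) = exp (real (n div k) * ln q)" using q by (simp add: exp_of_nat_mult)
      also have "\<dots> \<le> exp ((real n / real k - 1) * ln q)"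
        using d q by (simp add: mult_right_mono_neg)
      finally show "q ^ (n div k) \<le> exp ((real n / real k - 1) * ln q)" .
    qed simp
  qed (use q in simp)
  have L_lim: "L \<longlonglongrightarrow> 0"
  proof -
    have "(\<lambda>n. real n powr (-1/4)) \<longlonglongrightarrow> 0" by real_asymp
    from tendsto_add[OF tendsto_mult_right_zero[OF this] tendsto_mult_right_zero[OF geo]]
    show ?thesis unfolding L_def add_0_left .
  qed
  have G_lim: "(\<lambda>n. exp (G n)) \<longlonglongrightarrow> 0"
  proof -
    have "ln c' > 0" "A > 0" unfolding A_def using c k s by auto
    then have "filterlim (\<lambda>n. A * real n powr (1/4) - ln c' * real n powr (2/5) + ln c') at_bot sequentially"
      by real_asymp
    from tendsto_mult[OF tendsto_exp[OF L_lim] filterlim_compose[OF exp_at_bot this]]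
    show ?thesis unfolding G_def exp_add by simp
  qed
  have U_lim: "U \<longlonglongrightarrow> 1"
  proof -
    have "(\<lambda>n. real n powr (-1/5)) \<longlonglongrightarrow> 0" by real_asymp
    then have "U \<longlonglongrightarrow> exp 0 * (exp 0 / (1 - 0) + 0)"
      unfolding U_def using T_lim L_lim G_lim by (intro tendsto_intros) auto
    then show ?thesis by simp
  qed
  have "c' / c < 1" using c by simp
  moreover have "(\<lambda>n. b0 n ^ 2) \<longlonglongrightarrow> 1" using tendsto_power[OF b0_lim, of 2] by simp
  ultimately have ev_b0: "\<forall>\<^sub>F n in sequentially. c' / c < b0 n ^ 2" by (rule order_tendstoD(1)[rotated])
  have ev_b0': "\<forall>\<^sub>F n in sequentially. 0 < b0 n" using b0_lim by (rule order_tendstoD) simp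
  have ev_Y: "\<forall>\<^sub>F n in sequentially. 1 \<le> Y n" using Y_top by (simp add: filterlim_at_top)
  have "(\<lambda>n. r + Kc * r / Y n) \<longlonglongrightarrow> r + 0"
    using Y_top by (intro tendsto_add tendsto_const tendsto_divide_0[OF tendsto_const] filterlim_at_top_imp_at_infinity)
  then have ev_rate: "\<forall>\<^sub>F n in sequentially. r + Kc * r / Y n < q" using q(3) by (intro order_tendstoD(2)) auto
  have bound: "\<forall>\<^sub>F n in sequentially. 1 / U n \<le> ?P n"
    using large ev_b0 ev_b0' ev_Y ev_rate eventually_gt_at_top[of "4 * k"]
  proof eventually_elim
    case (elim n)
    interpret cycle_power n k by unfold_locales (use k elim in auto)
    have n3: "n \<ge> 3" "real n > 0" using elim k by auto
    have ps: "p_star k n = 1 / Y0 n"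
      unfolding p_star_def Y0_def using n3 by (simp add: powr_divide)
    have Y00: "Y0 n > 0" unfolding Y0_def using n3 by simp
    have Y0k: "Y0 n ^ k = real n / exp 1"
      using p_star_power[OF k1 n1] n3 Y00 unfolding ps by (simp add: power_divide field_simps)
    define \<beta> where "\<beta> = 1 - 2 * real k / (real n * p n)"
    have pn: "c / Y0 n \<le> p n" using elim(1) unfolding ps c_def by simp
    have p0: "0 < p n" using pn c Y00 by (meson divide_pos_pos less_le_trans less_trans zero_less_one)
    \<comment> \<open>Below, \<open>p\<close> enters only through this bound on \<open>1 / p\<close>
      and through \<open>0 < p \<le> 1\<close>, so it may lie arbitrarily far above the
      threshold.\<close>
    have pinv: "1 / p n \<le> Y0 n / c" using pn p0 Y00 c by (simp add: field_simps)
    have "Y0 n / c \<le> Y0 n" using Y00 c by (simp add: field_simps)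
    then have pinv': "1 / p n \<le> Y0 n" using pinv by linarith
    have b: "b0 n \<le> \<beta>" "0 < \<beta>"
    proof -
      have "2 * real k / (real n * p n) = 2 * real k / real n * (1 / p n)" by simp
      also have "\<dots> \<le> 2 * real k / real n * Y0 n" using pinv' by (intro mult_left_mono) auto
      finally show "b0 n \<le> \<beta>" unfolding b0_def \<beta>_def by simp
      then show "0 < \<beta>" using elim by simp
    qed
    have b1: "\<beta> \<le> 1" unfolding \<beta>_def using p0 n3 by simp
    have y: "(1 - p n) / (p n * \<beta> ^ 2) \<le> Y n"
    proof -
      have "c' / c \<le> \<beta> ^ 2"
        using elim(2) power_mono[OF b(1), of 2] elim(3) by simp
      then have *: "1 / \<beta> ^ 2 \<le> c / c'" using b(2) c by (simp add: field_simps)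
      have "(1 - p n) / (p n * \<beta> ^ 2) \<le> 1 / (p n * \<beta> ^ 2)"
        using p[of n] p0 b by (intro divide_right_mono) auto
      also have "\<dots> = (1 / p n) * (1 / \<beta> ^ 2)" by simp
      also have "\<dots> \<le> (Y0 n / c) * (c / c')"
        using pinv * p0 b c Y00 by (intro mult_mono) auto
      also have "\<dots> = Y n" unfolding Y_def using c by simp
      finally show ?thesis .
    qed
    have Yk: "s / real n * Y n ^ k = r"
      unfolding Y_def power_divide Y0k s_def r_def using n3 by (simp add: field_simps)
    have rate: "rate (Y n) s \<le> q"
    proof -
      have "Y n ^ k = Y n * Y n ^ (k - 1)" using k1 by (metis Suc_diff_1 power_Suc less_le_trans zero_less_one)
      then have eq: "s / real n * Y n ^ (k - 1) = r / Y n" using Yk elim(4) by (simp add: field_simps)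
      have "rate (Y n) s = r + Kc * (s / real n * Y n ^ (k - 1))"
        by (simp only: rate_def Yk Kc_def mult.assoc)
      then have "rate (Y n) s = r + Kc * r / Y n" unfolding eq by simp
      then show ?thesis using elim(5) by simp
    qed
    have rate1: "rate (Y n) (exp 1 * c') < 1" using rate q unfolding s_def by simp
    have Vn: "real (V n) \<le> real n powr (2/5)" "real n powr (2/5) \<le> real (V n) + 1"
      unfolding V_def by (simp_all add: of_nat_nat)
    have V2: "real (V n) ^ 2 / real n \<le> real n powr (-1/5)"
    proof -
      have "real (V n) ^ 2 \<le> (real n powr (2/5)) ^ 2" using Vn(1) by (intro power_mono) auto
      also have "\<dots> = real n powr (4/5)" using n3 by (simp add: powr_power)
      also have "\<dots> = real n powr (-1/5) * real n" using n3 by (simp add: powr_mult_base mult.commute)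
      finally show ?thesis using n3 by (simp add: field_simps)
    qed
    have small: "real n powr (-1/5) < 1" using n3 by (intro powr_less_one) auto
    have "real (V n) ^ 2 / real n < 1" using V2 small by linarith
    then have V3: "real (V n) ^ 2 < real n" by (rule divide_less_eq_1_pos[OF n3(2), THEN iffD1])
    have LB: "large_bound (Y n) s' \<le> L n" if "0 \<le> s'" "s' \<le> s" for s'
    proof -
      have "Y n ^ 3 / real n \<le> real n powr (-1/4)"
      proof -
        have "Y n \<le> Y0 n" unfolding Y_def using Y00 c by (simp add: field_simps)
        then have "Y n ^ 3 \<le> (real n powr (1/4)) ^ 3" using Y0_le[OF n3(1)] elim(4) by (intro power_mono) auto
        also have "\<dots> = real n powr (3/4)" using n3 by (simp add: powr_power)
        also have "\<dots> = real n powr (-1/4) * real n" using n3 by (simp add: powr_mult_base mult.commute)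
        finally show ?thesis using n3 by (simp add: field_simps)
      qed
      then have "cycle_power.Q k * (cycle_power.\<kappa> k * s) ^ 3 / (1 - q) * (Y n ^ 3 / n) \<le>
          cycle_power.Q k * (cycle_power.\<kappa> k * s) ^ 3 / (1 - q) * real n powr (-1/4)"
        using Q_ge_1 \<kappa>_nonneg s q by (intro mult_left_mono) auto
      then show ?thesis using large_bound_le[OF elim(4) that rate q(2)] unfolding L_def Qc_def Kc_def by linarith
    qed
    have fin1: "4 * real k ^ 2 / p n * (1 / \<beta> ^ 2 - 1) \<le> T n"
    proof -
      define u where "u = 2 * real k * (Y0 n / real n)"
      have u: "b0 n = 1 - u" "u \<ge> 0" unfolding b0_def u_def using Y00 n3 by auto
      have inv: "1 / \<beta> ^ 2 \<le> 1 / b0 n ^ 2" using b elim(3) by (intro divide_left_mono power_mono) auto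
      have "4 * real k ^ 2 / p n * (1 / \<beta> ^ 2 - 1) \<le> 4 * real k ^ 2 * Y0 n * (1 / b0 n ^ 2 - 1)"
      proof (rule mult_mono)
        have "4 * real k ^ 2 * (1 / p n) \<le> 4 * real k ^ 2 * Y0 n"
          using pinv' by (intro mult_left_mono) auto
        then show "4 * real k ^ 2 / p n \<le> 4 * real k ^ 2 * Y0 n" by simp
        show "0 \<le> 1 / \<beta> ^ 2 - 1" using b b1 by (simp add: power_le_one)
      qed (use Y00 inv in auto)
      also have "1 / b0 n ^ 2 - 1 \<le> 2 * u / b0 n ^ 2"
      proof -
        have "1 - b0 n ^ 2 \<le> 2 * u" unfolding u(1) by (simp add: power2_eq_square algebra_simps)
        then have "(1 - b0 n ^ 2) / b0 n ^ 2 \<le> 2 * u / b0 n ^ 2" by (intro divide_right_mono) auto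
        then show ?thesis using elim(3) by (simp add: diff_divide_distrib)
      qed
      then have "4 * real k ^ 2 * Y0 n * (1 / b0 n ^ 2 - 1) \<le> 4 * real k ^ 2 * Y0 n * (2 * u / b0 n ^ 2)"
        using Y00 by (intro mult_left_mono) auto
      also have "\<dots> = 16 * real k ^ 3 * (Y0 n ^ 2 / real n / b0 n ^ 2)"
        unfolding u_def by (simp add: power2_eq_square power3_eq_cube)
      also have "\<dots> \<le> 16 * real k ^ 3 * (real n powr (-1/2) / b0 n ^ 2)"
      proof (intro mult_left_mono divide_right_mono)
        have "Y0 n ^ 2 \<le> (real n powr (1/4)) ^ 2" using Y0_le[OF n3(1)] Y00 by (intro power_mono) auto
        also have "\<dots> = real n powr (1/2)" using n3 by (simp add: powr_power)
        also have "\<dots> = real n powr (-1/2) * real n" using n3 by (simp add: powr_mult_base mult.commute)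
        finally show "Y0 n ^ 2 / real n \<le> real n powr (-1/2)" using n3 by (simp add: field_simps)
      qed auto
      finally show ?thesis unfolding T_def .
    qed
    have fin2: "exp (2 * real k ^ 2 * Y n * s ^ 2 + large_bound (Y n) s) / c' ^ V n \<le> exp (G n)"
    proof -
      have "c' ^ V n = exp (real (V n) * ln c')" using c by (simp add: exp_of_nat_mult)
      then have "exp (2 * real k ^ 2 * Y n * s ^ 2 + large_bound (Y n) s) / c' ^ V n =
        exp (2 * real k ^ 2 * Y n * s ^ 2 + large_bound (Y n) s - real (V n) * ln c')" by (simp add: exp_diff)
      also have "\<dots> \<le> exp (G n)"
      proof -
        have "Y n \<le> Y0 n" unfolding Y_def using Y00 c by (simp add: field_simps)
        then have "A * Y n \<le> A * real n powr (1/4)"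
          using Y0_le[OF n3(1)] by (intro mult_left_mono) (auto simp: A_def)
        moreover have "(real n powr (2/5) - 1) * ln c' \<le> real (V n) * ln c'"
          using Vn c by (intro mult_right_mono) auto
        moreover have "(real n powr (2/5) - 1) * ln c' = ln c' * real n powr (2/5) - ln c'"
          by (simp add: algebra_simps)
        moreover have "2 * real k ^ 2 * Y n * s ^ 2 = A * Y n" by (simp add: A_def)
        moreover have "large_bound (Y n) s \<le> L n" using LB[of s] s by simp
        ultimately show ?thesis unfolding G_def exp_le_cancel_iff by linarith
      qed
      finally show ?thesis .
    qed
    have "exp (4 * real k ^ 2 / p n * (1 / \<beta> ^ 2 - 1)) *
      (exp (large_bound (Y n) 1) / (1 - real (V n) ^ 2 / real n) +
       exp (2 * real k ^ 2 * Y n * s ^ 2 + large_bound (Y n) s) / c' ^ V n) \<le> U n"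
      unfolding U_def
    proof (intro mult_mono add_mono fin2)
      show "exp (large_bound (Y n) 1) / (1 - real (V n) ^ 2 / real n) \<le> exp (L n) / (1 - real n powr (-1/5))"
        using LB[of 1] s V2 small by (intro frac_le) auto
      show "0 \<le> exp (large_bound (Y n) 1) / (1 - real (V n) ^ 2 / real n) +
       exp (2 * real k ^ 2 * Y n * s ^ 2 + large_bound (Y n) s) / c' ^ V n"
        using V3 n3 c by (intro add_nonneg_nonneg divide_nonneg_nonneg) auto
    qed (use fin1 in auto)
    moreover have "0 < exp (4 * real k ^ 2 / p n * (1 / \<beta> ^ 2 - 1)) *
      (exp (large_bound (Y n) 1) / (1 - real (V n) ^ 2 / real n) +
       exp (2 * real k ^ 2 * Y n * s ^ 2 + large_bound (Y n) s) / c' ^ V n)"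
      using V3 n3 c by (intro mult_pos_pos add_pos_pos divide_pos_pos) auto
    ultimately have "1 / U n \<le> 1 / (exp (4 * real k ^ 2 / p n * (1 / \<beta> ^ 2 - 1)) *
      (exp (large_bound (Y n) 1) / (1 - real (V n) ^ 2 / real n) +
       exp (2 * real k ^ 2 * Y n * s ^ 2 + large_bound (Y n) s) / c' ^ V n))"
      by (intro divide_left_mono) auto
    also have "\<dots> \<le> ?P n"
      unfolding s_def
      by (rule contains_lower_bound[OF _ p0 _ \<beta>_def b(2) y elim(4) _ V3 rate1]) (use k p[of n] c in auto)
    finally show ?case .
  qed
  have "(\<lambda>n. 1 / U n) \<longlonglongrightarrow> 1 / 1" using U_lim by (intro tendsto_divide tendsto_const) auto
  then have "?P \<longlonglongrightarrow> 1"
    by (intro tendsto_sandwich[OF bound _ _ tendsto_const]) auto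
  then show ?thesis unfolding with_high_probability_def .
qed

theorem theorem1p1:
  fixes k :: nat and \<epsilon> :: real and p :: "nat \<Rightarrow> real"
  assumes "k \<ge> 4" and "\<epsilon> > 0" and "\<And>n. 0 \<le> p n \<and> p n \<le> 1"
  shows "((\<forall>\<^sub>F n in sequentially. p n \<le> (1 - \<epsilon>) * p_star k n) \<longrightarrow>
            with_high_probability (\<lambda>n. binomial_random_graph n (p n))
              (\<lambda>n G. \<not> contains_copy G (hamilton_cycle_power k n))) \<and>
         ((\<forall>\<^sub>F n in sequentially. p n \<ge> (1 + \<epsilon>) * p_star k n) \<longrightarrow>
            with_high_probability (\<lambda>n. binomial_random_graph n (p n))
              (\<lambda>n G. contains_copy G (hamilton_cycle_power k n)))"
proof (intro conjI impI)
  show "with_high_probability (\<lambda>n. binomial_random_graph n (p n))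
      (\<lambda>n G. \<not> contains_copy G (hamilton_cycle_power k n))"
    if "\<forall>\<^sub>F n in sequentially. p n \<le> (1 - \<epsilon>) * p_star k n"
    using threshold_lower[OF assms that] .
  show "with_high_probability (\<lambda>n. binomial_random_graph n (p n))
      (\<lambda>n G. contains_copy G (hamilton_cycle_power k n))"
    if "\<forall>\<^sub>F n in sequentially. p n \<ge> (1 + \<epsilon>) * p_star k n"
    using threshold_upper[OF assms that] .
qed

end
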